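(* Let $\Lambda=\Lambda_0+\cdots+\Lambda_l$ be a Koszul self-injective algebra of Loewy length $l+1$, and let $\sigma$ be a graded automorphism of $\Lambda$. Set the dual basis elements of the maximal bound paths of $\Lambda$ (the basis of $\Lambda_l^*\subset D\Lambda$) as degree $1$ generators of $D\Lambda^{\sigma}$. Then the twisted trivial extension $\tilde\Lambda^{\sigma}=\Lambda\ltimes D\Lambda^{\sigma}$ is a Koszul algebra.
   Context: $k$ is a field and $D=\mathrm{Hom}_k(-,k)$. A graded algebra is $\Gamma=\bigoplus_{t\ge0}\Gamma_t$, generated by $\Gamma_0$ and $\Gamma_1$, with $\Gamma_0=\bigoplus_{i=1}^n ke_i$, where $1=e_1+\cdots+e_n$ is a decomposition into orthogonal primitive idempotents. A Koszul self-injective algebra is a finite-dimensional graded algebra $\Lambda=\Lambda_0+\cdots+\Lambda_l$ which is Koszul and self-injective; as in the whole paper it is given by a stable bound quiver of Loewy length $l+1$, i.e. all indecomposable projectives have Loewy length $l+1$ and there is a permutation $\tau$ of the vertices such that $e_i\Lambda_le_{\tau i}$ is the one-dimensional socle for each vertex $i$. The maximal bound paths are the paths of length $l$ nonzero in $\Lambda$. The trivial extension $\Lambda\ltimes M$ by a bimodule $M$ is $\Lambda\oplus M$ with $(a,x)(b,y)=(ab,ay+xb)$. A graded automorphism is an algebra automorphism preserving degrees of homogeneous elements. For a graded automorphism $\sigma$ and a $\Lambda$-bimodule $M$, the twist $M^\sigma$ is the vector space $M$ with the same left multiplication and with right multiplication $x\cdot b=x\sigma(b)$. Writing $\Lambda_t^*\subset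 D\Lambda$ for the span of the dual basis elements of a basis of $\Lambda_t$ (so $\Lambda_t^*\cong D(\Lambda_t)$), the grading is $\tilde\Lambda^\sigma_0=\Lambda_0$, $\tilde\Lambda^\sigma_t=\Lambda_t+\Lambda^*_{l+1-t}$ for $1\le t\le l$, $\tilde\Lambda^\sigma_{l+1}=\Lambda^*_0$. *)

theory Defs
  imports "HOL-Algebra.Algebra"
begin

section \<open>Modules over a not necessarily commutative ring\<close>

text \<open>The library locale \<open>module\<close> requires a commutative base ring. The same record type is
  used here for left modules over an arbitrary ring; the fields \<open>mult\<close> and \<open>one\<close> of a module are
  irrelevant. A right \<open>R\<close>-module is a left module over \<open>opposite R\<close>.\<close>

locale left_module = R?: ring R + M?: abelian_group M
  for R :: "('a, 'c) ring_scheme" (structure)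
    and M :: "('a, 'm, 'd) module_scheme" (structure) +
  assumes smult_closed [simp, intro]:
      "\<lbrakk>a \<in> carrier R; x \<in> carrier M\<rbrakk> \<Longrightarrow> a \<odot>\<^bsub>M\<^esub> x \<in> carrier M"
    and smult_l_distr:
      "\<lbrakk>a \<in> carrier R; b \<in> carrier R; x \<in> carrier M\<rbrakk> \<Longrightarrow>
        (a \<oplus> b) \<odot>\<^bsub>M\<^esub> x = a \<odot>\<^bsub>M\<^esub> x \<oplus>\<^bsub>M\<^esub> b \<odot>\<^bsub>M\<^esub> x"
    and smult_r_distr:
      "\<lbrakk>a \<in> carrier R; x \<in> carrier M; y \<in> carrier M\<rbrakk> \<Longrightarrow>
        a \<odot>\<^bsub>M\<^esub> (x \<oplus>\<^bsub>M\<^esub> y) = a \<odot>\<^bsub>M\<^esub> x \<oplus>\<^bsub>M\<^esub> a \<odot>\<^bsub>M\<^esub> y"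
    and smult_assoc1:
      "\<lbrakk>a \<in> carrier R; b \<in> carrier R; x \<in> carrier M\<rbrakk> \<Longrightarrow>
        (a \<otimes> b) \<odot>\<^bsub>M\<^esub> x = a \<odot>\<^bsub>M\<^esub> (b \<odot>\<^bsub>M\<^esub> x)"
    and smult_one [simp]:
      "x \<in> carrier M \<Longrightarrow> \<one> \<odot>\<^bsub>M\<^esub> x = x"

definition opposite :: "('a, 'b) ring_scheme \<Rightarrow> ('a, 'b) ring_scheme" where
  "opposite R = R\<lparr>monoid.mult := (\<lambda>x y. y \<otimes>\<^bsub>R\<^esub> x)\<rparr>"

definition regular_module :: "('a, 'b) ring_scheme \<Rightarrow> ('a, 'a) module" where
  "regular_module R =
    \<lparr>carrier = carrier R, monoid.mult = monoid.mult R, one = monoid.one R,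
     ring.zero = ring.zero R, ring.add = ring.add R,
     smult = monoid.mult R\<rparr>"

definition left_module_hom ::
  "('a, 'c) ring_scheme \<Rightarrow> ('a, 'm) module \<Rightarrow> ('a, 'n) module \<Rightarrow> ('m \<Rightarrow> 'n) set" where
  "left_module_hom R M N =
    {f \<in> carrier M \<rightarrow> carrier N.
      (\<forall>x\<in>carrier M. \<forall>y\<in>carrier M. f (x \<oplus>\<^bsub>M\<^esub> y) = f x \<oplus>\<^bsub>N\<^esub> f y) \<and>
      (\<forall>a\<in>carrier R. \<forall>x\<in>carrier M. f (a \<odot>\<^bsub>M\<^esub> x) = a \<odot>\<^bsub>N\<^esub> f x)}"

definition free_module :: "('a, 'c) ring_scheme \<Rightarrow> 'x set \<Rightarrow> ('a, 'x \<Rightarrow> 'a) module" where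
  "free_module R B =
    \<lparr>carrier = {f \<in> B \<rightarrow>\<^sub>E carrier R. finite {x \<in> B. f x \<noteq> \<zero>\<^bsub>R\<^esub>}},
     monoid.mult = undefined, one = undefined,
     ring.zero = (\<lambda>x\<in>B. \<zero>\<^bsub>R\<^esub>),
     ring.add = (\<lambda>f g. \<lambda>x\<in>B. f x \<oplus>\<^bsub>R\<^esub> g x),
     smult = (\<lambda>a f. \<lambda>x\<in>B. a \<otimes>\<^bsub>R\<^esub> f x)\<rparr>"

text \<open>Direct summand of a free module. Taking the basis \<open>B\<close> inside the type of elements of \<open>P\<close>
  is no restriction: if \<open>P\<close> is projective, it is a retract of the free module on its own
  carrier.\<close>

definition projective_module :: "('a, 'c) ring_scheme \<Rightarrow> ('a, 'p) module \<Rightarrow> bool" where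
  "projective_module R P \<longleftrightarrow> left_module R P \<and>
    (\<exists>B :: 'p set. \<exists>s \<in> left_module_hom R P (free_module R B).
      \<exists>p \<in> left_module_hom R (free_module R B) P. \<forall>x\<in>carrier P. p (s x) = x)"

text \<open>HOL does not allow quantification over modules of all types. The test modules have
  carriers in \<open>nat \<Rightarrow> 'a\<close>, where \<open>'a\<close> is the type of ring elements; up to isomorphism these
  include all countably generated modules, in particular the left ideals, and by Baer's
  criterion the latter suffice.\<close>

definition injective_module :: "('a, 'c) ring_scheme \<Rightarrow> ('a, 'e) module \<Rightarrow> bool" where
  "injective_module R E \<longleftrightarrow> left_module R E \<and>
    (\<forall>(M :: ('a, nat \<Rightarrow> 'a) module) (N :: ('a, nat \<Rightarrow> 'a) module) f g.
      left_module R M \<and> left_module R N \<and>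
      f \<in> left_module_hom R M N \<and> inj_on f (carrier M) \<and> g \<in> left_module_hom R M E \<longrightarrow>
      (\<exists>h \<in> left_module_hom R N E. \<forall>x\<in>carrier M. h (f x) = g x))"

definition self_injective :: "('a, 'c) ring_scheme \<Rightarrow> bool" where
  "self_injective R \<longleftrightarrow> injective_module R (regular_module R)"

definition submodule_span :: "('a, 'c) ring_scheme \<Rightarrow> ('a, 'm) module \<Rightarrow> 'm set \<Rightarrow> 'm set" where
  "submodule_span R M S = \<Inter>{N. submodule N R M \<and> S \<subseteq> N}"

definition simple_submodule :: "('a, 'c) ring_scheme \<Rightarrow> ('a, 'm) module \<Rightarrow> 'm set \<Rightarrow> bool" where
  "simple_submodule R M S \<longleftrightarrow> submodule S R M \<and> S \<noteq> {\<zero>\<^bsub>M\<^esub>} \<and>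
    (\<forall>N. submodule N R M \<and> N \<subseteq> S \<longrightarrow> N = {\<zero>\<^bsub>M\<^esub>} \<or> N = S)"

definition socle :: "('a, 'c) ring_scheme \<Rightarrow> ('a, 'm) module \<Rightarrow> 'm set" where
  "socle R M = submodule_span R M (\<Union>{S. simple_submodule R M S})"

definition maximal_submodule :: "('a, 'c) ring_scheme \<Rightarrow> ('a, 'm) module \<Rightarrow> 'm set \<Rightarrow> bool" where
  "maximal_submodule R M N \<longleftrightarrow> submodule N R M \<and> N \<noteq> carrier M \<and>
    (\<forall>L. submodule L R M \<and> N \<subseteq> L \<longrightarrow> L = N \<or> L = carrier M)"

definition module_radical :: "('a, 'c) ring_scheme \<Rightarrow> ('a, 'm) module \<Rightarrow> 'm set" where
  "module_radical R M = carrier M \<inter> \<Inter>{N. maximal_submodule R M N}"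

primrec radical_series :: "('a, 'c) ring_scheme \<Rightarrow> ('a, 'm) module \<Rightarrow> nat \<Rightarrow> 'm set" where
  "radical_series R M 0 = carrier M"
| "radical_series R M (Suc j) = module_radical R (M\<lparr>carrier := radical_series R M j\<rparr>)"

definition has_loewy_length :: "('a, 'c) ring_scheme \<Rightarrow> ('a, 'm) module \<Rightarrow> nat \<Rightarrow> bool" where
  "has_loewy_length R M m \<longleftrightarrow>
    radical_series R M m = {\<zero>\<^bsub>M\<^esub>} \<and> (\<forall>j<m. radical_series R M j \<noteq> {\<zero>\<^bsub>M\<^esub>})"


section \<open>Graded algebras and graded modules\<close>

locale field_algebra = K?: field K + A?: ring A + module K A
  for K :: "('k, 'c) ring_scheme" (structure) and A :: "('k, 'a, 'd) module_scheme" (structure) +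
  assumes smult_mult_left:
      "\<lbrakk>c \<in> carrier K; x \<in> carrier A; y \<in> carrier A\<rbrakk> \<Longrightarrow>
        (c \<odot>\<^bsub>A\<^esub> x) \<otimes>\<^bsub>A\<^esub> y = c \<odot>\<^bsub>A\<^esub> (x \<otimes>\<^bsub>A\<^esub> y)"
    and smult_mult_right:
      "\<lbrakk>c \<in> carrier K; x \<in> carrier A; y \<in> carrier A\<rbrakk> \<Longrightarrow>
        x \<otimes>\<^bsub>A\<^esub> (c \<odot>\<^bsub>A\<^esub> y) = c \<odot>\<^bsub>A\<^esub> (x \<otimes>\<^bsub>A\<^esub> y)"

definition finite_dimensional :: "('k, 'c) ring_scheme \<Rightarrow> ('k, 'a) module \<Rightarrow> bool" where
  "finite_dimensional K V \<longleftrightarrow>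
    (\<exists>B. finite B \<and> B \<subseteq> carrier V \<and>
      carrier V = {(\<Oplus>\<^bsub>V\<^esub>b\<in>B. c b \<odot>\<^bsub>V\<^esub> b) | c. c \<in> B \<rightarrow> carrier K})"

definition one_dimensional :: "('k, 'c) ring_scheme \<Rightarrow> ('k, 'a) module \<Rightarrow> 'a set \<Rightarrow> bool" where
  "one_dimensional K V U \<longleftrightarrow>
    (\<exists>u \<in> carrier V. u \<noteq> \<zero>\<^bsub>V\<^esub> \<and> U = {c \<odot>\<^bsub>V\<^esub> u | c. c \<in> carrier K})"

definition homogeneous_components ::
  "('m, 'c) ring_scheme \<Rightarrow> (nat \<Rightarrow> 'm set) \<Rightarrow> 'm \<Rightarrow> (nat \<Rightarrow> 'm) \<Rightarrow> bool" where
  "homogeneous_components M H x f \<longleftrightarrow>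
    (\<forall>t. f t \<in> H t) \<and> finite {t. f t \<noteq> \<zero>\<^bsub>M\<^esub>} \<and>
    x = (\<Oplus>\<^bsub>M\<^esub>t\<in>{t. f t \<noteq> \<zero>\<^bsub>M\<^esub>}. f t)"

definition direct_sum_decomposition :: "('m, 'c) ring_scheme \<Rightarrow> (nat \<Rightarrow> 'm set) \<Rightarrow> bool" where
  "direct_sum_decomposition M H \<longleftrightarrow>
    (\<forall>t. additive_subgroup (H t) M) \<and>
    (\<forall>x\<in>carrier M. \<exists>!f. homogeneous_components M H x f)"

definition hom_component :: "('m, 'c) ring_scheme \<Rightarrow> (nat \<Rightarrow> 'm set) \<Rightarrow> nat \<Rightarrow> 'm \<Rightarrow> 'm" where
  "hom_component M H t x = (THE f. homogeneous_components M H x f) t"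

definition idempotent_elem :: "('a, 'c) ring_scheme \<Rightarrow> 'a \<Rightarrow> bool" where
  "idempotent_elem R x \<longleftrightarrow> x \<in> carrier R \<and> x \<otimes>\<^bsub>R\<^esub> x = x"

definition primitive_idempotent :: "('a, 'c) ring_scheme \<Rightarrow> 'a \<Rightarrow> bool" where
  "primitive_idempotent R x \<longleftrightarrow> idempotent_elem R x \<and> x \<noteq> \<zero>\<^bsub>R\<^esub> \<and>
    \<not> (\<exists>f g. idempotent_elem R f \<and> idempotent_elem R g \<and> f \<noteq> \<zero>\<^bsub>R\<^esub> \<and> g \<noteq> \<zero>\<^bsub>R\<^esub> \<and>
        f \<otimes>\<^bsub>R\<^esub> g = \<zero>\<^bsub>R\<^esub> \<and> g \<otimes>\<^bsub>R\<^esub> f = \<zero>\<^bsub>R\<^esub> \<and> x = f \<oplus>\<^bsub>R\<^esub> g)"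

text \<open>As \<open>G 0\<close> contains the scalar multiples of the unit, the subring generated by
  \<open>G 0 \<union> G 1\<close> is the subalgebra generated by it.\<close>

locale graded_algebra = field_algebra K A
  for K :: "('k, 'c) ring_scheme" (structure) and A :: "('k, 'a, 'd) module_scheme" (structure)
    and G :: "nat \<Rightarrow> 'a set" and n :: nat and e :: "nat \<Rightarrow> 'a" +
  assumes vertices: "1 \<le> n"
    and decomposition: "direct_sum_decomposition A G"
    and component_smult: "\<lbrakk>c \<in> carrier K; x \<in> G t\<rbrakk> \<Longrightarrow> c \<odot>\<^bsub>A\<^esub> x \<in> G t"
    and component_mult: "\<lbrakk>x \<in> G s; y \<in> G t\<rbrakk> \<Longrightarrow> x \<otimes>\<^bsub>A\<^esub> y \<in> G (s + t)"
    and generated: "generate_ring A (G 0 \<union> G 1) = carrier A"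
    and primitive: "i \<in> {1..n} \<Longrightarrow> primitive_idempotent A (e i)"
    and orthogonal: "\<lbrakk>i \<in> {1..n}; j \<in> {1..n}; i \<noteq> j\<rbrakk> \<Longrightarrow> e i \<otimes>\<^bsub>A\<^esub> e j = \<zero>\<^bsub>A\<^esub>"
    and one_eq: "\<one>\<^bsub>A\<^esub> = (\<Oplus>\<^bsub>A\<^esub>i\<in>{1..n}. e i)"
    and degree_zero: "G 0 = {(\<Oplus>\<^bsub>A\<^esub>i\<in>{1..n}. c i \<odot>\<^bsub>A\<^esub> e i) | c. c \<in> {1..n} \<rightarrow> carrier K}"

text \<open>Degrees are natural numbers: a graded module over a non-negatively graded algebra which is
  generated in a degree \<open>i \<ge> 0\<close> has no components of negative degree.\<close>

definition graded_left_module ::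
  "('a, 'c) ring_scheme \<Rightarrow> (nat \<Rightarrow> 'a set) \<Rightarrow> ('a, 'm) module \<Rightarrow> (nat \<Rightarrow> 'm set) \<Rightarrow> bool" where
  "graded_left_module A G M H \<longleftrightarrow> left_module A M \<and> direct_sum_decomposition M H \<and>
    (\<forall>s t. \<forall>a\<in>G s. \<forall>x\<in>H t. a \<odot>\<^bsub>M\<^esub> x \<in> H (s + t))"

definition graded_hom ::
  "('a, 'c) ring_scheme \<Rightarrow> ('a, 'm) module \<Rightarrow> (nat \<Rightarrow> 'm set) \<Rightarrow>
    ('a, 'n) module \<Rightarrow> (nat \<Rightarrow> 'n set) \<Rightarrow> ('m \<Rightarrow> 'n) set" where
  "graded_hom A M H N L = {f \<in> left_module_hom A M N. \<forall>t. f ` H t \<subseteq> L t}"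

text \<open>The degree zero part as the graded module \<open>A/A\<^sub>>\<^sub>0\<close>, on which the components of positive
  degree act by zero.\<close>

definition degree_zero_module ::
  "('a, 'c) ring_scheme \<Rightarrow> (nat \<Rightarrow> 'a set) \<Rightarrow> ('a, 'a) module" where
  "degree_zero_module A G =
    \<lparr>carrier = G 0, monoid.mult = monoid.mult A, one = monoid.one A,
     ring.zero = ring.zero A, ring.add = ring.add A,
     smult = (\<lambda>a x. hom_component A G 0 a \<otimes>\<^bsub>A\<^esub> x)\<rparr>"

definition degree_zero_grading ::
  "('a, 'c) ring_scheme \<Rightarrow> (nat \<Rightarrow> 'a set) \<Rightarrow> nat \<Rightarrow> 'a set" where
  "degree_zero_grading A G t = (if t = 0 then G 0 else {\<zero>\<^bsub>A\<^esub>})"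

text \<open>Koszul means that \<open>A\<^sub>0\<close> has a linear resolution: a graded projective resolution whose
  \<open>i\<close>-th term is generated in degree \<open>i\<close>. The terms of such a resolution have at most
  \<open>|A| \<cdot> \<aleph>\<^sub>0\<close> elements up to replacing the resolution by an isomorphic one, so that carriers inside
  \<open>nat \<Rightarrow> 'a\<close> are no restriction.\<close>

definition has_linear_resolution :: "('a, 'c) ring_scheme \<Rightarrow> (nat \<Rightarrow> 'a set) \<Rightarrow> bool" where
  "has_linear_resolution A G \<longleftrightarrow>
    (\<exists>(P :: nat \<Rightarrow> ('a, nat \<Rightarrow> 'a) module) (H :: nat \<Rightarrow> nat \<Rightarrow> (nat \<Rightarrow> 'a) set) d \<epsilon>.
      (\<forall>i. graded_left_module A G (P i) (H i) \<and> projective_module A (P i) \<and>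
           submodule_span A (P i) (H i i) = carrier (P i)) \<and>
      (\<forall>i. d i \<in> graded_hom A (P (Suc i)) (H (Suc i)) (P i) (H i)) \<and>
      \<epsilon> \<in> graded_hom A (P 0) (H 0) (degree_zero_module A G) (degree_zero_grading A G) \<and>
      \<epsilon> ` carrier (P 0) = G 0 \<and>
      d 0 ` carrier (P 1) = {x \<in> carrier (P 0). \<epsilon> x = \<zero>\<^bsub>A\<^esub>} \<and>
      (\<forall>i. d (Suc i) ` carrier (P (Suc (Suc i))) =
           {x \<in> carrier (P (Suc i)). d i x = \<zero>\<^bsub>P i\<^esub>}))"

definition koszul_algebra ::
  "('k, 'c) ring_scheme \<Rightarrow> ('k, 'a) module \<Rightarrow> (nat \<Rightarrow> 'a set) \<Rightarrow> nat \<Rightarrow> (nat \<Rightarrow> 'a) \<Rightarrow> bool" where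
  "koszul_algebra K A G n e \<longleftrightarrow> graded_algebra K A G n e \<and> has_linear_resolution A G"

text \<open>The condition that the bound quiver of \<open>A\<close> is stable of Loewy length \<open>l + 1\<close> with
  permutation \<open>\<tau>\<close>. The indecomposable projectives \<open>e\<^sub>i A\<close> are right modules.\<close>

definition right_projective :: "('a, 'c) ring_scheme \<Rightarrow> 'a \<Rightarrow> ('a, 'a) module" where
  "right_projective A f =
    (regular_module (opposite A))\<lparr>carrier := {f \<otimes>\<^bsub>A\<^esub> x | x. x \<in> carrier A}\<rparr>"

definition stable_bound_quiver_algebra ::
  "('k, 'c) ring_scheme \<Rightarrow> ('k, 'a) module \<Rightarrow> (nat \<Rightarrow> 'a set) \<Rightarrow> nat \<Rightarrow> (nat \<Rightarrow> 'a) \<Rightarrow>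
    nat \<Rightarrow> (nat \<Rightarrow> nat) \<Rightarrow> bool" where
  "stable_bound_quiver_algebra K A G n e l \<tau> \<longleftrightarrow>
    (\<forall>t>l. G t = {\<zero>\<^bsub>A\<^esub>}) \<and>
    bij_betw \<tau> {1..n} {1..n} \<and>
    (\<forall>i\<in>{1..n}.
      has_loewy_length (opposite A) (right_projective A (e i)) (l + 1) \<and>
      one_dimensional K A {e i \<otimes>\<^bsub>A\<^esub> x \<otimes>\<^bsub>A\<^esub> e (\<tau> i) | x. x \<in> G l} \<and>
      socle (opposite A) (right_projective A (e i)) =
        {e i \<otimes>\<^bsub>A\<^esub> x \<otimes>\<^bsub>A\<^esub> e (\<tau> i) | x. x \<in> G l})"

definition koszul_self_injective_algebra ::
  "('k, 'c) ring_scheme \<Rightarrow> ('k, 'a) module \<Rightarrow> (nat \<Rightarrow> 'a set) \<Rightarrow> nat \<Rightarrow> (nat \<Rightarrow> 'a) \<Rightarrow>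
    nat \<Rightarrow> (nat \<Rightarrow> nat) \<Rightarrow> bool" where
  "koszul_self_injective_algebra K A G n e l \<tau> \<longleftrightarrow>
    koszul_algebra K A G n e \<and> finite_dimensional K A \<and> self_injective A \<and>
    stable_bound_quiver_algebra K A G n e l \<tau>"

definition graded_automorphism ::
  "('k, 'c) ring_scheme \<Rightarrow> ('k, 'a) module \<Rightarrow> (nat \<Rightarrow> 'a set) \<Rightarrow> ('a \<Rightarrow> 'a) \<Rightarrow> bool" where
  "graded_automorphism K A G \<sigma> \<longleftrightarrow> \<sigma> \<in> ring_iso A A \<and>
    (\<forall>c\<in>carrier K. \<forall>x\<in>carrier A. \<sigma> (c \<odot>\<^bsub>A\<^esub> x) = c \<odot>\<^bsub>A\<^esub> \<sigma> x) \<and>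
    (\<forall>t. \<sigma> ` G t \<subseteq> G t)"


section \<open>Bimodules and twisted trivial extensions\<close>

record ('a, 'm) bimodule = "('a, 'm) module" +
  rsmult :: "'m \<Rightarrow> 'a \<Rightarrow> 'm"

text \<open>The \<open>K\<close>-structure on \<open>M\<close> is the one induced by the action of \<open>A\<close>.\<close>

definition trivial_extension ::
  "('k, 'a) module \<Rightarrow> ('a, 'm) bimodule \<Rightarrow> ('k, 'a \<times> 'm) module" where
  "trivial_extension A M =
    \<lparr>carrier = carrier A \<times> carrier M,
     monoid.mult = (\<lambda>(a, x) (b, y). (a \<otimes>\<^bsub>A\<^esub> b, a \<odot>\<^bsub>M\<^esub> y \<oplus>\<^bsub>M\<^esub> rsmult M x b)),
     one = (\<one>\<^bsub>A\<^esub>, \<zero>\<^bsub>M\<^esub>),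
     ring.zero = (\<zero>\<^bsub>A\<^esub>, \<zero>\<^bsub>M\<^esub>),
     ring.add = (\<lambda>(a, x) (b, y). (a \<oplus>\<^bsub>A\<^esub> b, x \<oplus>\<^bsub>M\<^esub> y)),
     smult = (\<lambda>c (a, x). (c \<odot>\<^bsub>A\<^esub> a, (c \<odot>\<^bsub>A\<^esub> \<one>\<^bsub>A\<^esub>) \<odot>\<^bsub>M\<^esub> x))\<rparr>"

definition twist_bimodule ::
  "('a \<Rightarrow> 'a) \<Rightarrow> ('a, 'm) bimodule \<Rightarrow> ('a, 'm) bimodule" where
  "twist_bimodule \<sigma> M = M\<lparr>rsmult := (\<lambda>x b. rsmult M x (\<sigma> b))\<rparr>"

definition linear_functionals ::
  "('k, 'c) ring_scheme \<Rightarrow> ('k, 'a) module \<Rightarrow> ('a \<Rightarrow> 'k) set" where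
  "linear_functionals K V =
    {f \<in> carrier V \<rightarrow>\<^sub>E carrier K.
      (\<forall>x\<in>carrier V. \<forall>y\<in>carrier V. f (x \<oplus>\<^bsub>V\<^esub> y) = f x \<oplus>\<^bsub>K\<^esub> f y) \<and>
      (\<forall>c\<in>carrier K. \<forall>x\<in>carrier V. f (c \<odot>\<^bsub>V\<^esub> x) = c \<otimes>\<^bsub>K\<^esub> f x)}"

definition dual_bimodule ::
  "('k, 'c) ring_scheme \<Rightarrow> ('k, 'a) module \<Rightarrow> ('a, 'a \<Rightarrow> 'k) bimodule" where
  "dual_bimodule K A =
    \<lparr>carrier = linear_functionals K A,
     monoid.mult = undefined, one = undefined,
     ring.zero = (\<lambda>x\<in>carrier A. \<zero>\<^bsub>K\<^esub>),
     ring.add = (\<lambda>f g. \<lambda>x\<in>carrier A. f x \<oplus>\<^bsub>K\<^esub> g x),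
     smult = (\<lambda>a f. \<lambda>x\<in>carrier A. f (x \<otimes>\<^bsub>A\<^esub> a)),
     rsmult = (\<lambda>f b. \<lambda>x\<in>carrier A. f (b \<otimes>\<^bsub>A\<^esub> x))\<rparr>"

text \<open>The span, inside the dual of a finite-dimensional \<open>A\<close>, of the dual basis elements of a basis
  of \<open>G t\<close> (with respect to a homogeneous basis of \<open>A\<close>) consists of the functionals vanishing on
  all other components.\<close>

definition dual_component ::
  "('k, 'c) ring_scheme \<Rightarrow> ('k, 'a) module \<Rightarrow> (nat \<Rightarrow> 'a set) \<Rightarrow> nat \<Rightarrow> ('a \<Rightarrow> 'k) set" where
  "dual_component K A G t =
    {f \<in> linear_functionals K A. \<forall>s. s \<noteq> t \<longrightarrow> (\<forall>x\<in>G s. f x = \<zero>\<^bsub>K\<^esub>)}"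

definition twisted_trivial_extension ::
  "('k, 'c) ring_scheme \<Rightarrow> ('k, 'a) module \<Rightarrow> ('a \<Rightarrow> 'a) \<Rightarrow> ('k, 'a \<times> ('a \<Rightarrow> 'k)) module" where
  "twisted_trivial_extension K A \<sigma> = trivial_extension A (twist_bimodule \<sigma> (dual_bimodule K A))"

definition twisted_grading ::
  "('k, 'c) ring_scheme \<Rightarrow> ('k, 'a) module \<Rightarrow> (nat \<Rightarrow> 'a set) \<Rightarrow> nat \<Rightarrow>
    nat \<Rightarrow> ('a \<times> ('a \<Rightarrow> 'k)) set" where
  "twisted_grading K A G l t =
    (if t = 0 then G 0 \<times> {\<zero>\<^bsub>dual_bimodule K A\<^esub>}
     else if t \<le> l then G t \<times> dual_component K A G (l + 1 - t)
     else if t = l + 1 then {\<zero>\<^bsub>A\<^esub>} \<times> dual_component K A G 0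
     else {(\<zero>\<^bsub>A\<^esub>, \<zero>\<^bsub>dual_bimodule K A\<^esub>)})"

end

theory Submission
  imports Defs "HOL-Library.Countable"
begin

text \<open>Let \<open>\<phi>\<close> be a functional on \<open>\<Lambda>\<close> that is nonzero on each of the one-dimensional socles
  \<open>e\<^sub>i \<Lambda>\<^sub>l e\<^sub>\<tau>\<^sub>i\<close> and vanishes in degrees other than \<open>l\<close>. The form \<open>(a, b) \<mapsto> \<phi> (a b)\<close> is
  nondegenerate, so the dual of \<open>\<Lambda>\<close> is free of rank one on \<open>\<phi>\<close> from either side and
  \<open>a \<phi> = \<phi> \<psi>(a)\<close> for a graded automorphism \<open>\<psi>\<close>. Hence the twisted trivial extension is
  \<open>T = \<Lambda> + x \<Lambda>\<close> with \<open>x = \<phi>\<close> of degree one, \<open>x\<^sup>2 = 0\<close> and \<open>a x = x \<psi>(a)\<close>.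
  Given a linear resolution \<open>P\<close> of \<open>\<Lambda>\<^sub>0\<close> over \<open>\<Lambda>\<close>, resolving each \<open>P\<^sub>i\<close> over \<open>T\<close> by the
  complex with terms \<open>T \<otimes> P\<^sub>i\<close>, twisted by powers of \<open>\<psi>\<close>, and differential
  \<open>1 \<otimes> p \<mapsto> x \<otimes> p\<close> yields a double complex, whose total complex is a linear
  resolution of \<open>\<Lambda>\<^sub>0\<close> over \<open>T\<close>.\<close>

section \<open>Gradings\<close>

text \<open>Stability describes only the socles of the right projectives, which yields nondegeneracy
  of the form in its first argument. The second argument needs socle elements of left ideals, and
  there self-injectivity enters: it forces them into the right ideals generated by the socle
  elements \<open>u j\<close>. That the form then gives all functionals is deduced from separation
  of points, with no comparison of dimensions.

  Multiplication by x on \<open>T\<close> has kernel and image \<open>x T\<close>, so the resolution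
  of each term of P over \<open>T\<close> never stops, and every further step costs one factor x,
  that is, one degree and one application of \<psi>. So the module with index m - j occurs twisted j
  times and shifted by j, and is generated in degree (m - j) + j = m.

  A formal obstacle shapes the construction: all terms of a linear resolution over \<open>T\<close>
  must have carriers in one prescribed type, and bases of free modules must lie in the type of the
  module. The terms are therefore coded families of elements and not tensor products.\<close>

lemma (in abelian_monoid) finsum_eq_single:
  assumes "finite S" and "s \<in> S" and "f s \<in> carrier G" and "\<And>t. t \<in> S \<Longrightarrow> t \<noteq> s \<Longrightarrow> f t = \<zero>"
  shows "(\<Oplus>t\<in>S. f t) = f s"
proof -
  have "(\<Oplus>t\<in>S. f t) = (\<Oplus>t\<in>S. if s = t then f t else \<zero>)"
    by (rule finsum_cong') (use assms in auto)
  also have "\<dots> = f s"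
    by (rule add.finprod_singleton) (use assms in \<open>auto, metis zero_closed\<close>)
  finally show ?thesis .
qed

lemma additive_sum:
  assumes "abelian_group M" and "abelian_group N" and "f \<in> carrier M \<rightarrow> carrier N"
    and "\<And>x y. x \<in> carrier M \<Longrightarrow> y \<in> carrier M \<Longrightarrow> f (x \<oplus>\<^bsub>M\<^esub> y) = f x \<oplus>\<^bsub>N\<^esub> f y"
  shows additive_zero: "f \<zero>\<^bsub>M\<^esub> = \<zero>\<^bsub>N\<^esub>"
    and additive_minus: "x \<in> carrier M \<Longrightarrow> f (\<ominus>\<^bsub>M\<^esub> x) = \<ominus>\<^bsub>N\<^esub> f x"
    and additive_finsum: "g \<in> S \<rightarrow> carrier M \<Longrightarrow> f (\<Oplus>\<^bsub>M\<^esub>i\<in>S. g i) = (\<Oplus>\<^bsub>N\<^esub>i\<in>S. f (g i))"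
proof -
  interpret M: abelian_group M by fact
  interpret N: abelian_group N by fact
  have c [simp]: "x \<in> carrier M \<Longrightarrow> f x \<in> carrier N" for x
    using assms(3) by blast
  show z: "f \<zero>\<^bsub>M\<^esub> = \<zero>\<^bsub>N\<^esub>"
    using assms(4)[of "\<zero>\<^bsub>M\<^esub>" "\<zero>\<^bsub>M\<^esub>"] by (metis M.r_zero M.zero_closed N.add.r_cancel_one' c)
  show "f (\<ominus>\<^bsub>M\<^esub> x) = \<ominus>\<^bsub>N\<^esub> f x" if "x \<in> carrier M"
    using assms(4)[of "\<ominus>\<^bsub>M\<^esub> x" x] that z by (metis M.a_inv_closed M.l_neg N.minus_equality c)
  show "f (\<Oplus>\<^bsub>M\<^esub>i\<in>S. g i) = (\<Oplus>\<^bsub>N\<^esub>i\<in>S. f (g i))" if "g \<in> S \<rightarrow> carrier M"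
    using that
  proof (induction S rule: infinite_finite_induct)
    case (insert a S)
    then have "g a \<in> carrier M" and gS: "g \<in> S \<rightarrow> carrier M" by auto
    moreover from this have "(\<lambda>i. f (g i)) \<in> S \<rightarrow> carrier N" using c by (auto simp: Pi_iff)
    ultimately show ?case
      using insert by (simp add: assms(4))
  qed (simp_all add: z)
qed

lemma additive_subgroupI':
  assumes "abelian_group M" and "H \<subseteq> carrier M" and "\<zero>\<^bsub>M\<^esub> \<in> H"
    and "\<And>x y. x \<in> H \<Longrightarrow> y \<in> H \<Longrightarrow> x \<oplus>\<^bsub>M\<^esub> y \<in> H" and "\<And>x. x \<in> H \<Longrightarrow> \<ominus>\<^bsub>M\<^esub> x \<in> H"
  shows "additive_subgroup H M"
  using assms
  by (intro additive_subgroup.intro subgroup.intro) (simp_all flip: a_inv_def)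

locale graded_group = abelian_group M for M (structure) +
  fixes H
  assumes decomp: "direct_sum_decomposition M H"
begin

abbreviation "pr \<equiv> hom_component M H"

lemma component_subgroup: "additive_subgroup (H t) M"
  using decomp by (simp add: direct_sum_decomposition_def)

lemma component_closed: "x \<in> H t \<Longrightarrow> x \<in> carrier M"
  using additive_subgroup.a_subset[OF component_subgroup] by blast

lemma component_zero [simp]: "\<zero> \<in> H t"
  by (simp add: additive_subgroup.zero_closed[OF component_subgroup])

lemma component_add: "x \<in> H t \<Longrightarrow> y \<in> H t \<Longrightarrow> x \<oplus> y \<in> H t"
  by (simp add: additive_subgroup.a_closed[OF component_subgroup])

lemma component_minus: "x \<in> H t \<Longrightarrow> \<ominus> x \<in> H t"
  by (simp add: additive_subgroup.a_inv_closed[OF component_subgroup])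

lemma component_finsum:
  assumes "f \<in> S \<rightarrow> H t" shows "(\<Oplus>i\<in>S. f i) \<in> H t"
  using assms
proof (induction S rule: infinite_finite_induct)
  case (insert a S)
  moreover from this have "f \<in> S \<rightarrow> carrier M" "f a \<in> carrier M"
    using component_closed by blast+
  ultimately show ?case by (simp add: component_add)
qed simp_all

lemma components_pr:
  assumes "x \<in> carrier M"
  shows "homogeneous_components M H x (\<lambda>t. pr t x)"
proof -
  have "\<exists>!f. homogeneous_components M H x f"
    using decomp assms by (simp add: direct_sum_decomposition_def)
  then show ?thesis
    unfolding hom_component_def by (rule theI')
qed

lemma pr_unique:
  assumes "x \<in> carrier M" and "homogeneous_components M H x f"
  shows "pr t x = f t"
proof -
  have "(\<lambda>t. pr t x) = f"
    using decomp assms components_pr[OF assms(1)] unfolding direct_sum_decomposition_def by blast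
  then show ?thesis by metis
qed

lemma pr_in: "x \<in> carrier M \<Longrightarrow> pr t x \<in> H t"
  using components_pr by (simp add: homogeneous_components_def)

lemma pr_closed [simp]: "x \<in> carrier M \<Longrightarrow> pr t x \<in> carrier M"
  using pr_in component_closed by blast

lemma finite_support: "x \<in> carrier M \<Longrightarrow> finite {t. pr t x \<noteq> \<zero>}"
  using components_pr by (simp add: homogeneous_components_def)

lemma components_of_superset:
  assumes "finite S" and "f \<in> UNIV \<rightarrow> carrier M" and "{t. f t \<noteq> \<zero>} \<subseteq> S"
  shows "(\<Oplus>t\<in>S. f t) = (\<Oplus>t\<in>{t. f t \<noteq> \<zero>}. f t)"
  by (rule add.finprod_mono_neutral_cong_right) (use assms in auto)

lemma sum_pr:
  assumes "x \<in> carrier M" and "finite S" and "{t. pr t x \<noteq> \<zero>} \<subseteq> S"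
  shows "(\<Oplus>t\<in>S. pr t x) = x"
  using components_of_superset[of S "\<lambda>t. pr t x"] assms components_pr[OF assms(1)]
  by (simp add: homogeneous_components_def)

lemma sum_pr': "x \<in> carrier M \<Longrightarrow> (\<Oplus>t\<in>{t. pr t x \<noteq> \<zero>}. pr t x) = x"
  by (simp add: sum_pr finite_support)

lemma pr_homogeneous:
  assumes "x \<in> H s" shows "pr t x = (if t = s then x else \<zero>)"
proof (rule pr_unique)
  show x: "x \<in> carrier M" using assms component_closed by blast
  have "{t. (if t = s then x else \<zero>) \<noteq> \<zero>} \<subseteq> {s}" by auto
  then have "(\<Oplus>t\<in>{t. (if t = s then x else \<zero>) \<noteq> \<zero>}. if t = s then x else \<zero>) =
      (\<Oplus>t\<in>{s}. if t = s then x else \<zero>)"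
    by (intro components_of_superset[symmetric]) (use x in auto)
  also have "\<dots> = x" using x by simp
  finally show "homogeneous_components M H x (\<lambda>t. if t = s then x else \<zero>)"
    unfolding homogeneous_components_def using assms by (auto intro: finite_subset)
qed

lemma pr_add:
  assumes x: "x \<in> carrier M" and y: "y \<in> carrier M"
  shows "pr t (x \<oplus> y) = pr t x \<oplus> pr t y"
proof (rule pr_unique)
  show "x \<oplus> y \<in> carrier M" using x y by simp
  let ?f = "\<lambda>t. pr t x \<oplus> pr t y" and ?S = "{t. pr t x \<noteq> \<zero>} \<union> {t. pr t y \<noteq> \<zero>}"
  have fin: "finite ?S" using x y by (simp add: finite_support)
  have sub: "{t. ?f t \<noteq> \<zero>} \<subseteq> ?S" by auto
  have "(\<Oplus>t\<in>{t. ?f t \<noteq> \<zero>}. ?f t) = (\<Oplus>t\<in>?S. ?f t)"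
    by (intro components_of_superset[symmetric]) (use x y fin sub in auto)
  also have "\<dots> = (\<Oplus>t\<in>?S. pr t x) \<oplus> (\<Oplus>t\<in>?S. pr t y)"
    by (rule finsum_addf) (use x y in auto)
  also have "\<dots> = x \<oplus> y"
    using x y fin by (simp add: sum_pr)
  finally show "homogeneous_components M H (x \<oplus> y) ?f"
    unfolding homogeneous_components_def
    using x y fin sub by (auto intro: finite_subset component_add pr_in)
qed

lemma pr_zero [simp]: "pr t \<zero> = \<zero>"
  using pr_homogeneous[of \<zero>] by simp

lemma eq_if_pr_eq:
  assumes "x \<in> carrier M" "y \<in> carrier M" "\<And>t. pr t x = pr t y"
  shows "x = y"
proof -
  have "x = (\<Oplus>t\<in>{t. pr t x \<noteq> \<zero>}. pr t x)"
    using sum_pr'[OF assms(1)] by (rule sym)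
  also have "\<dots> = y"
    unfolding assms(3) by (rule sum_pr'[OF assms(2)])
  finally show ?thesis .
qed

text \<open>Every element is a finite sum of its components, so additive statements need to be
  checked on homogeneous elements only.\<close>

lemma additive_pr_induct [consumes 1, case_names homogeneous add]:
  assumes "x \<in> carrier M" and "\<And>t x. x \<in> H t \<Longrightarrow> P x"
    and "\<And>x y. x \<in> carrier M \<Longrightarrow> y \<in> carrier M \<Longrightarrow> P x \<Longrightarrow> P y \<Longrightarrow> P (x \<oplus> y)"
  shows "P x"
proof -
  have "P (\<Oplus>t\<in>S. pr t x)" if "finite S" for S
    using that
  proof (induction S)
    case empty
    show ?case using assms(2)[OF component_zero] by simp
  next
    case (insert a S)
    then show ?case using assms(1) by (simp add: assms(2)[OF pr_in] assms(3) Pi_def)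
  qed
  then show ?thesis using sum_pr'[OF assms(1)] finite_support[OF assms(1)] by metis
qed

end

text \<open>Applying the additive map \<open>p s\<close> to any homogeneous decomposition of x
  leaves only its term of degree s. So candidate projections whose sum returns x force uniqueness
  and are the actual projections. This serves for the terms of the resolution and for the extension
  itself.\<close>

lemma direct_sum_decompositionI:
  assumes M: "abelian_group M" and sub: "\<And>t. additive_subgroup (H t) M"
    and add: "\<And>t x y. x \<in> carrier M \<Longrightarrow> y \<in> carrier M \<Longrightarrow> p t (x \<oplus>\<^bsub>M\<^esub> y) = p t x \<oplus>\<^bsub>M\<^esub> p t y"
    and p_in: "\<And>t x. x \<in> carrier M \<Longrightarrow> p t x \<in> H t"
    and p_hom: "\<And>s t x. x \<in> H s \<Longrightarrow> p t x = (if t = s then x else \<zero>\<^bsub>M\<^esub>)"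
    and fin: "\<And>x. x \<in> carrier M \<Longrightarrow> \<exists>S. finite S \<and> (\<forall>t. t \<notin> S \<longrightarrow> p t x = \<zero>\<^bsub>M\<^esub>) \<and> (\<Oplus>\<^bsub>M\<^esub>t\<in>S. p t x) = x"
  shows "direct_sum_decomposition M H"
    and "x \<in> carrier M \<Longrightarrow> hom_component M H t x = p t x"
proof -
  interpret abelian_group M by fact
  have Hc: "x \<in> H t \<Longrightarrow> x \<in> carrier M" for x t
    using additive_subgroup.a_subset[OF sub] by blast
  have pc: "p t x \<in> carrier M" if "x \<in> carrier M" for x t
    using Hc[OF p_in[OF that]] .
  have ex: "homogeneous_components M H x (\<lambda>t. p t x)" if x: "x \<in> carrier M" for x
  proof -
    obtain S where S: "finite S" "\<forall>t. t \<notin> S \<longrightarrow> p t x = \<zero>\<^bsub>M\<^esub>" "(\<Oplus>\<^bsub>M\<^esub>t\<in>S. p t x) = x"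
      using fin[OF x] by blast
    have "(\<Oplus>\<^bsub>M\<^esub>t\<in>S. p t x) = (\<Oplus>\<^bsub>M\<^esub>t\<in>{t. p t x \<noteq> \<zero>\<^bsub>M\<^esub>}. p t x)"
      by (rule add.finprod_mono_neutral_cong_right) (use S(1,2) pc[OF x] in auto)
    moreover have "finite {t. p t x \<noteq> \<zero>\<^bsub>M\<^esub>}"
      by (rule finite_subset[OF _ S(1)]) (use S(2) in auto)
    ultimately show ?thesis
      using S(3) p_in[OF x] unfolding homogeneous_components_def by simp
  qed
  have un: "f = (\<lambda>t. p t x)" if x: "x \<in> carrier M" and f: "homogeneous_components M H x f" for x f
  proof
    fix s
    \<comment> \<open>The index s is added so that the sum has a term of degree s even when
      \<open>f s\<close> is zero.\<close>
    let ?S = "insert s {t. f t \<noteq> \<zero>\<^bsub>M\<^esub>}"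
    have fH: "f t \<in> H t" for t
      using f by (simp add: homogeneous_components_def)
    have finS: "finite ?S" and fx: "x = (\<Oplus>\<^bsub>M\<^esub>t\<in>{t. f t \<noteq> \<zero>\<^bsub>M\<^esub>}. f t)"
      using f unfolding homogeneous_components_def by simp_all
    have fc: "f t \<in> carrier M" for t using Hc[OF fH] .
    have "x = (\<Oplus>\<^bsub>M\<^esub>t\<in>?S. f t)"
      by (subst fx, rule add.finprod_mono_neutral_cong_left) (use finS fc in auto)
    then have "p s x = (\<Oplus>\<^bsub>M\<^esub>t\<in>?S. p s (f t))"
      using additive_finsum[OF M M, of "p s" f ?S] add fc pc by (simp add: Pi_iff)
    also have "\<dots> = p s (f s)"
      by (rule finsum_eq_single) (use finS fc in \<open>simp_all add: p_hom[OF fH]\<close>)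
    also have "\<dots> = f s" by (simp add: p_hom[OF fH])
    finally show "f s = p s x" by simp
  qed
  show *: "direct_sum_decomposition M H"
    unfolding direct_sum_decomposition_def
  proof (intro conjI allI ballI)
    show "\<exists>!f. homogeneous_components M H x f" if "x \<in> carrier M" for x
      using ex[OF that] un[OF that] by (rule ex1I)
  qed (rule sub)
  have "graded_group M H"
    by (intro graded_group.intro graded_group_axioms.intro M *)
  then show "hom_component M H t x = p t x" if "x \<in> carrier M"
    by (rule graded_group.pr_unique[OF _ that ex[OF that]])
qed

section \<open>Finite direct sums of shifted graded groups\<close>

text \<open>A direct sum whose elements are coded in the type \<open>'z\<close>: operations decode,
  act entrywise and encode again. The action is a parameter that receives the whole element, since
  the entries of a product will mix entries of the factor.\<close>

definition family_module ::
  "'i set \<Rightarrow> ('i \<Rightarrow> ('c, 'm) module) \<Rightarrow> (('i \<Rightarrow> 'm) \<Rightarrow> 'z) \<Rightarrow> ('z \<Rightarrow> 'i \<Rightarrow> 'm) \<Rightarrow>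
    ('b \<Rightarrow> 'z \<Rightarrow> 'i \<Rightarrow> 'm) \<Rightarrow> ('b, 'z) module" where
  "family_module I M enc dec act =
    \<lparr>carrier = enc ` (\<Pi>\<^sub>E i\<in>I. carrier (M i)),
     monoid.mult = undefined, one = undefined,
     ring.zero = enc (\<lambda>i\<in>I. \<zero>\<^bsub>M i\<^esub>),
     ring.add = (\<lambda>z w. enc (\<lambda>i\<in>I. dec z i \<oplus>\<^bsub>M i\<^esub> dec w i)),
     smult = (\<lambda>t z. enc (\<lambda>i\<in>I. act t z i))\<rparr>"

text \<open>The shift M(-s). Subtraction on natural numbers truncates, so degrees below s are set to
  zero separately; otherwise all of them would repeat \<open>H 0\<close>.\<close>

definition shifted_component :: "('c, 'm) module \<Rightarrow> (nat \<Rightarrow> 'm set) \<Rightarrow> nat \<Rightarrow> nat \<Rightarrow> 'm set" where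
  "shifted_component M H s t = (if s \<le> t then H (t - s) else {\<zero>\<^bsub>M\<^esub>})"

definition family_grading ::
  "'i set \<Rightarrow> ('i \<Rightarrow> ('c, 'm) module) \<Rightarrow> ('i \<Rightarrow> nat \<Rightarrow> 'm set) \<Rightarrow> ('i \<Rightarrow> nat) \<Rightarrow>
    (('i \<Rightarrow> 'm) \<Rightarrow> 'z) \<Rightarrow> nat \<Rightarrow> 'z set" where
  "family_grading I M H s enc t = enc ` (\<Pi>\<^sub>E i\<in>I. shifted_component (M i) (H i) (s i) t)"

locale graded_family =
  fixes I :: "'i set" and M :: "'i \<Rightarrow> ('c, 'm) module" and H :: "'i \<Rightarrow> nat \<Rightarrow> 'm set"
    and s :: "'i \<Rightarrow> nat" and enc :: "('i \<Rightarrow> 'm) \<Rightarrow> 'z" and dec :: "'z \<Rightarrow> 'i \<Rightarrow> 'm"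
    and act :: "'b \<Rightarrow> 'z \<Rightarrow> 'i \<Rightarrow> 'm"
  assumes finite_index: "finite I"
    and graded: "\<And>i. i \<in> I \<Longrightarrow> graded_group (M i) (H i)"
    and dec_enc: "\<And>f. dec (enc f) = f"
begin

abbreviation "Q \<equiv> family_module I M enc dec act"
abbreviation "HQ \<equiv> family_grading I M H s enc"

lemma group: "i \<in> I \<Longrightarrow> abelian_group (M i)"
  using graded graded_group.axioms(1) by blast

lemma dec_enc_restrict [simp]: "i \<in> I \<Longrightarrow> dec (enc (restrict f I)) i = f i"
  by (simp add: dec_enc)

lemma mem_iff: "z \<in> carrier Q \<longleftrightarrow> enc (dec z) = z \<and> dec z \<in> (\<Pi>\<^sub>E i\<in>I. carrier (M i))"
  unfolding family_module_def using dec_enc by (auto simp: image_iff) metis+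

lemma enc_in: "(\<And>i. i \<in> I \<Longrightarrow> f i \<in> carrier (M i)) \<Longrightarrow> enc (restrict f I) \<in> carrier Q"
  by (simp add: mem_iff dec_enc)

lemma dec_in [simp]: "z \<in> carrier Q \<Longrightarrow> i \<in> I \<Longrightarrow> dec z i \<in> carrier (M i)"
  by (auto simp: mem_iff)

lemma dec_eqI:
  assumes "z \<in> carrier Q" "w \<in> carrier Q" "\<And>i. i \<in> I \<Longrightarrow> dec z i = dec w i"
  shows "z = w"
proof -
  have "dec z = dec w"
    using assms unfolding mem_iff by (intro PiE_ext[of _ I]) auto
  then show ?thesis using assms(1,2) unfolding mem_iff by metis
qed

lemma zero_Q: "\<zero>\<^bsub>Q\<^esub> = enc (\<lambda>i\<in>I. \<zero>\<^bsub>M i\<^esub>)"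
  and add_Q: "z \<oplus>\<^bsub>Q\<^esub> w = enc (\<lambda>i\<in>I. dec z i \<oplus>\<^bsub>M i\<^esub> dec w i)"
  and smult_Q: "t \<odot>\<^bsub>Q\<^esub> z = enc (\<lambda>i\<in>I. act t z i)"
  by (simp_all add: family_module_def)

lemma dec_zero [simp]: "i \<in> I \<Longrightarrow> dec \<zero>\<^bsub>Q\<^esub> i = \<zero>\<^bsub>M i\<^esub>"
  and dec_add [simp]: "i \<in> I \<Longrightarrow> dec (z \<oplus>\<^bsub>Q\<^esub> w) i = dec z i \<oplus>\<^bsub>M i\<^esub> dec w i"
  and dec_smult [simp]: "i \<in> I \<Longrightarrow> dec (t \<odot>\<^bsub>Q\<^esub> z) i = act t z i"
  by (simp_all add: zero_Q add_Q smult_Q)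

lemma abelian_group_Q: "abelian_group Q"
proof (rule abelian_groupI)
  have zero: "\<zero>\<^bsub>Q\<^esub> \<in> carrier Q"
    unfolding zero_Q by (rule enc_in) (simp add: abelian_group.axioms abelian_monoid.zero_closed group)
  have add: "x \<oplus>\<^bsub>Q\<^esub> y \<in> carrier Q" if "x \<in> carrier Q" "y \<in> carrier Q" for x y
    unfolding add_Q
    by (rule enc_in) (use that in \<open>simp add: abelian_group.axioms abelian_monoid.a_closed group\<close>)
  show "\<zero>\<^bsub>Q\<^esub> \<in> carrier Q" by (rule zero)
  fix x y z assume x: "x \<in> carrier Q" and y: "y \<in> carrier Q" and z: "z \<in> carrier Q"
  show "x \<oplus>\<^bsub>Q\<^esub> y \<in> carrier Q" using x y by (rule add)
  show "(x \<oplus>\<^bsub>Q\<^esub> y) \<oplus>\<^bsub>Q\<^esub> z = x \<oplus>\<^bsub>Q\<^esub> (y \<oplus>\<^bsub>Q\<^esub> z)"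
    by (rule dec_eqI) (use x y z in
      \<open>simp_all add: add abelian_group.axioms(1) abelian_monoid.a_assoc group\<close>)
  show "x \<oplus>\<^bsub>Q\<^esub> y = y \<oplus>\<^bsub>Q\<^esub> x"
    by (rule dec_eqI) (use x y in
      \<open>simp_all add: add abelian_group.axioms(1) abelian_monoid.a_comm group\<close>)
  show "\<zero>\<^bsub>Q\<^esub> \<oplus>\<^bsub>Q\<^esub> x = x"
    by (rule dec_eqI) (use x in
      \<open>simp_all add: add zero abelian_group.axioms(1) abelian_monoid.l_zero group\<close>)
  let ?y = "enc (\<lambda>i\<in>I. \<ominus>\<^bsub>M i\<^esub> dec x i)"
  have y': "?y \<in> carrier Q"
    by (rule enc_in) (use x in \<open>simp add: abelian_group.a_inv_closed group\<close>)
  moreover have "?y \<oplus>\<^bsub>Q\<^esub> x = \<zero>\<^bsub>Q\<^esub>"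
    by (rule dec_eqI) (use x y' in \<open>simp_all add: add zero abelian_group.l_neg group\<close>)
  ultimately show "\<exists>y\<in>carrier Q. y \<oplus>\<^bsub>Q\<^esub> x = \<zero>\<^bsub>Q\<^esub>" by blast
qed

lemma dec_minus [simp]:
  assumes "i \<in> I" and "z \<in> carrier Q" shows "dec (\<ominus>\<^bsub>Q\<^esub> z) i = \<ominus>\<^bsub>M i\<^esub> dec z i"
  by (rule additive_minus[OF abelian_group_Q group]) (use assms in auto)

lemma dec_finsum:
  assumes "i \<in> I" and "g \<in> S \<rightarrow> carrier Q"
  shows "dec (\<Oplus>\<^bsub>Q\<^esub>k\<in>S. g k) i = (\<Oplus>\<^bsub>M i\<^esub>k\<in>S. dec (g k) i)"
  by (rule additive_finsum[OF abelian_group_Q group]) (use assms in auto)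

lemma shifted_component_subgroup:
  assumes "i \<in> I" shows "additive_subgroup (shifted_component (M i) (H i) (s i) t) (M i)"
proof (cases "s i \<le> t")
  case True
  then show ?thesis using graded_group.component_subgroup[OF graded[OF assms]]
    by (simp add: shifted_component_def)
next
  case False
  interpret abelian_group "M i" using assms by (rule group)
  show ?thesis
    unfolding shifted_component_def using False
    by (intro additive_subgroupI' abelian_group_axioms) auto
qed

lemma shifted_component_subset: "i \<in> I \<Longrightarrow> x \<in> shifted_component (M i) (H i) (s i) t \<Longrightarrow> x \<in> carrier (M i)"
  using additive_subgroup.a_subset[OF shifted_component_subgroup] by blast

lemma HQ_iff: "z \<in> HQ t \<longleftrightarrow>
    z \<in> carrier Q \<and> (\<forall>i\<in>I. dec z i \<in> shifted_component (M i) (H i) (s i) t)"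
proof
  assume "z \<in> HQ t"
  then obtain f where f: "f \<in> (\<Pi>\<^sub>E i\<in>I. shifted_component (M i) (H i) (s i) t)" "z = enc f"
    unfolding family_grading_def by blast
  then have "f \<in> (\<Pi>\<^sub>E i\<in>I. carrier (M i))" using shifted_component_subset by fast
  with f show "z \<in> carrier Q \<and> (\<forall>i\<in>I. dec z i \<in> shifted_component (M i) (H i) (s i) t)"
    by (auto simp: mem_iff dec_enc)
next
  assume "z \<in> carrier Q \<and> (\<forall>i\<in>I. dec z i \<in> shifted_component (M i) (H i) (s i) t)"
  then show "z \<in> HQ t"
    unfolding mem_iff family_grading_def
    by (intro image_eqI[of _ _ "dec z"]) (auto simp: PiE_iff)
qed

lemma graded_Q: "graded_group Q HQ"
proof (intro graded_group.intro graded_group_axioms.intro abelian_group_Q)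
  interpret Q: abelian_group Q by (rule abelian_group_Q)
  define p where "p t z = enc (\<lambda>i\<in>I. if s i \<le> t then hom_component (M i) (H i) (t - s i) (dec z i) else \<zero>\<^bsub>M i\<^esub>)"
    for t z
  have zc: "i \<in> I \<Longrightarrow> \<zero>\<^bsub>M i\<^esub> \<in> carrier (M i)" for i
    using group abelian_group.axioms(1) abelian_monoid.zero_closed by blast
  have pc: "p t z \<in> carrier Q" if "z \<in> carrier Q" for t z
    unfolding p_def by (rule enc_in) (use that in \<open>simp add: graded_group.pr_closed[OF graded] zc\<close>)
  have dp: "dec (p t z) i = (if s i \<le> t then hom_component (M i) (H i) (t - s i) (dec z i) else \<zero>\<^bsub>M i\<^esub>)"
    if "i \<in> I" for t z i
    using that by (simp add: p_def)
  show "direct_sum_decomposition Q HQ"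
  proof (rule direct_sum_decompositionI(1)[OF abelian_group_Q, of _ p])
    fix t
    show "additive_subgroup (HQ t) Q"
    proof (rule additive_subgroupI'[OF abelian_group_Q])
      show "HQ t \<subseteq> carrier Q" by (auto simp: HQ_iff)
      show "\<zero>\<^bsub>Q\<^esub> \<in> HQ t"
        by (auto simp: HQ_iff additive_subgroup.zero_closed[OF shifted_component_subgroup])
      show "x \<oplus>\<^bsub>Q\<^esub> y \<in> HQ t" if "x \<in> HQ t" "y \<in> HQ t" for x y
        using that unfolding HQ_iff
        by (auto simp: additive_subgroup.a_closed[OF shifted_component_subgroup])
      show "\<ominus>\<^bsub>Q\<^esub> x \<in> HQ t" if "x \<in> HQ t" for x
        using that unfolding HQ_iff
        by (auto simp: additive_subgroup.a_inv_closed[OF shifted_component_subgroup])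
    qed
    show "p t (x \<oplus>\<^bsub>Q\<^esub> y) = p t x \<oplus>\<^bsub>Q\<^esub> p t y" if "x \<in> carrier Q" "y \<in> carrier Q" for x y
      by (rule dec_eqI) (use that in \<open>simp_all add: pc dp graded_group.pr_add[OF graded]
            abelian_monoid.l_zero[OF abelian_group.axioms(1)[OF group]] zc\<close>)
    show "p t z \<in> HQ t" if "z \<in> carrier Q" for z
      using that by (auto simp: HQ_iff pc dp shifted_component_def graded_group.pr_in[OF graded])
    show "p t z = (if t = r then z else \<zero>\<^bsub>Q\<^esub>)" if z: "z \<in> HQ r" for r z
    proof (rule dec_eqI)
      show "p t z \<in> carrier Q" "(if t = r then z else \<zero>\<^bsub>Q\<^esub>) \<in> carrier Q"
        using z by (auto simp: HQ_iff pc)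
      fix i assume i: "i \<in> I"
      have d: "dec z i \<in> shifted_component (M i) (H i) (s i) r"
        using z i by (auto simp: HQ_iff)
      show "dec (p t z) i = dec (if t = r then z else \<zero>\<^bsub>Q\<^esub>) i"
      proof (cases "s i \<le> r")
        case True
        then have "dec z i \<in> H i (r - s i)" using d by (simp add: shifted_component_def)
        from graded_group.pr_homogeneous[OF graded[OF i] this] True i show ?thesis
          by (auto simp: dp)
      next
        case False
        then have "dec z i = \<zero>\<^bsub>M i\<^esub>" using d by (simp add: shifted_component_def)
        then show ?thesis using i False graded_group.pr_zero[OF graded[OF i]] by (auto simp: dp)
      qed
    qed
    fix z assume z: "z \<in> carrier Q"
    let ?supp = "\<lambda>i. {k. hom_component (M i) (H i) k (dec z i) \<noteq> \<zero>\<^bsub>M i\<^esub>}"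
    have fin: "finite (?supp i)" if "i \<in> I" for i
      using graded_group.finite_support[OF graded[OF that]] z that by simp
    \<comment> \<open>The supports of the entries, moved to degrees of the sum; the union is finite
      because the index set is.\<close>
    define S where "S = (\<Union>i\<in>I. (\<lambda>k. k + s i) ` ?supp i)"
    have finS: "finite S" unfolding S_def using fin finite_index by auto
    have out: "p t z = \<zero>\<^bsub>Q\<^esub>" if "t \<notin> S" for t
    proof (rule dec_eqI)
      fix i assume i: "i \<in> I"
      show "dec (p t z) i = dec \<zero>\<^bsub>Q\<^esub> i"
      proof (rule ccontr)
        assume "dec (p t z) i \<noteq> dec \<zero>\<^bsub>Q\<^esub> i"
        then have "s i \<le> t" "t - s i \<in> ?supp i" using i by (auto simp: dp split: if_splits)
        then have "t \<in> (\<lambda>k. k + s i) ` ?supp i" by (intro image_eqI[of _ _ "t - s i"]) auto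
        then show False using that i unfolding S_def by blast
      qed
    qed (use z in \<open>simp_all add: pc\<close>)
    have "(\<Oplus>\<^bsub>Q\<^esub>t\<in>S. p t z) = z"
    proof (rule dec_eqI)
      show "(\<Oplus>\<^bsub>Q\<^esub>t\<in>S. p t z) \<in> carrier Q" using z pc by (auto intro: Q.finsum_closed)
      fix i assume i: "i \<in> I"
      interpret Mi: graded_group "M i" "H i" using graded[OF i] .
      let ?f = "\<lambda>t. hom_component (M i) (H i) t (dec z i)"
      have d: "dec z i \<in> carrier (M i)" using z i by simp
      have "dec (\<Oplus>\<^bsub>Q\<^esub>t\<in>S. p t z) i = (\<Oplus>\<^bsub>M i\<^esub>t\<in>S. dec (p t z) i)"
        by (rule dec_finsum[OF i]) (use z pc in auto)
      \<comment> \<open>At the entry i only the degrees k + s i with k in its support contribute,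
        and k \<mapsto> k + s i is injective, so reindexing returns the decomposition of that
        entry.\<close>
      also have "\<dots> = (\<Oplus>\<^bsub>M i\<^esub>t\<in>(\<lambda>k. k + s i) ` ?supp i. dec (p t z) i)"
      proof (rule Mi.add.finprod_mono_neutral_cong_right)
        show "(\<lambda>k. k + s i) ` ?supp i \<subseteq> S" using i by (auto simp: S_def)
        show "dec (p t z) i = \<zero>\<^bsub>M i\<^esub>" if "t \<in> S - (\<lambda>k. k + s i) ` ?supp i" for t
        proof (rule ccontr)
          assume "dec (p t z) i \<noteq> \<zero>\<^bsub>M i\<^esub>"
          then have "s i \<le> t" "t - s i \<in> ?supp i" using i by (auto simp: dp split: if_splits)
          then have "t \<in> (\<lambda>k. k + s i) ` ?supp i" by (intro image_eqI[of _ _ "t - s i"]) auto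
          then show False using that by blast
        qed
      qed (use finS i z pc in auto)
      also have "\<dots> = (\<Oplus>\<^bsub>M i\<^esub>k\<in>?supp i. dec (p (k + s i) z) i)"
        by (rule Mi.add.finprod_reindex) (use i z pc in \<open>auto simp: inj_on_def\<close>)
      also have "\<dots> = (\<Oplus>\<^bsub>M i\<^esub>k\<in>?supp i. ?f k)"
        using i by (simp add: dp)
      also have "\<dots> = dec z i" using Mi.sum_pr'[OF d] .
      finally show "dec (\<Oplus>\<^bsub>Q\<^esub>t\<in>S. p t z) i = dec z i" .
    qed (rule z)
    then show "\<exists>S. finite S \<and> (\<forall>t. t \<notin> S \<longrightarrow> p t z = \<zero>\<^bsub>Q\<^esub>) \<and> (\<Oplus>\<^bsub>Q\<^esub>t\<in>S. p t z) = z"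
      using finS out by blast
  qed
qed

end

section \<open>Square-zero extensions by a normal element of degree one\<close>

text \<open>An element \<open>t\<close> of \<open>T\<close> is written \<open>\<alpha> t + x \<beta> t\<close>, where \<open>x\<close> has degree one,
  \<open>x\<^sup>2 = 0\<close> and \<open>a x = x \<psi>(a)\<close> for \<open>a\<close> in \<open>A\<close>; \<open>comb a b\<close> stands for \<open>a + x b\<close>.\<close>

locale skew_extension = A: ring A + T: ring T
  for A :: "('a, 'c) ring_scheme" (structure) and T :: "('b, 'd) ring_scheme" +
  fixes G :: "nat \<Rightarrow> 'a set" and TG :: "nat \<Rightarrow> 'b set"
    and \<alpha> \<beta> :: "'b \<Rightarrow> 'a" and comb :: "'a \<Rightarrow> 'a \<Rightarrow> 'b" and \<psi> :: "'a \<Rightarrow> 'a"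
  assumes A_decomp: "direct_sum_decomposition A G" and T_decomp: "direct_sum_decomposition T TG"
    and \<alpha>_closed [simp]: "t \<in> carrier T \<Longrightarrow> \<alpha> t \<in> carrier A"
    and \<beta>_closed [simp]: "t \<in> carrier T \<Longrightarrow> \<beta> t \<in> carrier A"
    and \<alpha>_add: "t \<in> carrier T \<Longrightarrow> u \<in> carrier T \<Longrightarrow> \<alpha> (t \<oplus>\<^bsub>T\<^esub> u) = \<alpha> t \<oplus> \<alpha> u"
    and \<beta>_add: "t \<in> carrier T \<Longrightarrow> u \<in> carrier T \<Longrightarrow> \<beta> (t \<oplus>\<^bsub>T\<^esub> u) = \<beta> t \<oplus> \<beta> u"
    and \<alpha>_mult: "t \<in> carrier T \<Longrightarrow> u \<in> carrier T \<Longrightarrow> \<alpha> (t \<otimes>\<^bsub>T\<^esub> u) = \<alpha> t \<otimes> \<alpha> u"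
    and \<beta>_mult: "t \<in> carrier T \<Longrightarrow> u \<in> carrier T \<Longrightarrow>
      \<beta> (t \<otimes>\<^bsub>T\<^esub> u) = \<psi> (\<alpha> t) \<otimes> \<beta> u \<oplus> \<beta> t \<otimes> \<alpha> u"
    and \<alpha>_one: "\<alpha> \<one>\<^bsub>T\<^esub> = \<one>" and \<beta>_one: "\<beta> \<one>\<^bsub>T\<^esub> = \<zero>"
    and comb_closed [simp]: "a \<in> carrier A \<Longrightarrow> b \<in> carrier A \<Longrightarrow> comb a b \<in> carrier T"
    and \<alpha>_comb [simp]: "a \<in> carrier A \<Longrightarrow> b \<in> carrier A \<Longrightarrow> \<alpha> (comb a b) = a"
    and \<beta>_comb [simp]: "a \<in> carrier A \<Longrightarrow> b \<in> carrier A \<Longrightarrow> \<beta> (comb a b) = b"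
    and comb_\<alpha>_\<beta>: "t \<in> carrier T \<Longrightarrow> comb (\<alpha> t) (\<beta> t) = t"
    and \<psi>_iso: "\<psi> \<in> ring_iso A A"
    and \<psi>_graded: "a \<in> G k \<Longrightarrow> \<psi> a \<in> G k"
    and \<alpha>_graded: "t \<in> TG k \<Longrightarrow> \<alpha> t \<in> G k"
    and \<beta>_graded_zero: "t \<in> TG 0 \<Longrightarrow> \<beta> t = \<zero>"
    and \<beta>_graded: "t \<in> TG (Suc k) \<Longrightarrow> \<beta> t \<in> G k"
    and TG_zero: "TG 0 = (\<lambda>a. comb a \<zero>) ` G 0"
    and T_pr_zero: "t \<in> carrier T \<Longrightarrow>
      hom_component T TG 0 t = comb (hom_component A G 0 (\<alpha> t)) \<zero>"
begin

sublocale AG: graded_group A G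
  by (intro graded_group.intro graded_group_axioms.intro A.abelian_group_axioms A_decomp)

sublocale TG: graded_group T TG
  by (intro graded_group.intro graded_group_axioms.intro T.abelian_group_axioms T_decomp)

lemma T_eqI:
  assumes "t \<in> carrier T" "u \<in> carrier T" "\<alpha> t = \<alpha> u" "\<beta> t = \<beta> u" shows "t = u"
proof -
  have "comb (\<alpha> t) (\<beta> t) = comb (\<alpha> u) (\<beta> u)" by (simp only: assms(3,4))
  then show ?thesis unfolding comb_\<alpha>_\<beta>[OF assms(1)] comb_\<alpha>_\<beta>[OF assms(2)] .
qed

lemma comb_add:
  assumes "a \<in> carrier A" "b \<in> carrier A" "a' \<in> carrier A" "b' \<in> carrier A"
  shows "comb (a \<oplus> a') (b \<oplus> b') = comb a b \<oplus>\<^bsub>T\<^esub> comb a' b'"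
  by (rule T_eqI) (use assms in \<open>simp_all add: \<alpha>_add \<beta>_add\<close>)

text \<open>Moving a scalar of \<open>A\<close> to the right past j factors x applies \<psi> j
  times; this is the twist in column j of the double complex.\<close>

definition Psi :: "nat \<Rightarrow> 'a \<Rightarrow> 'a" where "Psi j = \<psi> ^^ j"

lemma Psi_0 [simp]: "Psi 0 a = a" by (simp add: Psi_def)
lemma Psi_Suc: "Psi (Suc j) a = Psi j (\<psi> a)" by (simp add: Psi_def funpow_swap1)

lemma \<psi>_hom: "\<psi> \<in> ring_hom A A" and \<psi>_bij: "bij_betw \<psi> (carrier A) (carrier A)"
  using \<psi>_iso by (auto simp: ring_iso_def)

lemma \<psi>_closed [simp]: "a \<in> carrier A \<Longrightarrow> \<psi> a \<in> carrier A"
  using \<psi>_hom by (rule ring_hom_closed)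

lemma \<psi>_mult: "a \<in> carrier A \<Longrightarrow> b \<in> carrier A \<Longrightarrow> \<psi> (a \<otimes> b) = \<psi> a \<otimes> \<psi> b"
  using \<psi>_hom by (rule ring_hom_mult)

lemma Psi_hom: "Psi j \<in> ring_hom A A"
proof (induction j)
  case 0 then show ?case by (auto intro: ring_hom_memI)
next
  case (Suc j)
  have "Psi (Suc j) = Psi j \<circ> \<psi>" by (rule ext) (simp add: Psi_Suc)
  then show ?case using ring_hom_trans[OF \<psi>_hom Suc] by (simp only:)
qed

lemma Psi_bij: "bij_betw (Psi j) (carrier A) (carrier A)"
  unfolding Psi_def by (rule bij_betw_funpow[OF \<psi>_bij])

lemma Psi_closed [simp]: "a \<in> carrier A \<Longrightarrow> Psi j a \<in> carrier A"
  using Psi_hom by (rule ring_hom_closed)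

lemma Psi_mult: "a \<in> carrier A \<Longrightarrow> b \<in> carrier A \<Longrightarrow> Psi j (a \<otimes> b) = Psi j a \<otimes> Psi j b"
  using Psi_hom by (rule ring_hom_mult)

lemma Psi_add: "a \<in> carrier A \<Longrightarrow> b \<in> carrier A \<Longrightarrow> Psi j (a \<oplus> b) = Psi j a \<oplus> Psi j b"
  using Psi_hom by (rule ring_hom_add)

lemma Psi_one [simp]: "Psi j \<one> = \<one>"
  using Psi_hom by (rule ring_hom_one)

lemma Psi_zero [simp]: "Psi j \<zero> = \<zero>"
  by (rule ring_hom_zero[OF Psi_hom A.ring_axioms A.ring_axioms])

lemma Psi_graded: "a \<in> G t \<Longrightarrow> Psi j a \<in> G t"
  by (induction j arbitrary: a) (simp_all add: Psi_Suc \<psi>_graded)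

definition Psi' :: "nat \<Rightarrow> 'a \<Rightarrow> 'a" where "Psi' j = inv_into (carrier A) (Psi j)"

lemma Psi'_closed [simp]: "a \<in> carrier A \<Longrightarrow> Psi' j a \<in> carrier A"
  unfolding Psi'_def by (rule inv_into_into) (simp add: bij_betw_imp_surj_on[OF Psi_bij])

lemma Psi_Psi' [simp]: "a \<in> carrier A \<Longrightarrow> Psi j (Psi' j a) = a"
  unfolding Psi'_def by (rule f_inv_into_f) (simp add: bij_betw_imp_surj_on[OF Psi_bij])

lemma Psi_eqD: "a \<in> carrier A \<Longrightarrow> b \<in> carrier A \<Longrightarrow> Psi j a = Psi j b \<Longrightarrow> a = b"
  using inj_onD[OF bij_betw_imp_inj_on[OF Psi_bij]] .

lemma Psi'_add: "a \<in> carrier A \<Longrightarrow> b \<in> carrier A \<Longrightarrow> Psi' j (a \<oplus> b) = Psi' j a \<oplus> Psi' j b"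
  by (rule Psi_eqD[of _ _ j]) (simp_all add: Psi_add)

text \<open>By this identity \<open>Psi' j\<close> turns the regular module with the action
  \<open>Psi j a \<otimes> b\<close> into the untwisted one, so that twisting keeps free modules
  free.\<close>

lemma Psi'_mult: "a \<in> carrier A \<Longrightarrow> b \<in> carrier A \<Longrightarrow> Psi' j (Psi j a \<otimes> b) = a \<otimes> Psi' j b"
  by (rule Psi_eqD[of _ _ j]) (simp_all add: Psi_mult)

lemma Psi'_zero [simp]: "Psi' j \<zero> = \<zero>"
  by (rule Psi_eqD[of _ _ j]) simp_all

end

text \<open>The terms of the resolution over \<open>T\<close> must have carriers in a prescribed type \<open>'z\<close>: \<open>enc\<close>
  and \<open>dec\<close> represent families of elements of the \<open>P i\<close> there, and \<open>ix\<close> supplies bases of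
  free modules.\<close>

locale skew_resolution = skew_extension A T G TG \<alpha> \<beta> comb \<psi>
  for A :: "('a, 'c) ring_scheme" (structure) and T :: "('b, 'd) ring_scheme" and G TG \<alpha> \<beta> comb \<psi> +
  fixes P :: "nat \<Rightarrow> ('a, 'm) module" and H :: "nat \<Rightarrow> nat \<Rightarrow> 'm set"
    and d :: "nat \<Rightarrow> 'm \<Rightarrow> 'm" and \<epsilon> :: "'m \<Rightarrow> 'a"
    and enc :: "(nat \<times> bool \<Rightarrow> 'm) \<Rightarrow> 'z" and dec :: "'z \<Rightarrow> nat \<times> bool \<Rightarrow> 'm" and ix :: "nat \<times> 'm \<Rightarrow> 'z"
  assumes P_graded: "graded_left_module A G (P i) (H i)"
    and P_projective: "projective_module A (P i)"
    and P_span: "submodule_span A (P i) (H i i) = carrier (P i)"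
    and d_hom: "d i \<in> graded_hom A (P (Suc i)) (H (Suc i)) (P i) (H i)"
    and \<epsilon>_hom: "\<epsilon> \<in> graded_hom A (P 0) (H 0) (degree_zero_module A G) (degree_zero_grading A G)"
    and \<epsilon>_surj: "\<epsilon> ` carrier (P 0) = G 0"
    and exact_0: "d 0 ` carrier (P 1) = {x \<in> carrier (P 0). \<epsilon> x = \<zero>}"
    and exact: "d (Suc i) ` carrier (P (Suc (Suc i))) = {x \<in> carrier (P (Suc i)). d i x = \<zero>\<^bsub>P i\<^esub>}"
    and dec_enc: "dec (enc f) = f"
    and inj_ix: "inj ix"
begin

section \<open>The given resolution over \<open>A\<close>, and signs\<close>

lemma P_module: "left_module A (P i)"
  and P_decomp: "direct_sum_decomposition (P i) (H i)"
  and P_smult_graded: "a \<in> G r \<Longrightarrow> x \<in> H i t \<Longrightarrow> a \<odot>\<^bsub>P i\<^esub> x \<in> H i (r + t)"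
  using P_graded[of i] by (auto simp: graded_left_module_def)

lemma P_group: "abelian_group (P i)"
  using P_module[unfolded left_module_def] by blast

lemma P_monoid: "abelian_monoid (P i)"
  using P_group abelian_group.axioms(1) by blast

lemma P_graded_group: "graded_group (P i) (H i)"
  by (intro graded_group.intro graded_group_axioms.intro P_group P_decomp)

lemmas P_smult_closed [simp] = left_module.smult_closed[OF P_module]
  and P_smult_l_distr = left_module.smult_l_distr[OF P_module]
  and P_smult_r_distr = left_module.smult_r_distr[OF P_module]
  and P_smult_assoc1 = left_module.smult_assoc1[OF P_module]
  and P_smult_one [simp] = left_module.smult_one[OF P_module]
  and P_zero_closed [simp] = abelian_monoid.zero_closed[OF P_monoid]
  and P_a_closed [simp] = abelian_monoid.a_closed[OF P_monoid]
  and P_l_zero [simp] = abelian_monoid.l_zero[OF P_monoid]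
  and P_r_zero [simp] = abelian_monoid.r_zero[OF P_monoid]
  and P_a_assoc = abelian_monoid.a_assoc[OF P_monoid]
  and P_a_comm = abelian_monoid.a_comm[OF P_monoid]
  and P_a_lcomm = abelian_monoid.a_lcomm[OF P_monoid]
  and P_minus_closed [simp] = abelian_group.a_inv_closed[OF P_group]
  and P_minus_minus [simp] = abelian_group.minus_minus[OF P_group]
  and P_minus_add = abelian_group.minus_add[OF P_group]
  and P_l_neg [simp] = abelian_group.l_neg[OF P_group]
  and P_r_neg [simp] = abelian_group.r_neg[OF P_group]

lemma P_minus_zero [simp]: "\<ominus>\<^bsub>P i\<^esub> \<zero>\<^bsub>P i\<^esub> = \<zero>\<^bsub>P i\<^esub>"
  by (rule abelian_group.minus_equality[OF P_group]) simp_all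

lemma P_smult_zero_right [simp]: "a \<in> carrier A \<Longrightarrow> a \<odot>\<^bsub>P i\<^esub> \<zero>\<^bsub>P i\<^esub> = \<zero>\<^bsub>P i\<^esub>"
  by (rule additive_zero[OF P_group P_group]) (auto simp: P_smult_r_distr)

lemma P_smult_minus: "a \<in> carrier A \<Longrightarrow> x \<in> carrier (P i) \<Longrightarrow> a \<odot>\<^bsub>P i\<^esub> (\<ominus>\<^bsub>P i\<^esub> x) = \<ominus>\<^bsub>P i\<^esub> (a \<odot>\<^bsub>P i\<^esub> x)"
  by (rule additive_minus[OF P_group P_group]) (auto simp: P_smult_r_distr)

lemma P_smult_zero_left [simp]: "x \<in> carrier (P i) \<Longrightarrow> \<zero> \<odot>\<^bsub>P i\<^esub> x = \<zero>\<^bsub>P i\<^esub>"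
  by (rule additive_zero[OF A.abelian_group_axioms P_group]) (auto simp: P_smult_l_distr)

lemma d_closed [simp]: "x \<in> carrier (P (Suc i)) \<Longrightarrow> d i x \<in> carrier (P i)"
  and d_add: "x \<in> carrier (P (Suc i)) \<Longrightarrow> y \<in> carrier (P (Suc i)) \<Longrightarrow>
    d i (x \<oplus>\<^bsub>P (Suc i)\<^esub> y) = d i x \<oplus>\<^bsub>P i\<^esub> d i y"
  and d_smult: "a \<in> carrier A \<Longrightarrow> x \<in> carrier (P (Suc i)) \<Longrightarrow> d i (a \<odot>\<^bsub>P (Suc i)\<^esub> x) = a \<odot>\<^bsub>P i\<^esub> d i x"
  using d_hom[of i] by (auto simp: graded_hom_def left_module_hom_def)

lemma d_graded: "x \<in> H (Suc i) t \<Longrightarrow> d i x \<in> H i t"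
  using d_hom[of i] unfolding graded_hom_def by blast

lemma d_zero [simp]: "d i \<zero>\<^bsub>P (Suc i)\<^esub> = \<zero>\<^bsub>P i\<^esub>"
  by (rule additive_zero[OF P_group P_group]) (auto simp: d_add)

lemma d_minus: "x \<in> carrier (P (Suc i)) \<Longrightarrow> d i (\<ominus>\<^bsub>P (Suc i)\<^esub> x) = \<ominus>\<^bsub>P i\<^esub> d i x"
  by (rule additive_minus[OF P_group P_group]) (auto simp: d_add)

lemma d_d [simp]: "x \<in> carrier (P (Suc (Suc i))) \<Longrightarrow> d i (d (Suc i) x) = \<zero>\<^bsub>P i\<^esub>"
  using exact[of i] by auto

lemma \<epsilon>_d [simp]: "x \<in> carrier (P (Suc 0)) \<Longrightarrow> \<epsilon> (d 0 x) = \<zero>"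
  using exact_0 by auto

text \<open>The factor (-1)^j. The differential of P commutes with the passage from
  \<open>1 \<otimes> p\<close> to \<open>x \<otimes> p\<close>, so a sign depending on the column is
  needed for the total differential to square to zero.\<close>

definition sg :: "nat \<Rightarrow> nat \<Rightarrow> 'm \<Rightarrow> 'm" where
  "sg i j x = (if even j then x else \<ominus>\<^bsub>P i\<^esub> x)"

lemma sg_closed [simp]: "x \<in> carrier (P i) \<Longrightarrow> sg i j x \<in> carrier (P i)"
  by (simp add: sg_def)

lemma sg_0 [simp]: "sg i 0 x = x"
  by (simp add: sg_def)

lemma sg_zero [simp]: "sg i j \<zero>\<^bsub>P i\<^esub> = \<zero>\<^bsub>P i\<^esub>"
  by (simp add: sg_def)

lemma sg_add: "x \<in> carrier (P i) \<Longrightarrow> y \<in> carrier (P i) \<Longrightarrow> sg i j (x \<oplus>\<^bsub>P i\<^esub> y) = sg i j x \<oplus>\<^bsub>P i\<^esub> sg i j y"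
  by (simp add: sg_def P_minus_add)

lemma sg_smult: "a \<in> carrier A \<Longrightarrow> x \<in> carrier (P i) \<Longrightarrow> sg i j (a \<odot>\<^bsub>P i\<^esub> x) = a \<odot>\<^bsub>P i\<^esub> sg i j x"
  by (simp add: sg_def P_smult_minus)

lemma sg_d: "x \<in> carrier (P (Suc i)) \<Longrightarrow> d i (sg (Suc i) j x) = sg i j (d i x)"
  by (simp add: sg_def d_minus)

lemma sg_cancel: "x \<in> carrier (P i) \<Longrightarrow> sg i j x \<oplus>\<^bsub>P i\<^esub> sg i (Suc j) x = \<zero>\<^bsub>P i\<^esub>"
  by (simp add: sg_def)

text \<open>Read off from the product of a + x b with \<open>1 \<otimes> p + x \<otimes> q\<close>,
  where a is \<open>\<alpha> t\<close> and b is \<open>\<beta> t\<close>: moving a past x turns it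
  into \<psi>(a), and the term with two factors x vanishes. In column j all scalars are in addition
  twisted by \<open>Psi j\<close>.\<close>

definition act :: "nat \<Rightarrow> 'b \<Rightarrow> 'z \<Rightarrow> nat \<times> bool \<Rightarrow> 'm" where
  "act m t z = (\<lambda>(j, b).
     if b then Psi (Suc j) (\<alpha> t) \<odot>\<^bsub>P (m - j)\<^esub> dec z (j, True) \<oplus>\<^bsub>P (m - j)\<^esub> Psi j (\<beta> t) \<odot>\<^bsub>P (m - j)\<^esub> dec z (j, False)
     else Psi j (\<alpha> t) \<odot>\<^bsub>P (m - j)\<^esub> dec z (j, False))"

definition Ind :: "nat \<Rightarrow> (nat \<times> bool) set" where "Ind m = {..m} \<times> UNIV"

lemma Ind_iff [simp]: "(j, b) \<in> Ind m \<longleftrightarrow> j \<le> m"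
  by (simp add: Ind_def)

text \<open>The term \<open>Q m\<close> of the resolution over \<open>T\<close> is the sum of the modules \<open>T \<otimes> P\<^sub>m\<^sub>-\<^sub>j\<close>, twisted by
  \<open>\<psi>\<^sup>j\<close> and shifted by \<open>j\<close>, for \<open>j \<le> m\<close>. The entries of an element \<open>z\<close> at \<open>(j, False)\<close> and
  \<open>(j, True)\<close> are the \<open>p\<close> and \<open>q\<close> of its component \<open>1 \<otimes> p + x \<otimes> q\<close>.\<close>

definition Q :: "nat \<Rightarrow> ('b, 'z) module" where
  "Q m = family_module (Ind m) (\<lambda>(j, b). P (m - j)) enc dec (act m)"

text \<open>The entries with a factor x are shifted by one more than the others of their column, as
  x has degree one.\<close>

definition HQ :: "nat \<Rightarrow> nat \<Rightarrow> 'z set" where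
  "HQ m = family_grading (Ind m) (\<lambda>(j, b). P (m - j)) (\<lambda>(j, b). H (m - j)) (\<lambda>(j, b). j + of_bool b) enc"

lemma graded_family_Q:
  "graded_family (Ind m) (\<lambda>(j, b). P (m - j)) (\<lambda>(j, b). H (m - j)) enc dec"
  by (intro graded_family.intro) (auto simp: Ind_def dec_enc P_graded_group)

lemma Q_enc_in:
  assumes "\<And>j. j \<le> m \<Longrightarrow> f (j, False) \<in> carrier (P (m - j))" "\<And>j. j \<le> m \<Longrightarrow> f (j, True) \<in> carrier (P (m - j))"
  shows "enc (restrict f (Ind m)) \<in> carrier (Q m)"
proof -
  have "f i \<in> carrier ((\<lambda>(j, b). P (m - j)) i)" if "i \<in> Ind m" for i
    using that assms by (cases i; cases "snd i") auto
  then show ?thesis unfolding Q_def by (rule graded_family.enc_in[OF graded_family_Q])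
qed

lemma Q_dec [simp]: "z \<in> carrier (Q m) \<Longrightarrow> j \<le> m \<Longrightarrow> dec z (j, b) \<in> carrier (P (m - j))"
  using graded_family.dec_in[OF graded_family_Q[of m], where z = z and i = "(j, b)"] by (simp add: Q_def)

lemma Q_eqI:
  assumes "z \<in> carrier (Q m)" "w \<in> carrier (Q m)"
    and "\<And>j. j \<le> m \<Longrightarrow> dec z (j, False) = dec w (j, False)"
    and "\<And>j. j \<le> m \<Longrightarrow> dec z (j, True) = dec w (j, True)"
  shows "z = w"
proof (rule graded_family.dec_eqI[OF graded_family_Q])
  show "dec z i = dec w i" if "i \<in> Ind m" for i
    using that assms(3,4) by (cases i; cases "snd i") auto
qed (use assms in \<open>simp_all add: Q_def\<close>)

lemma dec_restrict [simp]: "j \<le> m \<Longrightarrow> dec (enc (restrict f (Ind m))) (j, b) = f (j, b)"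
  by (simp add: dec_enc)

lemma Q_group: "abelian_group (Q m)"
  unfolding Q_def by (rule graded_family.abelian_group_Q[OF graded_family_Q])

lemma Q_monoid: "abelian_monoid (Q m)"
  using Q_group abelian_group.axioms(1) by blast

lemmas Q_zero_closed [simp] = abelian_monoid.zero_closed[OF Q_monoid]
  and Q_a_closed [simp] = abelian_monoid.a_closed[OF Q_monoid]

lemma Q_dec_zero [simp]: "j \<le> m \<Longrightarrow> dec \<zero>\<^bsub>Q m\<^esub> (j, b) = \<zero>\<^bsub>P (m - j)\<^esub>"
  using graded_family.dec_zero[OF graded_family_Q[of m], where i = "(j, b)"] by (simp add: Q_def)

lemma Q_dec_add [simp]: "j \<le> m \<Longrightarrow> dec (z \<oplus>\<^bsub>Q m\<^esub> w) (j, b) = dec z (j, b) \<oplus>\<^bsub>P (m - j)\<^esub> dec w (j, b)"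
  using graded_family.dec_add[OF graded_family_Q[of m], where i = "(j, b)"] by (simp add: Q_def)

lemma Q_dec_smult [simp]:
  "j \<le> m \<Longrightarrow> dec (t \<odot>\<^bsub>Q m\<^esub> z) (j, False) = Psi j (\<alpha> t) \<odot>\<^bsub>P (m - j)\<^esub> dec z (j, False)"
  "j \<le> m \<Longrightarrow> dec (t \<odot>\<^bsub>Q m\<^esub> z) (j, True) =
    Psi (Suc j) (\<alpha> t) \<odot>\<^bsub>P (m - j)\<^esub> dec z (j, True) \<oplus>\<^bsub>P (m - j)\<^esub> Psi j (\<beta> t) \<odot>\<^bsub>P (m - j)\<^esub> dec z (j, False)"
  using graded_family.dec_smult[OF graded_family_Q[of m], where i = "(j, False)" and act = "act m"]
    graded_family.dec_smult[OF graded_family_Q[of m], where i = "(j, True)" and act = "act m"]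
  by (simp_all add: Q_def act_def)

lemma Q_smult_eq: "t \<odot>\<^bsub>Q m\<^esub> z = enc (restrict (act m t z) (Ind m))"
  unfolding Q_def by (rule graded_family.smult_Q[OF graded_family_Q])

lemma Q_smult_closed [simp]: "t \<in> carrier T \<Longrightarrow> z \<in> carrier (Q m) \<Longrightarrow> t \<odot>\<^bsub>Q m\<^esub> z \<in> carrier (Q m)"
  unfolding Q_smult_eq by (rule Q_enc_in) (simp_all add: act_def)

lemma Q_module: "left_module T (Q m)"
proof (intro left_module.intro left_module_axioms.intro T.ring_axioms Q_group)
  fix t u z w assume t: "t \<in> carrier T" and u: "u \<in> carrier T"
    and z: "z \<in> carrier (Q m)" and w: "w \<in> carrier (Q m)"
  show "t \<odot>\<^bsub>Q m\<^esub> z \<in> carrier (Q m)" using t z by simp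
  show "(t \<oplus>\<^bsub>T\<^esub> u) \<odot>\<^bsub>Q m\<^esub> z = t \<odot>\<^bsub>Q m\<^esub> z \<oplus>\<^bsub>Q m\<^esub> u \<odot>\<^bsub>Q m\<^esub> z"
    by (rule Q_eqI[where m = m]) (use t u z in
      \<open>simp_all add: \<alpha>_add \<beta>_add Psi_add P_smult_l_distr P_a_assoc P_a_comm P_a_lcomm\<close>)
  show "t \<odot>\<^bsub>Q m\<^esub> (z \<oplus>\<^bsub>Q m\<^esub> w) = t \<odot>\<^bsub>Q m\<^esub> z \<oplus>\<^bsub>Q m\<^esub> t \<odot>\<^bsub>Q m\<^esub> w"
    by (rule Q_eqI[where m = m]) (use t z w in
      \<open>simp_all add: P_smult_r_distr P_a_assoc P_a_comm P_a_lcomm\<close>)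
  \<comment> \<open>At the x-entry this is \<open>\<beta>_mult\<close> under \<open>Psi j\<close>,
    with \<open>Psi j (\<psi> a)\<close> read as \<open>Psi (Suc j) a\<close>: the extra power of
    \<psi> there is forced by a x = x \<psi>(a).\<close>
  show "(t \<otimes>\<^bsub>T\<^esub> u) \<odot>\<^bsub>Q m\<^esub> z = t \<odot>\<^bsub>Q m\<^esub> (u \<odot>\<^bsub>Q m\<^esub> z)"
    by (rule Q_eqI[where m = m]) (use t u z in
      \<open>simp_all add: \<alpha>_mult \<beta>_mult \<psi>_mult Psi_add Psi_mult Psi_Suc P_smult_l_distr P_smult_r_distr
        P_smult_assoc1 P_a_assoc\<close>)
next
  show "\<one>\<^bsub>T\<^esub> \<odot>\<^bsub>Q m\<^esub> z = z" if z: "z \<in> carrier (Q m)" for z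
    by (rule Q_eqI[where m = m]) (use z in \<open>simp_all add: \<alpha>_one \<beta>_one\<close>)
qed

abbreviation "Sh i \<equiv> shifted_component (P i) (H i)"

lemma HQ_iff: "z \<in> HQ m t \<longleftrightarrow> z \<in> carrier (Q m) \<and>
    (\<forall>j\<le>m. dec z (j, False) \<in> Sh (m - j) j t \<and>
      dec z (j, True) \<in> Sh (m - j) (Suc j) t)"
proof -
  have "(\<forall>i\<in>Ind m. R i) \<longleftrightarrow> (\<forall>j\<le>m. R (j, False) \<and> R (j, True))" for R
  proof
    assume R: "\<forall>j\<le>m. R (j, False) \<and> R (j, True)"
    show "\<forall>i\<in>Ind m. R i"
    proof
      fix i assume "i \<in> Ind m" then show "R i" using R by (cases i; cases "snd i") auto
    qed
  qed simp
  then show ?thesis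
    unfolding HQ_def Q_def graded_family.HQ_iff[OF graded_family_Q[of m], where act = "act m"] by simp
qed

lemma shifted_zero [simp]: "\<zero>\<^bsub>P i\<^esub> \<in> Sh i r t"
  by (simp add: shifted_component_def graded_group.component_zero[OF P_graded_group])

lemma shifted_add: "x \<in> Sh i r t \<Longrightarrow> y \<in> Sh i r t \<Longrightarrow>
    x \<oplus>\<^bsub>P i\<^esub> y \<in> Sh i r t"
  by (auto simp: shifted_component_def graded_group.component_add[OF P_graded_group] split: if_splits)

lemma shifted_smult:
  assumes "a \<in> G u" "x \<in> Sh i r t"
  shows "a \<odot>\<^bsub>P i\<^esub> x \<in> Sh i r (u + t)"
proof (cases "r \<le> t")
  case True
  then show ?thesis using assms P_smult_graded[of a u x i "t - r"]
    by (simp add: shifted_component_def)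
next
  case False
  then have "x = \<zero>\<^bsub>P i\<^esub>" using assms by (simp add: shifted_component_def)
  then show ?thesis using AG.component_closed[OF assms(1)] by simp
qed

lemma shifted_Suc_Suc: "shifted_component M H' (Suc r) (Suc t) = shifted_component M H' r t"
  by (simp add: shifted_component_def)

lemma shifted_sg: "x \<in> Sh i r t \<Longrightarrow> sg i j x \<in> Sh i r t"
  by (auto simp: shifted_component_def sg_def graded_group.component_minus[OF P_graded_group] split: if_splits)

lemma shifted_d: "x \<in> Sh (Suc i) r t \<Longrightarrow> d i x \<in> Sh i r t"
  by (auto simp: shifted_component_def d_graded split: if_splits)

lemma Q_graded: "graded_left_module T TG (Q m) (HQ m)"
  unfolding graded_left_module_def
proof (intro conjI allI ballI Q_module)
  show "direct_sum_decomposition (Q m) (HQ m)"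
    using graded_group.decomp[OF graded_family.graded_Q[OF graded_family_Q]] unfolding Q_def HQ_def .
  fix u r a z assume a: "a \<in> TG u" and z: "z \<in> HQ m r"
  show "a \<odot>\<^bsub>Q m\<^esub> z \<in> HQ m (u + r)"
    unfolding HQ_iff
  proof (intro conjI allI impI)
    have "a \<in> carrier T" using TG.component_closed[OF a] .
    then show "a \<odot>\<^bsub>Q m\<^esub> z \<in> carrier (Q m)" using z by (simp add: HQ_iff)
    fix j assume j: "j \<le> m"
    have p: "dec z (j, False) \<in> Sh (m - j) j r"
      and q: "dec z (j, True) \<in> Sh (m - j) (Suc j) r"
      and zc: "z \<in> carrier (Q m)"
      using z j by (auto simp: HQ_iff)
    show "dec (a \<odot>\<^bsub>Q m\<^esub> z) (j, False) \<in> Sh (m - j) j (u + r)"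
      using j shifted_smult[OF Psi_graded[OF \<alpha>_graded[OF a]] p] by simp
    \<comment> \<open>\<open>\<beta>\<close> lowers the degree by one while the x-entry is shifted
      by one more, so the degrees balance; for degree zero \<open>\<beta>\<close> vanishes
      instead.\<close>
    have "Psi j (\<beta> a) \<odot>\<^bsub>P (m - j)\<^esub> dec z (j, False) \<in> Sh (m - j) (Suc j) (u + r)"
    proof (cases u)
      case 0
      then show ?thesis using a zc j by (simp add: \<beta>_graded_zero)
    next
      case (Suc u')
      then have "\<beta> a \<in> G u'" using a \<beta>_graded by simp
      from shifted_smult[OF Psi_graded[OF this] p] show ?thesis
        by (simp add: shifted_Suc_Suc Suc)
    qed
    then show "dec (a \<odot>\<^bsub>Q m\<^esub> z) (j, True) \<in> Sh (m - j) (Suc j) (u + r)"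
      using j shifted_smult[OF Psi_graded[OF \<alpha>_graded[OF a]] q] by (simp add: shifted_add)
  qed
qed

end

lemma submoduleD:
  assumes "abelian_group M" and "submodule N R M"
  shows "N \<subseteq> carrier M" and "\<zero>\<^bsub>M\<^esub> \<in> N"
    and "x \<in> N \<Longrightarrow> y \<in> N \<Longrightarrow> x \<oplus>\<^bsub>M\<^esub> y \<in> N" and "x \<in> N \<Longrightarrow> \<ominus>\<^bsub>M\<^esub> x \<in> N"
    and "a \<in> carrier R \<Longrightarrow> x \<in> N \<Longrightarrow> a \<odot>\<^bsub>M\<^esub> x \<in> N"
proof -
  interpret additive_subgroup N M
    using assms(2) by (intro additive_subgroup.intro) (simp add: submodule_def)
  interpret abelian_group M by fact
  show "N \<subseteq> carrier M" by (rule a_subset)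
  show "\<zero>\<^bsub>M\<^esub> \<in> N" by simp
  show "x \<in> N \<Longrightarrow> y \<in> N \<Longrightarrow> x \<oplus>\<^bsub>M\<^esub> y \<in> N" by simp
  show "x \<in> N \<Longrightarrow> \<ominus>\<^bsub>M\<^esub> x \<in> N"
    using subgroup.m_inv_closed[OF a_subgroup] by (simp add: a_inv_def)
  show "a \<in> carrier R \<Longrightarrow> x \<in> N \<Longrightarrow> a \<odot>\<^bsub>M\<^esub> x \<in> N"
    using assms(2) by (rule submodule.smult_closed)
qed

lemma submoduleI':
  assumes "abelian_group M" and "N \<subseteq> carrier M" and "\<zero>\<^bsub>M\<^esub> \<in> N"
    and "\<And>x y. x \<in> N \<Longrightarrow> y \<in> N \<Longrightarrow> x \<oplus>\<^bsub>M\<^esub> y \<in> N" and "\<And>x. x \<in> N \<Longrightarrow> \<ominus>\<^bsub>M\<^esub> x \<in> N"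
    and "\<And>a x. a \<in> carrier R \<Longrightarrow> x \<in> N \<Longrightarrow> a \<odot>\<^bsub>M\<^esub> x \<in> N"
  shows "submodule N R M"
  using additive_subgroupI'[OF assms(1-5)] assms(6)
  by (auto intro!: submodule.intro submodule_axioms.intro simp: additive_subgroup_def)

section \<open>The total differential and exactness\<close>

context skew_resolution
begin

text \<open>The signed differential of P inside each column, plus the map taking
  \<open>1 \<otimes> p\<close> in column j + 1 to \<open>x \<otimes> p\<close> in column j. These
  two entries carry the same twist \<open>Psi (Suc j)\<close> and the same shift j + 1, which makes
  the second part linear and of degree zero.\<close>

definition D :: "nat \<Rightarrow> 'z \<Rightarrow> 'z" where
  "D m z = enc (restrict (\<lambda>(j, b).
     if b then sg (m - j) j (d (m - j) (dec z (j, True))) \<oplus>\<^bsub>P (m - j)\<^esub> dec z (Suc j, False)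
     else sg (m - j) j (d (m - j) (dec z (j, False)))) (Ind m))"

lemma D_dec [simp]:
  "j \<le> m \<Longrightarrow> dec (D m z) (j, False) = sg (m - j) j (d (m - j) (dec z (j, False)))"
  "j \<le> m \<Longrightarrow> dec (D m z) (j, True) =
    sg (m - j) j (d (m - j) (dec z (j, True))) \<oplus>\<^bsub>P (m - j)\<^esub> dec z (Suc j, False)"
  by (simp_all add: D_def)

lemma Q_dec_Suc [simp]: "z \<in> carrier (Q (Suc m)) \<Longrightarrow> j \<le> m \<Longrightarrow> dec z (j, b) \<in> carrier (P (Suc (m - j)))"
  using Q_dec[of z "Suc m" j b] by (simp add: Suc_diff_le)

lemma Q_dec_Suc_Suc [simp]: "z \<in> carrier (Q (Suc m)) \<Longrightarrow> j \<le> m \<Longrightarrow> dec z (Suc j, b) \<in> carrier (P (m - j))"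
  using Q_dec[of z "Suc m" "Suc j" b] by simp

lemma D_closed [simp]: "z \<in> carrier (Q (Suc m)) \<Longrightarrow> D m z \<in> carrier (Q m)"
  unfolding D_def by (rule Q_enc_in) simp_all

lemma D_hom: "D m \<in> graded_hom T (Q (Suc m)) (HQ (Suc m)) (Q m) (HQ m)"
  unfolding graded_hom_def left_module_hom_def
proof (intro CollectI conjI ballI allI funcsetI)
  show "D m z \<in> carrier (Q m)" if "z \<in> carrier (Q (Suc m))" for z
    using that by simp
  show "D m (z \<oplus>\<^bsub>Q (Suc m)\<^esub> w) = D m z \<oplus>\<^bsub>Q m\<^esub> D m w"
    if "z \<in> carrier (Q (Suc m))" "w \<in> carrier (Q (Suc m))" for z w
    by (rule Q_eqI[where m = m]) (use that in
      \<open>simp_all add: Suc_diff_le d_add sg_add P_a_assoc P_a_comm P_a_lcomm\<close>)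
  show "D m (t \<odot>\<^bsub>Q (Suc m)\<^esub> z) = t \<odot>\<^bsub>Q m\<^esub> D m z"
    if "t \<in> carrier T" "z \<in> carrier (Q (Suc m))" for t z
    by (rule Q_eqI[where m = m]) (use that in
      \<open>simp_all add: Suc_diff_le d_add sg_add d_smult sg_smult P_smult_r_distr P_a_assoc P_a_comm P_a_lcomm\<close>)
  show "D m ` HQ (Suc m) t \<subseteq> HQ m t" for t
  proof clarify
    fix z assume z: "z \<in> HQ (Suc m) t"
    then have zc: "z \<in> carrier (Q (Suc m))" by (simp add: HQ_iff)
    have p: "dec z (j, False) \<in> Sh (Suc (m - j)) j t"
      and q: "dec z (j, True) \<in> Sh (Suc (m - j)) (Suc j) t"
      and r: "dec z (Suc j, False) \<in> Sh (m - j) (Suc j) t" if "j \<le> m" for j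
    proof -
      have "j \<le> Suc m" "Suc j \<le> Suc m" using that by simp_all
      with z that show "dec z (j, False) \<in> Sh (Suc (m - j)) j t"
        "dec z (j, True) \<in> Sh (Suc (m - j)) (Suc j) t"
        "dec z (Suc j, False) \<in> Sh (m - j) (Suc j) t"
        unfolding HQ_iff by (metis Suc_diff_le, metis Suc_diff_le, metis diff_Suc_Suc)
    qed
    show "D m z \<in> HQ m t"
      unfolding HQ_iff using zc p q r by (simp add: shifted_add shifted_sg shifted_d)
  qed
qed

lemma D_D:
  assumes "z \<in> carrier (Q (Suc (Suc m)))" shows "D m (D (Suc m) z) = \<zero>\<^bsub>Q m\<^esub>"
proof (rule Q_eqI[where m = m])
  fix j assume j: "j \<le> m"
  have p: "dec z (j, b) \<in> carrier (P (Suc (Suc (m - j))))" for b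
    using Q_dec_Suc[OF assms, of j b] j by (simp add: Suc_diff_le)
  show "dec (D m (D (Suc m) z)) (j, False) = dec \<zero>\<^bsub>Q m\<^esub> (j, False)"
    using j p by (simp add: Suc_diff_le sg_d)
  have r: "dec z (Suc j, False) \<in> carrier (P (Suc (m - j)))"
    using Q_dec_Suc_Suc[OF assms, of j False] j by (simp add: Suc_diff_le)
  \<comment> \<open>Besides the square of the differential of P there are two mixed terms: the image
    under d of the same entry, once with the sign of column j and once with that of column j +
    1.\<close>
  show "dec (D m (D (Suc m) z)) (j, True) = dec \<zero>\<^bsub>Q m\<^esub> (j, True)"
    using j p r by (simp add: Suc_diff_le sg_d d_add sg_add sg_cancel)
qed (use assms in simp_all)

text \<open>The map \<open>1 \<otimes> p \<mapsto> x \<otimes> p\<close> is onto the x-entries, so a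
  preimage of z arises by moving each x-entry of z to the free entry of the next column. Only column
  0 is not covered by this, and there a lift r along d is put in. The relations \<open>zq\<close>
  say that the x-entries of the differential of z vanish; for m = 0 there are none, so that the
  augmented end of the complex is covered as well.\<close>

lemma D_lift:
  assumes z: "z \<in> carrier (Q m)" and r: "r \<in> carrier (P (Suc m))" "d m r = dec z (0, False)"
    and zq: "\<And>j. j < m \<Longrightarrow> sg (m - Suc j) j (d (m - Suc j) (dec z (j, True))) \<oplus>\<^bsub>P (m - Suc j)\<^esub>
      dec z (Suc j, False) = \<zero>\<^bsub>P (m - Suc j)\<^esub>"
  shows "z \<in> D m ` carrier (Q (Suc m))"
proof (rule image_eqI)
  let ?f = "\<lambda>(j, b). if b then \<zero>\<^bsub>P (Suc m - j)\<^esub> else case j of 0 \<Rightarrow> r | Suc k \<Rightarrow> dec z (k, True)"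
  let ?w = "enc (restrict ?f (Ind (Suc m)))"
  show w: "?w \<in> carrier (Q (Suc m))"
    by (rule Q_enc_in) (use z r in \<open>auto split: nat.split\<close>)
  show "z = D m ?w"
  proof (rule Q_eqI[where m = m])
    fix j assume j: "j \<le> m"
    show "dec z (j, True) = dec (D m ?w) (j, True)"
      using j z by (simp add: Suc_diff_le)
    show "dec z (j, False) = dec (D m ?w) (j, False)"
    proof (cases j)
      case 0
      then show ?thesis using r by simp
    next
      case (Suc k)
      then have k: "k < m" "m - k = Suc (m - Suc k)" using j by auto
      let ?i = "m - Suc k"
      have q: "dec z (k, True) \<in> carrier (P (Suc ?i))" and p: "dec z (Suc k, False) \<in> carrier (P ?i)"
        using Q_dec[OF z, of k True] Q_dec[OF z, of "Suc k" False] k by simp_all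
      let ?y = "d ?i (dec z (k, True))"
      \<comment> \<open>The relation in column k makes \<open>dec z (Suc k, False)\<close> the
        negative of \<open>sg ?i k ?y\<close>, and a change of sign is the same as passing to the
        sign of column k + 1.\<close>
      have "sg ?i (Suc k) ?y \<oplus>\<^bsub>P ?i\<^esub> (sg ?i k ?y \<oplus>\<^bsub>P ?i\<^esub> dec z (Suc k, False)) = sg ?i (Suc k) ?y"
        using zq[OF k(1)] q by simp
      moreover have "sg ?i (Suc k) ?y \<oplus>\<^bsub>P ?i\<^esub> sg ?i k ?y = \<zero>\<^bsub>P ?i\<^esub>"
        using sg_cancel[of ?y ?i k] q by (simp add: P_a_comm)
      ultimately have "dec z (Suc k, False) = sg ?i (Suc k) ?y"
        using p q P_a_assoc[of "sg ?i (Suc k) ?y" ?i "sg ?i k ?y" "dec z (Suc k, False)"] by simp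
      then show ?thesis using Suc j by simp
    qed
  qed (use z w in simp_all)
qed

lemma Q_exact: "D (Suc m) ` carrier (Q (Suc (Suc m))) = {z \<in> carrier (Q (Suc m)). D m z = \<zero>\<^bsub>Q m\<^esub>}"
proof (intro equalityI subsetI)
  show "z \<in> {z \<in> carrier (Q (Suc m)). D m z = \<zero>\<^bsub>Q m\<^esub>}" if "z \<in> D (Suc m) ` carrier (Q (Suc (Suc m)))" for z
    using that D_D by auto
  fix z assume "z \<in> {z \<in> carrier (Q (Suc m)). D m z = \<zero>\<^bsub>Q m\<^esub>}"
  then have z: "z \<in> carrier (Q (Suc m))" and Dz: "D m z = \<zero>\<^bsub>Q m\<^esub>" by auto
  \<comment> \<open>Exactness of P is used in column 0, to lift the free entry; the other columns
    are settled by \<open>D_lift\<close>.\<close>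
  have "d m (dec z (0, False)) = \<zero>\<^bsub>P m\<^esub>"
    using arg_cong[OF Dz, of "\<lambda>w. dec w (0, False)"] by simp
  moreover have "dec z (0, False) \<in> carrier (P (Suc m))"
    using Q_dec[OF z, of 0] by simp
  ultimately obtain r where r: "r \<in> carrier (P (Suc (Suc m)))" "d (Suc m) r = dec z (0, False)"
    using exact[of m] by (smt (verit, best) image_iff mem_Collect_eq)
  show "z \<in> D (Suc m) ` carrier (Q (Suc (Suc m)))"
  proof (rule D_lift[OF z r])
    fix j assume "j < Suc m"
    then show "sg (Suc m - Suc j) j (d (Suc m - Suc j) (dec z (j, True))) \<oplus>\<^bsub>P (Suc m - Suc j)\<^esub>
      dec z (Suc j, False) = \<zero>\<^bsub>P (Suc m - Suc j)\<^esub>"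
      using arg_cong[OF Dz, of "\<lambda>w. dec w (j, True)"] by simp
  qed
qed

text \<open>The x-entry is discarded because x has positive degree and acts as zero on the
  degree-zero part.\<close>

definition aug :: "'z \<Rightarrow> 'b" where "aug z = comb (\<epsilon> (dec z (0, False))) \<zero>"

lemma \<epsilon>_closed: "x \<in> carrier (P 0) \<Longrightarrow> \<epsilon> x \<in> G 0"
  using \<epsilon>_surj by blast

lemma \<epsilon>_closed' [simp]: "x \<in> carrier (P 0) \<Longrightarrow> \<epsilon> x \<in> carrier A"
  using \<epsilon>_closed AG.component_closed by blast

lemma comb_zero [simp]: "comb \<zero> \<zero> = \<zero>\<^bsub>T\<^esub>"
proof (rule T_eqI)
  have "\<alpha> \<zero>\<^bsub>T\<^esub> = \<zero>"
    by (rule additive_zero[OF T.abelian_group_axioms A.abelian_group_axioms]) (auto simp: \<alpha>_add)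
  moreover have "\<beta> \<zero>\<^bsub>T\<^esub> = \<zero>"
    by (rule additive_zero[OF T.abelian_group_axioms A.abelian_group_axioms]) (auto simp: \<beta>_add)
  ultimately show "\<alpha> (comb \<zero> \<zero>) = \<alpha> \<zero>\<^bsub>T\<^esub>" "\<beta> (comb \<zero> \<zero>) = \<beta> \<zero>\<^bsub>T\<^esub>" by simp_all
qed simp_all

lemma comb_mult:
  assumes "t \<in> carrier T" "a \<in> carrier A" "b \<in> carrier A"
  shows "t \<otimes>\<^bsub>T\<^esub> comb a b = comb (\<alpha> t \<otimes> a) (\<psi> (\<alpha> t) \<otimes> b \<oplus> \<beta> t \<otimes> a)"
  by (rule T_eqI) (use assms in \<open>simp_all add: \<alpha>_mult \<beta>_mult\<close>)

lemma Q_dec_0 [simp]: "z \<in> carrier (Q 0) \<Longrightarrow> dec z (0, b) \<in> carrier (P 0)"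
  using Q_dec[of z 0 0 b] by simp

lemma aug_hom: "aug \<in> graded_hom T (Q 0) (HQ 0) (degree_zero_module T TG) (degree_zero_grading T TG)"
  unfolding graded_hom_def left_module_hom_def
proof (intro CollectI conjI ballI allI funcsetI)
  have \<epsilon>_add: "\<epsilon> (x \<oplus>\<^bsub>P 0\<^esub> y) = \<epsilon> x \<oplus> \<epsilon> y"
    if "x \<in> carrier (P 0)" "y \<in> carrier (P 0)" for x y
    using that \<epsilon>_hom by (auto simp: graded_hom_def left_module_hom_def degree_zero_module_def)
  have \<epsilon>_smult: "\<epsilon> (a \<odot>\<^bsub>P 0\<^esub> x) = AG.pr 0 a \<otimes> \<epsilon> x"
    if "x \<in> carrier (P 0)" "a \<in> carrier A" for x a
    using that \<epsilon>_hom by (auto simp: graded_hom_def left_module_hom_def degree_zero_module_def)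
  have \<epsilon>g: "\<epsilon> ` H 0 t \<subseteq> degree_zero_grading A G t" for t
    using \<epsilon>_hom by (auto simp: graded_hom_def)
  show "aug z \<in> carrier (degree_zero_module T TG)" if "z \<in> carrier (Q 0)" for z
    using that by (simp add: degree_zero_module_def aug_def TG_zero \<epsilon>_closed)
  show "aug (z \<oplus>\<^bsub>Q 0\<^esub> w) = aug z \<oplus>\<^bsub>degree_zero_module T TG\<^esub> aug w"
    if "z \<in> carrier (Q 0)" "w \<in> carrier (Q 0)" for z w
    using that comb_add[of _ "\<zero>" _ "\<zero>"] by (simp add: degree_zero_module_def aug_def \<epsilon>_add)
  show "aug (t \<odot>\<^bsub>Q 0\<^esub> z) = t \<odot>\<^bsub>degree_zero_module T TG\<^esub> aug z"
    if "t \<in> carrier T" "z \<in> carrier (Q 0)" for t z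
    using that by (simp add: degree_zero_module_def aug_def \<epsilon>_smult T_pr_zero comb_mult)
  show "aug ` HQ 0 t \<subseteq> degree_zero_grading T TG t" for t
  proof clarify
    fix z assume z: "z \<in> HQ 0 t"
    then have "dec z (0, False) \<in> H 0 t" by (simp add: HQ_iff shifted_component_def)
    then have "\<epsilon> (dec z (0, False)) \<in> degree_zero_grading A G t" using \<epsilon>g by blast
    then show "aug z \<in> degree_zero_grading T TG t"
      by (auto simp: degree_zero_grading_def aug_def TG_zero split: if_splits)
  qed
qed

lemma aug_surj: "aug ` carrier (Q 0) = TG 0"
proof (intro equalityI subsetI)
  show "t \<in> TG 0" if "t \<in> aug ` carrier (Q 0)" for t
    using that by (auto simp: aug_def TG_zero \<epsilon>_closed)
  fix t assume "t \<in> TG 0"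
  then obtain x where x: "x \<in> carrier (P 0)" "t = comb (\<epsilon> x) \<zero>"
    unfolding TG_zero \<epsilon>_surj[symmetric] by blast
  show "t \<in> aug ` carrier (Q 0)"
  proof (rule image_eqI)
    let ?z = "enc (restrict (\<lambda>_. x) (Ind 0))"
    show "?z \<in> carrier (Q 0)" by (rule Q_enc_in) (use x in simp_all)
    show "t = aug ?z" using x by (simp add: aug_def)
  qed
qed

lemma Q_exact_0: "D 0 ` carrier (Q 1) = {z \<in> carrier (Q 0). aug z = \<zero>\<^bsub>T\<^esub>}"
proof (intro equalityI subsetI)
  show "z \<in> {z \<in> carrier (Q 0). aug z = \<zero>\<^bsub>T\<^esub>}" if z: "z \<in> D 0 ` carrier (Q 1)" for z
  proof -
    obtain w where w: "w \<in> carrier (Q (Suc 0))" "z = D 0 w" using z by auto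
    then have "dec w (0, False) \<in> carrier (P (Suc 0))" using Q_dec[OF w(1), of 0] by simp
    then show ?thesis using w by (simp add: aug_def)
  qed
  fix z assume "z \<in> {z \<in> carrier (Q 0). aug z = \<zero>\<^bsub>T\<^esub>}"
  then have z: "z \<in> carrier (Q 0)" and az: "aug z = comb \<zero> \<zero>" by auto
  have "\<epsilon> (dec z (0, False)) = \<zero>"
    using arg_cong[OF az, of \<alpha>] z by (simp add: aug_def del: comb_zero)
  then obtain r where r: "r \<in> carrier (P (Suc 0))" "d 0 r = dec z (0, False)"
    using exact_0 Q_dec_0[OF z, of False] by (smt (verit, best) One_nat_def image_iff mem_Collect_eq)
  show "z \<in> D 0 ` carrier (Q 1)"
    using D_lift[OF z r] by simp
qed

section \<open>Generation of the m-th term in degree m\<close>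

definition single :: "nat \<Rightarrow> nat \<Rightarrow> bool \<Rightarrow> 'm \<Rightarrow> 'z" where
  "single m k b p = enc (restrict (\<lambda>(j, b'). if j = k \<and> b' = b then p else \<zero>\<^bsub>P (m - j)\<^esub>) (Ind m))"

lemma single_dec [simp]: "j \<le> m \<Longrightarrow> dec (single m k b p) (j, b') = (if j = k \<and> b' = b then p else \<zero>\<^bsub>P (m - j)\<^esub>)"
  by (simp add: single_def)

lemma single_closed [simp]: "p \<in> carrier (P (m - k)) \<Longrightarrow> single m k b p \<in> carrier (Q m)"
  unfolding single_def by (rule Q_enc_in) auto

lemma Q_dec_minus [simp]:
  assumes "z \<in> carrier (Q m)" and "j \<le> m" shows "dec (\<ominus>\<^bsub>Q m\<^esub> z) (j, b) = \<ominus>\<^bsub>P (m - j)\<^esub> dec z (j, b)"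
  by (rule additive_minus[OF Q_group P_group]) (use assms in auto)

lemma Q_minus_closed [simp]: "z \<in> carrier (Q m) \<Longrightarrow> \<ominus>\<^bsub>Q m\<^esub> z \<in> carrier (Q m)"
  by (rule abelian_group.a_inv_closed[OF Q_group])

text \<open>Column k is generated by the part of \<open>P (m - k)\<close> of degree m - k, which the
  shift by k moves to degree m. So N contains every \<open>1 \<otimes> p\<close>, then every
  \<open>x \<otimes> p\<close> by the action of x, and these span.\<close>

lemma Q_submodule_eq:
  assumes N: "submodule N T (Q m)" and sub: "HQ m m \<subseteq> N"
  shows "carrier (Q m) \<subseteq> N"
proof -
  note ND = submoduleD[OF Q_group N]
  have p_in: "single m k False p \<in> N" if k: "k \<le> m" and p: "p \<in> carrier (P (m - k))" for k p
  proof -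
    let ?L = "{p \<in> carrier (P (m - k)). single m k False p \<in> N}"
    have "submodule ?L A (P (m - k))"
    proof (rule submoduleI'[OF P_group])
      have "single m k False \<zero>\<^bsub>P (m - k)\<^esub> = \<zero>\<^bsub>Q m\<^esub>"
        by (rule Q_eqI[where m = m]) auto
      then show "\<zero>\<^bsub>P (m - k)\<^esub> \<in> ?L" using ND(2) by simp
      show "x \<oplus>\<^bsub>P (m - k)\<^esub> y \<in> ?L" if xy: "x \<in> ?L" "y \<in> ?L" for x y
      proof -
        have "single m k False (x \<oplus>\<^bsub>P (m - k)\<^esub> y) = single m k False x \<oplus>\<^bsub>Q m\<^esub> single m k False y"
          by (rule Q_eqI[where m = m]) (use xy in auto)
        then show ?thesis using ND(3) xy by simp
      qed
      show "\<ominus>\<^bsub>P (m - k)\<^esub> x \<in> ?L" if x: "x \<in> ?L" for x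
      proof -
        have "single m k False (\<ominus>\<^bsub>P (m - k)\<^esub> x) = \<ominus>\<^bsub>Q m\<^esub> single m k False x"
          by (rule Q_eqI[where m = m]) (use x in auto)
        then show ?thesis using ND(4) x by simp
      qed
      show "a \<odot>\<^bsub>P (m - k)\<^esub> x \<in> ?L" if ax: "a \<in> carrier A" "x \<in> ?L" for a x
      proof -
        \<comment> \<open>Column k is twisted by \<open>Psi k\<close>, so the scalar that acts there
          as a is \<open>Psi' k a\<close>; this uses that \<psi> is onto.\<close>
        have "single m k False (a \<odot>\<^bsub>P (m - k)\<^esub> x) = comb (Psi' k a) \<zero> \<odot>\<^bsub>Q m\<^esub> single m k False x"
          by (rule Q_eqI[where m = m]) (use ax in auto)
        then show ?thesis using ND(5) ax by simp
      qed
    qed auto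
    moreover have "H (m - k) (m - k) \<subseteq> ?L"
    proof
      fix x assume x: "x \<in> H (m - k) (m - k)"
      then have xc: "x \<in> carrier (P (m - k))"
        using graded_group.component_closed[OF P_graded_group] by blast
      have "single m k False x \<in> HQ m m"
        unfolding HQ_iff using x xc k by (auto simp: shifted_component_def[of _ _ k])
      then show "x \<in> ?L" using xc sub by auto
    qed
    ultimately have "submodule_span A (P (m - k)) (H (m - k) (m - k)) \<subseteq> ?L"
      unfolding submodule_span_def by blast
    then show ?thesis using p unfolding P_span by blast
  qed
  have q_in: "single m k True p \<in> N" if k: "k \<le> m" and p: "p \<in> carrier (P (m - k))" for k p
  proof -
    \<comment> \<open>\<open>comb \<zero> \<one>\<close> is x itself.\<close>
    have "single m k True p = comb \<zero> \<one> \<odot>\<^bsub>Q m\<^esub> single m k False p"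
      by (rule Q_eqI[where m = m]) (use k p in auto)
    then show ?thesis using ND(5) p_in[OF k p] by simp
  qed
  show ?thesis
  proof
    fix z assume z: "z \<in> carrier (Q m)"
    \<comment> \<open>The columns are added one at a time, which reduces membership of z to closure
      of N under binary sums.\<close>
    define trunc where "trunc k = enc (restrict (\<lambda>(j, b). if j < k then dec z (j, b) else \<zero>\<^bsub>P (m - j)\<^esub>) (Ind m))" for k
    have tc: "trunc k \<in> carrier (Q m)" for k
      unfolding trunc_def by (rule Q_enc_in) (use z in auto)
    have td: "dec (trunc k) (j, b) = (if j < k then dec z (j, b) else \<zero>\<^bsub>P (m - j)\<^esub>)" if "j \<le> m" for j b k
      using that by (simp add: trunc_def)
    have "trunc k \<in> N" if "k \<le> Suc m" for k
      using that
    proof (induction k)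
      case 0
      have "trunc 0 = \<zero>\<^bsub>Q m\<^esub>"
        by (rule Q_eqI[where m = m]) (use tc td in auto)
      then show ?case using ND(2) by simp
    next
      case (Suc k)
      then have k: "k \<le> m" by simp
      let ?w = "single m k False (dec z (k, False)) \<oplus>\<^bsub>Q m\<^esub> single m k True (dec z (k, True))"
      have "trunc (Suc k) = trunc k \<oplus>\<^bsub>Q m\<^esub> ?w"
        by (rule Q_eqI[where m = m]) (use tc td z k in \<open>auto simp: less_Suc_eq\<close>)
      moreover have "?w \<in> N"
        using k z by (intro ND(3) p_in q_in) auto
      ultimately show ?case using Suc ND(3) by simp
    qed
    moreover have "trunc (Suc m) = z"
      by (rule Q_eqI[where m = m]) (use tc td z in auto)
    ultimately show "z \<in> N" by force
  qed
qed

lemma Q_span: "submodule_span T (Q m) (HQ m m) = carrier (Q m)"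
proof (intro equalityI)
  have "submodule (carrier (Q m)) T (Q m)"
    by (rule submoduleI'[OF Q_group]) (auto simp: left_module.smult_closed[OF Q_module])
  moreover have "HQ m m \<subseteq> carrier (Q m)" by (auto simp: HQ_iff)
  ultimately show "submodule_span T (Q m) (HQ m m) \<subseteq> carrier (Q m)"
    unfolding submodule_span_def by blast
  show "carrier (Q m) \<subseteq> submodule_span T (Q m) (HQ m m)"
    unfolding submodule_span_def using Q_submodule_eq by blast
qed

section \<open>Projectivity of the terms\<close>

lemma free_module_carrier: "f \<in> carrier (free_module R B) \<longleftrightarrow>
    f \<in> B \<rightarrow>\<^sub>E carrier R \<and> finite {x \<in> B. f x \<noteq> \<zero>\<^bsub>R\<^esub>}"
  by (simp add: free_module_def)

lemma free_module_closed:
  assumes R: "ring R" and f: "f \<in> carrier (free_module R B)"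
  shows free_module_smult_closed: "a \<in> carrier R \<Longrightarrow> a \<odot>\<^bsub>free_module R B\<^esub> f \<in> carrier (free_module R B)"
    and free_module_add_closed: "g \<in> carrier (free_module R B) \<Longrightarrow>
      f \<oplus>\<^bsub>free_module R B\<^esub> g \<in> carrier (free_module R B)"
proof -
  interpret R: ring R by fact
  show "a \<odot>\<^bsub>free_module R B\<^esub> f \<in> carrier (free_module R B)" if a: "a \<in> carrier R"
  proof -
    have "finite {x \<in> B. f x \<noteq> \<zero>\<^bsub>R\<^esub>}" using f by (simp add: free_module_carrier)
    then have "finite {x \<in> B. a \<otimes>\<^bsub>R\<^esub> f x \<noteq> \<zero>\<^bsub>R\<^esub>}"
      by (rule rev_finite_subset) (use a in auto)
    moreover have "{x \<in> B. (\<lambda>x\<in>B. a \<otimes>\<^bsub>R\<^esub> f x) x \<noteq> \<zero>\<^bsub>R\<^esub>} = {x \<in> B. a \<otimes>\<^bsub>R\<^esub> f x \<noteq> \<zero>\<^bsub>R\<^esub>}" by auto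
    ultimately show ?thesis using a f by (auto simp: free_module_def)
  qed
  show "f \<oplus>\<^bsub>free_module R B\<^esub> g \<in> carrier (free_module R B)" if g: "g \<in> carrier (free_module R B)"
  proof -
    have "finite ({x \<in> B. f x \<noteq> \<zero>\<^bsub>R\<^esub>} \<union> {x \<in> B. g x \<noteq> \<zero>\<^bsub>R\<^esub>})"
      using f g by (simp add: free_module_carrier)
    then have "finite {x \<in> B. f x \<oplus>\<^bsub>R\<^esub> g x \<noteq> \<zero>\<^bsub>R\<^esub>}"
      by (rule rev_finite_subset) auto
    moreover have "{x \<in> B. (\<lambda>x\<in>B. f x \<oplus>\<^bsub>R\<^esub> g x) x \<noteq> \<zero>\<^bsub>R\<^esub>} = {x \<in> B. f x \<oplus>\<^bsub>R\<^esub> g x \<noteq> \<zero>\<^bsub>R\<^esub>}" by auto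
    ultimately show ?thesis using f g by (auto simp: free_module_def)
  qed
qed

text \<open>Let \<open>P i\<close> be a retract of the free \<open>A\<close>-module on
  \<open>B i\<close>. Multiplying a basis vector of column j by t gives entries with coefficients
  \<open>Psi j (\<alpha> t)\<close> and \<open>Psi j (\<beta> t)\<close>; hence the column is a
  retract of the free \<open>T\<close>-module on the same basis, and its coordinates over
  \<open>T\<close> are found by undoing the twist with \<open>Psi' j\<close>.\<close>

lemma Q_projective: "projective_module T (Q m)"
proof -
  define good where "good i B s p \<longleftrightarrow> s \<in> left_module_hom A (P i) (free_module A B) \<and>
      p \<in> left_module_hom A (free_module A B) (P i) \<and> (\<forall>x\<in>carrier (P i). p (s x) = x)"
    for i and B :: "'m set" and s p
  have "\<exists>B s p. good i B s p" for i
    using P_projective[of i] unfolding projective_module_def good_def by blast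
  then obtain B s p where good: "\<And>i. good i (B i) (s i) (p i)"
    by metis
  have s: "s i \<in> left_module_hom A (P i) (free_module A (B i))"
    and p: "p i \<in> left_module_hom A (free_module A (B i)) (P i)" for i
    using good[of i] by (simp_all add: good_def)
  have ps: "p i (s i x) = x" if "x \<in> carrier (P i)" for i x
    using good[of i] that by (simp add: good_def)
  have sc: "s i x \<in> carrier (free_module A (B i))" if "x \<in> carrier (P i)" for i x
    using s[of i] that by (auto simp: left_module_hom_def)
  have scb [simp]: "s i x b \<in> carrier A" if "x \<in> carrier (P i)" "b \<in> B i" for i x b
    using sc[OF that(1)] that(2) by (auto simp: free_module_carrier)
  have s_add: "s i (x \<oplus>\<^bsub>P i\<^esub> y) b = s i x b \<oplus> s i y b"
    if "x \<in> carrier (P i)" "y \<in> carrier (P i)" "b \<in> B i" for i x y b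
    using s[of i] that by (auto simp: left_module_hom_def free_module_def)
  have s_smult: "s i (a \<odot>\<^bsub>P i\<^esub> x) b = a \<otimes> s i x b"
    if "a \<in> carrier A" "x \<in> carrier (P i)" "b \<in> B i" for i x a b
    using s[of i] that by (auto simp: left_module_hom_def free_module_def)
  have pc [simp]: "p i f \<in> carrier (P i)" if "f \<in> carrier (free_module A (B i))" for i f
    using p[of i] that by (auto simp: left_module_hom_def)
  have p_add: "p i (\<lambda>b\<in>B i. f b \<oplus> g b) = p i f \<oplus>\<^bsub>P i\<^esub> p i g"
    if "f \<in> carrier (free_module A (B i))" "g \<in> carrier (free_module A (B i))" for i f g
    using p[of i] that unfolding left_module_hom_def by (simp add: free_module_def)
  have p_smult: "p i (\<lambda>b\<in>B i. a \<otimes> f b) = a \<odot>\<^bsub>P i\<^esub> p i f"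
    if "a \<in> carrier A" "f \<in> carrier (free_module A (B i))" for i f a
    using p[of i] that unfolding left_module_hom_def by (simp add: free_module_def)

  \<comment> \<open>A basis has to lie in the type of module elements, and the bases of different
    columns must stay disjoint; \<open>ix\<close> codes pairs of a column and a basis
    element.\<close>
  define B' where "B' = ix ` {(j, b). j \<le> m \<and> b \<in> B (m - j)}"
  define S where "S z = (\<lambda>y\<in>B'. case inv_into UNIV ix y of (j, b) \<Rightarrow>
    comb (Psi' j (s (m - j) (dec z (j, False)) b)) (Psi' j (s (m - j) (dec z (j, True)) b)))" for z
  define R where "R f = enc (restrict (\<lambda>(j, c). p (m - j)
    (\<lambda>b\<in>B (m - j). Psi j ((if c then \<beta> else \<alpha>) (f (ix (j, b)))))) (Ind m))" for f
  have B'E: "\<exists>j b. y = ix (j, b) \<and> j \<le> m \<and> b \<in> B (m - j)" if "y \<in> B'" for y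
    using that by (auto simp: B'_def)
  have B'I [simp]: "ix (j, b) \<in> B'" if "j \<le> m" "b \<in> B (m - j)" for j b
    using that by (auto simp: B'_def)
  have S_ix [simp]: "S z (ix (j, b)) =
      comb (Psi' j (s (m - j) (dec z (j, False)) b)) (Psi' j (s (m - j) (dec z (j, True)) b))"
    if "j \<le> m" "b \<in> B (m - j)" for z j b
    using that by (simp add: S_def inv_into_f_f[OF inj_ix])
  have S_eqI: "S z = f" if "f \<in> extensional B'"
    and "\<And>j b. j \<le> m \<Longrightarrow> b \<in> B (m - j) \<Longrightarrow> S z (ix (j, b)) = f (ix (j, b))" for z f
  proof (rule extensionalityI[of _ B'])
    show "S z \<in> extensional B'" by (simp add: S_def)
    show "S z y = f y" if "y \<in> B'" for y
      using B'E[OF that] \<open>\<And>j b. j \<le> m \<Longrightarrow> b \<in> B (m - j) \<Longrightarrow> S z (ix (j, b)) = f (ix (j, b))\<close> by blast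
  qed (rule that(1))

  have S_closed: "S z \<in> carrier (free_module T B')" if z: "z \<in> carrier (Q m)" for z
    unfolding free_module_carrier
  proof
    show "S z \<in> B' \<rightarrow>\<^sub>E carrier T"
    proof
      show "S z y \<in> carrier T" if "y \<in> B'" for y
        using B'E[OF that] z by auto
      show "S z y = undefined" if "y \<notin> B'" for y
        using that by (simp add: S_def)
    qed
    let ?supp = "\<lambda>j c. {b \<in> B (m - j). s (m - j) (dec z (j, c)) b \<noteq> \<zero>}"
    have "{y \<in> B'. S z y \<noteq> \<zero>\<^bsub>T\<^esub>} \<subseteq> ix ` (SIGMA j:{..m}. ?supp j False \<union> ?supp j True)"
    proof clarify
      fix y assume y: "y \<in> B'" "S z y \<noteq> \<zero>\<^bsub>T\<^esub>"
      obtain j b where jb: "y = ix (j, b)" "j \<le> m" "b \<in> B (m - j)" using B'E[OF y(1)] by blast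
      have "b \<in> ?supp j False \<union> ?supp j True"
      proof (rule ccontr)
        assume "b \<notin> ?supp j False \<union> ?supp j True"
        then have "S z y = \<zero>\<^bsub>T\<^esub>" using jb by simp
        then show False using y(2) by simp
      qed
      then show "y \<in> ix ` (SIGMA j:{..m}. ?supp j False \<union> ?supp j True)"
        using jb by blast
    qed
    moreover have "finite (?supp j c)" if "j \<in> {..m}" for j c
      using sc[of "dec z (j, c)" "m - j"] z that by (auto simp: free_module_carrier)
    then have "finite (ix ` (SIGMA j:{..m}. ?supp j False \<union> ?supp j True))"
      by (intro finite_imageI finite_SigmaI finite_UnI) auto
    ultimately show "finite {y \<in> B'. S z y \<noteq> \<zero>\<^bsub>T\<^esub>}" by (rule finite_subset)
  qed
  have \<alpha>_zero: "\<alpha> \<zero>\<^bsub>T\<^esub> = \<zero>" and \<beta>_zero: "\<beta> \<zero>\<^bsub>T\<^esub> = \<zero>"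
    unfolding comb_zero[symmetric] by (simp_all del: comb_zero)
  have coord: "(\<lambda>b\<in>B (m - j). Psi j ((if c then \<beta> else \<alpha>) (f (ix (j, b))))) \<in> carrier (free_module A (B (m - j)))"
    if f: "f \<in> carrier (free_module T B')" and j: "j \<le> m" for f j c
    unfolding free_module_carrier
  proof
    have fin: "finite {y \<in> B'. f y \<noteq> \<zero>\<^bsub>T\<^esub>}" and fc: "f y \<in> carrier T" if "y \<in> B'" for y
      using f that by (auto simp: free_module_carrier)
    show "(\<lambda>b\<in>B (m - j). Psi j ((if c then \<beta> else \<alpha>) (f (ix (j, b))))) \<in> B (m - j) \<rightarrow>\<^sub>E carrier A"
      using fc j by auto
    have "inj (\<lambda>b. ix (j, b))" using inj_ix by (auto simp: inj_def)
    then have "finite ((\<lambda>b. ix (j, b)) -` {y \<in> B'. f y \<noteq> \<zero>\<^bsub>T\<^esub>})"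
      using f by (intro finite_vimageI) (auto simp: free_module_carrier)
    then show "finite {b \<in> B (m - j). (\<lambda>b\<in>B (m - j). Psi j ((if c then \<beta> else \<alpha>) (f (ix (j, b))))) b \<noteq> \<zero>}"
      by (rule rev_finite_subset) (use j in \<open>auto simp: \<alpha>_zero \<beta>_zero\<close>)
  qed
  have R_dec: "dec (R f) (j, c) = p (m - j) (\<lambda>b\<in>B (m - j). Psi j ((if c then \<beta> else \<alpha>) (f (ix (j, b)))))"
    if "j \<le> m" for f j c
    using that by (simp add: R_def)
  have R_closed: "R f \<in> carrier (Q m)" if "f \<in> carrier (free_module T B')" for f
    unfolding R_def by (rule Q_enc_in) (simp_all only: prod.case, (erule pc[OF coord[OF that]])+)
  have S_hom: "S \<in> left_module_hom T (Q m) (free_module T B')"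
    unfolding left_module_hom_def
  proof (intro CollectI conjI ballI funcsetI S_closed)
    show "S (z \<oplus>\<^bsub>Q m\<^esub> w) = S z \<oplus>\<^bsub>free_module T B'\<^esub> S w" if "z \<in> carrier (Q m)" "w \<in> carrier (Q m)" for z w
      by (rule S_eqI) (use that in \<open>auto simp: free_module_def s_add Psi'_add comb_add\<close>)
    show "S (t \<odot>\<^bsub>Q m\<^esub> z) = t \<odot>\<^bsub>free_module T B'\<^esub> S z" if "t \<in> carrier T" "z \<in> carrier (Q m)" for t z
      by (rule S_eqI) (use that in
        \<open>auto simp: free_module_def s_add s_smult Psi_Suc Psi'_add Psi'_mult comb_mult\<close>)
  qed
  have R_hom: "R \<in> left_module_hom T (free_module T B') (Q m)"
    unfolding left_module_hom_def
  proof (intro CollectI conjI ballI funcsetI R_closed)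
    fix t f assume t: "t \<in> carrier T" and f: "f \<in> carrier (free_module T B')"
    have fc [simp]: "f (ix (j, b)) \<in> carrier T" if "j \<le> m" "b \<in> B (m - j)" for j b
      using f that by (auto simp: free_module_carrier)
    let ?tf = "t \<odot>\<^bsub>free_module T B'\<^esub> f"
    have tf: "?tf \<in> carrier (free_module T B')"
      using t f by (simp add: free_module_smult_closed T.ring_axioms)
    have tf_ix: "?tf (ix (j, b)) = t \<otimes>\<^bsub>T\<^esub> f (ix (j, b))" if "j \<le> m" "b \<in> B (m - j)" for j b
      using that by (simp add: free_module_def)
    show "R ?tf = t \<odot>\<^bsub>Q m\<^esub> R f"
    proof (rule Q_eqI[where m = m])
      fix j assume j: "j \<le> m"
      define ca where "ca = (\<lambda>b\<in>B (m - j). Psi j (\<alpha> (f (ix (j, b)))))"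
      define cb where "cb = (\<lambda>b\<in>B (m - j). Psi j (\<beta> (f (ix (j, b)))))"
      have c: "ca \<in> carrier (free_module A (B (m - j)))" "cb \<in> carrier (free_module A (B (m - j)))"
        using coord[OF f j, of False] coord[OF f j, of True] by (simp_all add: ca_def cb_def)
      have R: "dec (R f) (j, False) = p (m - j) ca" "dec (R f) (j, True) = p (m - j) cb"
        using j by (simp_all add: R_dec ca_def cb_def)
      have "(\<lambda>b\<in>B (m - j). Psi j (\<alpha> (?tf (ix (j, b))))) =
          (\<lambda>b\<in>B (m - j). Psi j (\<alpha> t) \<otimes> ca b)"
        using j t by (auto simp: tf_ix \<alpha>_mult Psi_mult ca_def)
      then show "dec (R ?tf) (j, False) = dec (t \<odot>\<^bsub>Q m\<^esub> R f) (j, False)"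
        using j t c by (simp add: R_dec[of _ ?tf] R p_smult)
      let ?u = "\<lambda>b\<in>B (m - j). Psi (Suc j) (\<alpha> t) \<otimes> cb b"
        and ?v = "\<lambda>b\<in>B (m - j). Psi j (\<beta> t) \<otimes> ca b"
      have uv: "?u \<in> carrier (free_module A (B (m - j)))" "?v \<in> carrier (free_module A (B (m - j)))"
        using free_module_smult_closed[OF A.ring_axioms c(2), of "Psi (Suc j) (\<alpha> t)"]
          free_module_smult_closed[OF A.ring_axioms c(1), of "Psi j (\<beta> t)"] t
        by (simp_all add: free_module_def)
      \<comment> \<open>The two summands of \<open>\<beta>_mult\<close> become the two summands of
        the action on the x-entry.\<close>
      have "(\<lambda>b\<in>B (m - j). Psi j (\<beta> (?tf (ix (j, b))))) = (\<lambda>b\<in>B (m - j). ?u b \<oplus> ?v b)"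
        using j t by (auto simp: tf_ix \<beta>_mult Psi_mult Psi_add Psi_Suc ca_def cb_def)
      then have "dec (R ?tf) (j, True) = p (m - j) ?u \<oplus>\<^bsub>P (m - j)\<^esub> p (m - j) ?v"
        using p_add[OF uv] j by (simp only: R_dec if_True)
      also have "p (m - j) ?u = Psi (Suc j) (\<alpha> t) \<odot>\<^bsub>P (m - j)\<^esub> p (m - j) cb"
        by (rule p_smult) (use t c in simp_all)
      also have "p (m - j) ?v = Psi j (\<beta> t) \<odot>\<^bsub>P (m - j)\<^esub> p (m - j) ca"
        by (rule p_smult) (use t c in simp_all)
      finally show "dec (R ?tf) (j, True) = dec (t \<odot>\<^bsub>Q m\<^esub> R f) (j, True)"
        using j by (simp add: R)
    qed (use t tf f in \<open>simp_all add: R_closed\<close>)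
  next
    fix f g assume f: "f \<in> carrier (free_module T B')" and g: "g \<in> carrier (free_module T B')"
    have c [simp]: "f (ix (j, b)) \<in> carrier T" "g (ix (j, b)) \<in> carrier T" if "j \<le> m" "b \<in> B (m - j)" for j b
      using f g that by (auto simp: free_module_carrier)
    let ?fg = "f \<oplus>\<^bsub>free_module T B'\<^esub> g"
    have fg: "?fg \<in> carrier (free_module T B')"
      using f g by (simp add: free_module_add_closed T.ring_axioms)
    have fg_ix: "?fg (ix (j, b)) = f (ix (j, b)) \<oplus>\<^bsub>T\<^esub> g (ix (j, b))" if "j \<le> m" "b \<in> B (m - j)" for j b
      using that by (simp add: free_module_def)
    have *: "dec (R ?fg) (j, k) = dec (R f \<oplus>\<^bsub>Q m\<^esub> R g) (j, k)" if j: "j \<le> m" for j k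
    proof -
      define c where "c f = (\<lambda>b\<in>B (m - j). Psi j ((if k then \<beta> else \<alpha>) (f (ix (j, b)))))" for f
      have "c ?fg = (\<lambda>b\<in>B (m - j). c f b \<oplus> c g b)"
        using j by (auto simp: fg_ix \<alpha>_add \<beta>_add Psi_add c_def)
      moreover have "c f \<in> carrier (free_module A (B (m - j)))" "c g \<in> carrier (free_module A (B (m - j)))"
        unfolding c_def using coord f g j by blast+
      moreover have "dec (R h) (j, k) = p (m - j) (c h)" for h
        using j by (simp add: R_dec c_def)
      ultimately show ?thesis
        using j p_add by simp
    qed
    show "R ?fg = R f \<oplus>\<^bsub>Q m\<^esub> R g"
      by (rule Q_eqI[where m = m]) (use * fg f g in \<open>simp_all only: R_closed Q_a_closed\<close>)
  qed
  have "R (S z) = z" if z: "z \<in> carrier (Q m)" for z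
  proof -
    have "dec (R (S z)) (j, k) = dec z (j, k)" if j: "j \<le> m" for j k
    proof -
      have "s (m - j) (dec z (j, k)) \<in> extensional (B (m - j))"
        using sc[of "dec z (j, k)" "m - j"] z j by (auto simp: free_module_carrier PiE_def)
      then have "(\<lambda>b\<in>B (m - j). Psi j ((if k then \<beta> else \<alpha>) (S z (ix (j, b))))) = s (m - j) (dec z (j, k))"
        by (intro extensionalityI[of _ "B (m - j)"]) (use z j in auto)
      then show ?thesis
        using j z by (simp add: R_dec ps)
    qed
    then show ?thesis
      by (intro Q_eqI[where m = m]) (use z in \<open>simp_all only: R_closed S_closed\<close>)
  qed
  then show ?thesis
    unfolding projective_module_def using Q_module S_hom R_hom by blast
qed

end

text \<open>The codings come from an injection of \<open>'a\<close> into \<open>'b\<close> and from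
  countability of \<open>(nat \<times> bool) \<times> nat\<close>: a family of sequences over
  \<open>'a\<close> indexed by \<open>nat \<times> bool\<close> is a single sequence over
  \<open>'b\<close>.\<close>

lemma (in skew_extension) linear_resolution:
  fixes i :: "'a \<Rightarrow> 'b"
  assumes "inj i" and nontrivial: "\<one>\<^bsub>T\<^esub> \<noteq> \<zero>\<^bsub>T\<^esub>" and "has_linear_resolution A G"
  shows "has_linear_resolution T TG"
proof -
  obtain P :: "nat \<Rightarrow> ('a, nat \<Rightarrow> 'a) module" and H d \<epsilon> where
    P: "\<forall>i. graded_left_module A G (P i) (H i) \<and> projective_module A (P i) \<and>
           submodule_span A (P i) (H i i) = carrier (P i)"
    and d: "\<forall>i. d i \<in> graded_hom A (P (Suc i)) (H (Suc i)) (P i) (H i)"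
    and \<epsilon>: "\<epsilon> \<in> graded_hom A (P 0) (H 0) (degree_zero_module A G) (degree_zero_grading A G)"
      "\<epsilon> ` carrier (P 0) = G 0"
    and ex: "d 0 ` carrier (P 1) = {x \<in> carrier (P 0). \<epsilon> x = \<zero>}"
      "\<forall>i. d (Suc i) ` carrier (P (Suc (Suc i))) = {x \<in> carrier (P (Suc i)). d i x = \<zero>\<^bsub>P i\<^esub>}"
    using assms(3) unfolding has_linear_resolution_def by (elim exE conjE) (rule that)
  define enc :: "(nat \<times> bool \<Rightarrow> nat \<Rightarrow> 'a) \<Rightarrow> nat \<Rightarrow> 'b"
    where "enc f k = (case from_nat k of (x, l) \<Rightarrow> i (f x l))" for f k
  define dec :: "(nat \<Rightarrow> 'b) \<Rightarrow> nat \<times> bool \<Rightarrow> nat \<Rightarrow> 'a"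
    where "dec z x l = inv_into UNIV i (z (to_nat (x, l)))" for z x l
  \<comment> \<open>Even positions hold the sequence; odd positions hold the number, as the place of
    a single \<one>. Recovering the number needs \<one> and \<zero> of \<open>T\<close> to
    differ.\<close>
  define ix :: "nat \<times> (nat \<Rightarrow> 'a) \<Rightarrow> nat \<Rightarrow> 'b"
    where "ix y k = (if even k then i (snd y (k div 2)) else if k div 2 = fst y then \<one>\<^bsub>T\<^esub> else \<zero>\<^bsub>T\<^esub>)" for y k
  have "inj ix"
  proof (rule injI)
    fix y y' assume eq: "ix y = ix y'"
    have "snd y l = snd y' l" for l
      using fun_cong[OF eq, of "2 * l"] \<open>inj i\<close> by (simp add: ix_def inj_eq)
    moreover have "fst y = fst y'"
      using fun_cong[OF eq, of "Suc (2 * fst y)"] nontrivial by (simp add: ix_def split: if_splits)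
    ultimately show "y = y'" by (simp add: prod_eq_iff fun_eq_iff)
  qed
  moreover have "dec (enc f) = f" for f
    using \<open>inj i\<close> by (simp add: enc_def dec_def fun_eq_iff)
  ultimately interpret skew_resolution A T G TG \<alpha> \<beta> comb \<psi> P H d \<epsilon> enc dec ix
    using P d \<epsilon> ex
    by (intro skew_resolution.intro skew_resolution_axioms.intro skew_extension_axioms) simp_all
  show ?thesis
    unfolding has_linear_resolution_def
    by (intro exI[of _ Q] exI[of _ HQ] exI[of _ D] exI[of _ aug] conjI allI
        Q_graded Q_projective Q_span D_hom aug_hom aug_surj Q_exact Q_exact_0)
qed

section \<open>Linear functionals\<close>

lemma linear_functionalsD:
  assumes "f \<in> linear_functionals K V"
  shows "x \<in> carrier V \<Longrightarrow> f x \<in> carrier K"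
    and "x \<in> carrier V \<Longrightarrow> y \<in> carrier V \<Longrightarrow> f (x \<oplus>\<^bsub>V\<^esub> y) = f x \<oplus>\<^bsub>K\<^esub> f y"
    and "c \<in> carrier K \<Longrightarrow> x \<in> carrier V \<Longrightarrow> f (c \<odot>\<^bsub>V\<^esub> x) = c \<otimes>\<^bsub>K\<^esub> f x"
    and "f \<in> extensional (carrier V)"
  using assms by (auto simp: linear_functionals_def PiE_def)

text \<open>Takes the place of a comparison of dimensions between V and its dual: a subspace of the
  dual whose only common zero is 0 will be shown to be the whole dual when V is
  finite-dimensional.\<close>

locale separating_functionals = K?: field K + V?: module K V
  for K :: "('k, 'c) ring_scheme" (structure) and V :: "('k, 'v) module" +
  fixes W :: "('v \<Rightarrow> 'k) set"
  assumes W_linear: "W \<subseteq> linear_functionals K V"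
    and W_nonempty: "W \<noteq> {}"
    and W_closed: "\<lbrakk>w \<in> W; w' \<in> W; c \<in> carrier K\<rbrakk> \<Longrightarrow> (\<lambda>x\<in>carrier V. w x \<oplus> c \<otimes> w' x) \<in> W"
    and separates: "\<lbrakk>v \<in> carrier V; v \<noteq> \<zero>\<^bsub>V\<^esub>\<rbrakk> \<Longrightarrow> \<exists>w\<in>W. w v \<noteq> \<zero>"
begin

lemma V_group: "abelian_group V"
  using V.module_axioms by (rule module.axioms)

lemma functional_zero: "f \<in> linear_functionals K V \<Longrightarrow> f \<zero>\<^bsub>V\<^esub> = \<zero>"
  by (rule additive_zero[OF V_group K.abelian_group_axioms])
    (auto simp: linear_functionalsD)

lemma W_D [simp]: "w \<in> W \<Longrightarrow> x \<in> carrier V \<Longrightarrow> w x \<in> carrier K"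
  by (rule linear_functionalsD(1)[OF subsetD[OF W_linear]])

text \<open>The hypothesis on v means that W cannot tell v from an element of the span of B. The
  induction subtracts multiples of members of B from v, until separation of points shows that
  nothing is left.\<close>

lemma annihilator_determines:
  assumes "finite B" and "B \<subseteq> carrier V" and "v \<in> carrier V"
    and "\<And>w. w \<in> W \<Longrightarrow> (\<forall>b\<in>B. w b = \<zero>) \<Longrightarrow> w v = \<zero>"
    and "f \<in> linear_functionals K V" and "\<forall>b\<in>B. f b = \<zero>"
  shows "f v = \<zero>"
  using assms(1-4,6)
proof (induction B arbitrary: v)
  case empty
  then have "v = \<zero>\<^bsub>V\<^esub>" using separates by blast
  then show ?case using functional_zero assms(5) by simp
next
  case (insert b B)
  then have b: "b \<in> carrier V" and B: "B \<subseteq> carrier V" by auto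
  show ?case
  proof (cases "\<forall>w\<in>W. (\<forall>b\<in>B. w b = \<zero>) \<longrightarrow> w b = \<zero>")
    case True
    show ?thesis
      using insert.IH[OF B insert.prems(2)] insert.prems(3,4) True by blast
  next
    case False
    then obtain w0 where w0: "w0 \<in> W" "\<forall>b\<in>B. w0 b = \<zero>" "w0 b \<noteq> \<zero>" by blast
    \<comment> \<open>Chosen so that \<open>w0\<close> vanishes at \<open>?v\<close>.\<close>
    define c where "c = \<ominus> (w0 v \<otimes> inv w0 b)"
    have inv: "inv w0 b \<in> carrier K" "inv w0 b \<otimes> w0 b = \<one>"
      using w0 b by (simp_all add: K.field_Units K.Units_l_inv)
    have c: "c \<in> carrier K" using w0 insert.prems(2) inv by (simp add: c_def)
    let ?v = "v \<oplus>\<^bsub>V\<^esub> c \<odot>\<^bsub>V\<^esub> b"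
    have v': "?v \<in> carrier V" using c b insert.prems(2) by simp
    have fv: "f v = f ?v \<oplus> \<ominus> (c \<otimes> f b)" if "f \<in> linear_functionals K V" for f
      using that b c insert.prems(2) by (simp add: linear_functionalsD K.a_assoc K.r_neg)
    have "w ?v = \<zero>" if w: "w \<in> W" "\<forall>b\<in>B. w b = \<zero>" for w
    proof -
      \<comment> \<open>Corrects w by the multiple of \<open>w0\<close> that makes it vanish at b,
        so that the hypothesis on v applies to \<open>?w\<close>; its value at v equals
        \<open>w ?v\<close>.\<close>
      let ?k = "\<ominus> (w b \<otimes> inv w0 b)"
      have k: "?k \<in> carrier K" using w b inv by simp
      let ?w = "\<lambda>x\<in>carrier V. w x \<oplus> ?k \<otimes> w0 x"
      have "?w \<in> W" using W_closed[OF w(1) w0(1) k] .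
      moreover have "?w x = \<zero>" if "x \<in> B" for x
        using that B w w0 k by auto
      moreover have "?w b = \<zero>"
        using b w w0 inv by (simp add: K.l_minus K.m_assoc K.r_neg)
      ultimately have "?w v = \<zero>" using insert.prems(3)[of ?w] by blast
      then have "w v \<oplus> ?k \<otimes> w0 v = \<zero>" using insert.prems(2) by simp
      moreover have "?k \<otimes> w0 v = c \<otimes> w b"
        using w w0 b inv insert.prems(2) by (simp add: c_def K.l_minus K.r_minus K.m_ac)
      moreover have "w ?v = w v \<oplus> c \<otimes> w b"
        using w(1) W_linear b c insert.prems(2) by (auto simp: linear_functionalsD)
      ultimately show ?thesis by simp
    qed
    then have "f ?v = \<zero>" using insert.IH[OF B v'] insert.prems(4) by blast
    then show ?thesis using fv[OF assms(5)] c insert.prems(4) by simp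
  qed
qed

text \<open>When b is added to B, either some member of W vanishes on B but not at b and can correct
  the value there, or the value at b is already determined by those on B, for f as well as for W, by
  \<open>annihilator_determines\<close>.\<close>

lemma interpolation:
  assumes "finite B" and "B \<subseteq> carrier V" and f: "f \<in> linear_functionals K V"
  shows "\<exists>w\<in>W. \<forall>b\<in>B. w b = f b"
  using assms(1,2)
proof (induction B)
  case empty
  then show ?case using W_nonempty by blast
next
  case (insert b B)
  then obtain w where w: "w \<in> W" "\<forall>b\<in>B. w b = f b" and b: "b \<in> carrier V" and B: "B \<subseteq> carrier V" by auto
  show ?case
  proof (cases "\<forall>w\<in>W. (\<forall>b\<in>B. w b = \<zero>) \<longrightarrow> w b = \<zero>")
    case True
    let ?g = "\<lambda>x\<in>carrier V. f x \<ominus> w x"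
    note fD = linear_functionalsD[OF f] and wD = linear_functionalsD[OF subsetD[OF W_linear w(1)]]
    have "?g \<in> linear_functionals K V"
      unfolding linear_functionals_def
    proof (intro CollectI conjI ballI)
      show "?g \<in> carrier V \<rightarrow>\<^sub>E carrier K" using fD(1) wD(1) by auto
      show "?g (x \<oplus>\<^bsub>V\<^esub> y) = ?g x \<oplus> ?g y" if "x \<in> carrier V" "y \<in> carrier V" for x y
        using that fD(1,2) wD(1,2) by (simp add: K.minus_add K.minus_eq K.a_ac)
      show "?g (c \<odot>\<^bsub>V\<^esub> x) = c \<otimes> ?g x" if "c \<in> carrier K" "x \<in> carrier V" for c x
        using that fD(1,3) wD(1,3) by (simp add: K.minus_eq K.r_distr K.r_minus)
    qed
    moreover have "?g x = \<zero>" if x: "x \<in> B" for x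
    proof -
      have "x \<in> carrier V" "w x = f x" using x w B by auto
      then show ?thesis using fD(1)[of x] by (simp add: K.minus_eq K.r_neg)
    qed
    ultimately have "?g b = \<zero>"
      using annihilator_determines[OF insert.hyps(1) B b, of ?g] True by blast
    then have "f b \<ominus> w b = \<zero>" using b by simp
    then have "w b = f b" using fD(1)[OF b] wD(1)[OF b] by simp
    then show ?thesis using w by auto
  next
    case False
    then obtain w0 where w0: "w0 \<in> W" "\<forall>b\<in>B. w0 b = \<zero>" "w0 b \<noteq> \<zero>" by blast
    have inv: "inv w0 b \<in> carrier K" "inv w0 b \<otimes> w0 b = \<one>"
      using w0 b by (simp_all add: K.field_Units K.Units_l_inv)
    have fb: "f b \<in> carrier K" using linear_functionalsD(1)[OF f b] .
    let ?c = "(f b \<ominus> w b) \<otimes> inv w0 b"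
    have c: "?c \<in> carrier K" using fb inv w b by simp
    let ?w = "\<lambda>x\<in>carrier V. w x \<oplus> ?c \<otimes> w0 x"
    have "?w \<in> W" using W_closed[OF w(1) w0(1) c] .
    moreover have "?w x = f x" if "x \<in> B" for x
    proof -
      have "x \<in> carrier V" "w x = f x" "w0 x = \<zero>" using that w w0 B by auto
      then show ?thesis using c linear_functionalsD(1)[OF f, of x] by simp
    qed
    moreover have "?w b = f b"
    proof -
      have "?c \<otimes> w0 b = f b \<ominus> w b" using fb inv w w0 b by (simp add: K.m_assoc)
      then have "?w b = w b \<oplus> (f b \<ominus> w b)" using b by simp
      also have "\<dots> = f b \<oplus> (w b \<oplus> \<ominus> w b)"
        using fb W_D[OF w(1) b] by (simp only: K.minus_eq K.a_lcomm K.a_inv_closed)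
      also have "\<dots> = f b" using fb W_D[OF w(1) b] by (simp add: K.r_neg)
      finally show ?thesis .
    qed
    ultimately show ?thesis by blast
  qed
qed

theorem all_functionals:
  assumes "finite_dimensional K V" and f: "f \<in> linear_functionals K V"
  shows "f \<in> W"
proof -
  obtain B where B: "finite B" "B \<subseteq> carrier V"
    and span: "carrier V = {(\<Oplus>\<^bsub>V\<^esub>b\<in>B. c b \<odot>\<^bsub>V\<^esub> b) | c. c \<in> B \<rightarrow> carrier K}"
    using assms(1) unfolding finite_dimensional_def by blast
  obtain w where w: "w \<in> W" "\<forall>b\<in>B. w b = f b" using interpolation[OF B f] by blast
  have wl: "w \<in> linear_functionals K V" using w W_linear by blast
  have "w = f"
  proof (rule extensionalityI[OF linear_functionalsD(4)[OF wl] linear_functionalsD(4)[OF f]])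
    fix x assume "x \<in> carrier V"
    then obtain c where c: "c \<in> B \<rightarrow> carrier K" "x = (\<Oplus>\<^bsub>V\<^esub>b\<in>B. c b \<odot>\<^bsub>V\<^esub> b)" using span by blast
    have "g x = (\<Oplus>b\<in>B. c b \<otimes> g b)" if g: "g \<in> linear_functionals K V" for g
    proof -
      have "g x = (\<Oplus>b\<in>B. g (c b \<odot>\<^bsub>V\<^esub> b))"
        unfolding c(2)
        by (rule additive_finsum[OF V_group K.abelian_group_axioms])
          (use g c(1) B in \<open>auto simp: linear_functionalsD\<close>)
      also have "\<dots> = (\<Oplus>b\<in>B. c b \<otimes> g b)"
        by (rule K.finsum_cong') (use g c(1) B in \<open>auto simp: linear_functionalsD Pi_iff subset_iff\<close>)
      finally show ?thesis .
    qed
    moreover have "(\<Oplus>b\<in>B. c b \<otimes> w b) = (\<Oplus>b\<in>B. c b \<otimes> f b)"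
      by (rule K.finsum_cong') (use w f c(1) B in \<open>auto simp: linear_functionalsD Pi_iff subset_iff\<close>)
    ultimately show "w x = f x" using wl f by simp
  qed
  then show ?thesis using w by simp
qed

end

section \<open>The Frobenius form of a stable self-injective algebra\<close>

text \<open>The parameters are reordered to make the operations of \<open>A\<close> the unindexed ones.\<close>

locale graded_algebra_over = graded_algebra K A G n e
  for A :: "('a, 'b, 'd) module_scheme" (structure) and K :: "('a, 'c) ring_scheme" and G n e
begin

sublocale AG: graded_group A G
  by (intro graded_group.intro graded_group_axioms.intro A.abelian_group_axioms decomposition)

lemma A_group: "abelian_group A"
  by (rule A.abelian_group_axioms)

lemma e_closed [simp]: "i \<in> {1..n} \<Longrightarrow> e i \<in> carrier A"
  and e_idem: "i \<in> {1..n} \<Longrightarrow> e i \<otimes> e i = e i"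
  using primitive[of i] by (auto simp: primitive_idempotent_def idempotent_elem_def)

lemma e_mult: "i \<in> {1..n} \<Longrightarrow> j \<in> {1..n} \<Longrightarrow> e i \<otimes> e j = (if i = j then e i else \<zero>)"
  using e_idem orthogonal by auto

lemma e_degree: assumes "i \<in> {1..n}" shows "e i \<in> G 0"
proof -
  let ?c = "\<lambda>j. if j = i then \<one>\<^bsub>K\<^esub> else \<zero>\<^bsub>K\<^esub>"
  have "(\<Oplus>j\<in>{1..n}. ?c j \<odot> e j) = ?c i \<odot> e i"
    by (rule A.finsum_eq_single)
      (use assms in auto)
  also have "\<dots> = e i" using assms by simp
  finally show ?thesis unfolding degree_zero by (intro CollectI exI[of _ ?c]) auto
qed

lemma one_degree: "\<one> \<in> G 0"
  unfolding one_eq by (rule AG.component_finsum) (use e_degree in auto)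

lemma sum_e_left:
  assumes "x \<in> carrier A" shows "(\<Oplus>i\<in>{1..n}. e i \<otimes> x) = x"
proof -
  have "(\<Oplus>i\<in>{1..n}. e i \<otimes> x) = \<one> \<otimes> x"
    unfolding one_eq by (rule A.finsum_ldistr[symmetric]) (use assms in auto)
  then show ?thesis using assms by simp
qed

lemma sum_e_right:
  assumes "x \<in> carrier A" shows "(\<Oplus>i\<in>{1..n}. x \<otimes> e i) = x"
proof -
  have "(\<Oplus>i\<in>{1..n}. x \<otimes> e i) = x \<otimes> \<one>"
    unfolding one_eq by (rule A.finsum_rdistr[symmetric]) (use assms in auto)
  then show ?thesis using assms by simp
qed

lemma ex_e_left:
  assumes "x \<in> carrier A" "x \<noteq> \<zero>" shows "\<exists>i\<in>{1..n}. e i \<otimes> x \<noteq> \<zero>"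
proof (rule ccontr)
  assume "\<not> ?thesis"
  then have "(\<Oplus>i\<in>{1..n}. e i \<otimes> x) = (\<Oplus>i\<in>{1..n}. \<zero>)"
    by (intro A.finsum_cong') auto
  then show False using sum_e_left[OF assms(1)] assms(2) by simp
qed

lemma ex_e_right:
  assumes "x \<in> carrier A" "x \<noteq> \<zero>" shows "\<exists>i\<in>{1..n}. x \<otimes> e i \<noteq> \<zero>"
proof (rule ccontr)
  assume "\<not> ?thesis"
  then have "(\<Oplus>i\<in>{1..n}. x \<otimes> e i) = (\<Oplus>i\<in>{1..n}. \<zero>)"
    by (intro A.finsum_cong') auto
  then show False using sum_e_right[OF assms(1)] assms(2) by simp
qed

lemma component_mult0_left: "x \<in> G 0 \<Longrightarrow> y \<in> G t \<Longrightarrow> x \<otimes> y \<in> G t"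
  and component_mult0_right: "x \<in> G t \<Longrightarrow> y \<in> G 0 \<Longrightarrow> x \<otimes> y \<in> G t"
  using component_mult[of x 0 y t] component_mult[of x t y 0] by simp_all

lemma pr_mult0_left:
  assumes a: "a \<in> G 0" and x: "x \<in> carrier A"
  shows "AG.pr t (a \<otimes> x) = a \<otimes> AG.pr t x"
  using x
proof (induction x rule: AG.additive_pr_induct)
  case (homogeneous s x)
  then show ?case
    using a component_mult0_left[OF a homogeneous] AG.component_closed[OF a]
    by (simp add: AG.pr_homogeneous)
next
  case (add x y)
  then show ?case using AG.component_closed[OF a] by (simp add: A.r_distr AG.pr_add)
qed

lemma pr_mult0_right:
  assumes a: "a \<in> G 0" and x: "x \<in> carrier A"
  shows "AG.pr t (x \<otimes> a) = AG.pr t x \<otimes> a"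
  using x
proof (induction x rule: AG.additive_pr_induct)
  case (homogeneous s x)
  then show ?case
    using a component_mult0_right[OF homogeneous a] AG.component_closed[OF a]
    by (simp add: AG.pr_homogeneous)
next
  case (add x y)
  then show ?case using AG.component_closed[OF a] by (simp add: A.l_distr AG.pr_add)
qed

lemma pr_smult:
  assumes c: "c \<in> carrier K" and x: "x \<in> carrier A"
  shows "AG.pr t (c \<odot> x) = c \<odot> AG.pr t x"
  using x
proof (induction x rule: AG.additive_pr_induct)
  case (homogeneous s x)
  then show ?case
    using c component_smult[OF c homogeneous] by (simp add: AG.pr_homogeneous)
next
  case (add x y)
  then show ?case using c by (simp add: smult_r_distr AG.pr_add)
qed

lemma smult_cancel:
  assumes "c \<in> carrier K" "c' \<in> carrier K" "x \<in> carrier A" "x \<noteq> \<zero>" "c \<odot> x = c' \<odot> x"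
  shows "c = c'"
proof (rule ccontr)
  assume "c \<noteq> c'"
  then have "c \<ominus>\<^bsub>K\<^esub> c' \<noteq> \<zero>\<^bsub>K\<^esub>" using assms by simp
  then have u: "c \<ominus>\<^bsub>K\<^esub> c' \<in> Units K" using assms by (simp add: K.field_Units)
  have "(c \<ominus>\<^bsub>K\<^esub> c') \<odot> x = \<zero>"
    using assms by (simp add: K.minus_eq smult_l_distr smult_l_minus A.r_neg)
  then have "inv\<^bsub>K\<^esub> (c \<ominus>\<^bsub>K\<^esub> c') \<odot> ((c \<ominus>\<^bsub>K\<^esub> c') \<odot> x) = \<zero>" using u by simp
  moreover have "inv\<^bsub>K\<^esub> (c \<ominus>\<^bsub>K\<^esub> c') \<odot> ((c \<ominus>\<^bsub>K\<^esub> c') \<odot> x) = x"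
    using smult_assoc1[OF K.Units_inv_closed[OF u] K.Units_closed[OF u] assms(3)] K.Units_l_inv[OF u] assms(3)
    by simp
  ultimately have "x = \<zero>" by simp
  then show False using assms by simp
qed

lemma mult_eq_pr0_left:
  assumes a: "a \<in> carrier A" and y: "y \<in> carrier A" "\<And>t b. 1 \<le> t \<Longrightarrow> b \<in> G t \<Longrightarrow> b \<otimes> y = \<zero>"
  shows "a \<otimes> y = AG.pr 0 a \<otimes> y"
  using a
proof (induction a rule: AG.additive_pr_induct)
  case (homogeneous s x)
  then show ?case using y(1) y(2)[OF _ homogeneous] by (cases s) (simp_all add: AG.pr_homogeneous)
next
  case (add x x')
  then show ?case using y(1) by (simp add: A.l_distr AG.pr_add)
qed

lemma mult_eq_pr0_right:
  assumes a: "a \<in> carrier A" and y: "y \<in> carrier A" "\<And>t b. 1 \<le> t \<Longrightarrow> b \<in> G t \<Longrightarrow> y \<otimes> b = \<zero>"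
  shows "y \<otimes> a = y \<otimes> AG.pr 0 a"
  using a
proof (induction a rule: AG.additive_pr_induct)
  case (homogeneous s x)
  then show ?case using y(1) y(2)[OF _ homogeneous] by (cases s) (simp_all add: AG.pr_homogeneous)
next
  case (add x x')
  then show ?case using y(1) by (simp add: A.r_distr AG.pr_add)
qed

lemma degree_zero_mult_e:
  assumes i: "i \<in> {1..n}" and a: "a \<in> G 0"
  shows "\<exists>c\<in>carrier K. a \<otimes> e i = c \<odot> e i \<and> e i \<otimes> a = c \<odot> e i"
proof -
  obtain c where c: "c \<in> {1..n} \<rightarrow> carrier K" "a = (\<Oplus>j\<in>{1..n}. c j \<odot> e j)"
    using a unfolding degree_zero by blast
  have cj: "c j \<in> carrier K" if "j \<in> {1..n}" for j using c(1) that by blast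
  have "a \<otimes> e i = (\<Oplus>j\<in>{1..n}. c j \<odot> e j \<otimes> e i)"
    unfolding c(2) by (rule A.finsum_ldistr) (use i cj in auto)
  also have "\<dots> = c i \<odot> e i \<otimes> e i"
    by (rule A.finsum_eq_single)
      (use i cj in \<open>auto simp: smult_mult_left e_mult\<close>)
  finally have 1: "a \<otimes> e i = c i \<odot> e i" using i cj by (simp add: smult_mult_left e_mult)
  have "e i \<otimes> a = (\<Oplus>j\<in>{1..n}. e i \<otimes> (c j \<odot> e j))"
    unfolding c(2) by (rule A.finsum_rdistr) (use i cj in auto)
  also have "\<dots> = e i \<otimes> (c i \<odot> e i)"
    by (rule A.finsum_eq_single)
      (use i cj in \<open>auto simp: smult_mult_right e_mult\<close>)
  finally have 2: "e i \<otimes> a = c i \<odot> e i" using i cj by (simp add: smult_mult_right e_mult)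
  show ?thesis using 1 2 cj[OF i] by blast
qed

text \<open>The scalar by which \<open>a\<close> acts on the simple module at the vertex \<open>i\<close>.\<close>

definition ev where
  "ev i a = (SOME c. c \<in> carrier K \<and> AG.pr 0 a \<otimes> e i = c \<odot> e i \<and> e i \<otimes> AG.pr 0 a = c \<odot> e i)"

lemma ev:
  assumes "i \<in> {1..n}" and "a \<in> carrier A"
  shows "ev i a \<in> carrier K" and "AG.pr 0 a \<otimes> e i = ev i a \<odot> e i"
    and "e i \<otimes> AG.pr 0 a = ev i a \<odot> e i"
proof -
  have "\<exists>c. c \<in> carrier K \<and> AG.pr 0 a \<otimes> e i = c \<odot> e i \<and> e i \<otimes> AG.pr 0 a = c \<odot> e i"
    using degree_zero_mult_e[OF assms(1) AG.pr_in[OF assms(2)]] by blast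
  from someI_ex[OF this]
  show "ev i a \<in> carrier K" and "AG.pr 0 a \<otimes> e i = ev i a \<odot> e i"
    and "e i \<otimes> AG.pr 0 a = ev i a \<odot> e i"
    unfolding ev_def by blast+
qed

text \<open>Positive degrees kill y, so a acts through its degree-zero part, which acts on
  \<open>e i \<otimes> y\<close> by a scalar. A nonzero y of this kind spans a copy of the simple
  left module at the vertex i.\<close>

lemma left_eigen:
  assumes i: "i \<in> {1..n}" and a: "a \<in> carrier A" and y: "y \<in> carrier A" "e i \<otimes> y = y"
    and kill: "\<And>t b. 1 \<le> t \<Longrightarrow> b \<in> G t \<Longrightarrow> b \<otimes> y = \<zero>"
  shows "a \<otimes> y = ev i a \<odot> y"
proof -
  have "a \<otimes> y = AG.pr 0 a \<otimes> (e i \<otimes> y)"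
    unfolding y(2) by (rule mult_eq_pr0_left[OF a y(1) kill])
  also have "\<dots> = (AG.pr 0 a \<otimes> e i) \<otimes> y"
    using a y(1) i by (simp add: A.m_assoc)
  also have "\<dots> = ev i a \<odot> (e i \<otimes> y)"
    unfolding ev(2)[OF i a] using i a y(1) ev(1) by (simp add: smult_mult_left)
  finally show ?thesis unfolding y(2) .
qed

lemma right_eigen:
  assumes i: "i \<in> {1..n}" and a: "a \<in> carrier A" and y: "y \<in> carrier A" "y \<otimes> e i = y"
    and kill: "\<And>t b. 1 \<le> t \<Longrightarrow> b \<in> G t \<Longrightarrow> y \<otimes> b = \<zero>"
  shows "y \<otimes> a = ev i a \<odot> y"
proof -
  have "y \<otimes> a = (y \<otimes> e i) \<otimes> AG.pr 0 a"
    unfolding y(2) by (rule mult_eq_pr0_right[OF a y(1) kill])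
  also have "\<dots> = y \<otimes> (e i \<otimes> AG.pr 0 a)"
    using a y(1) i by (simp add: A.m_assoc)
  also have "\<dots> = ev i a \<odot> (y \<otimes> e i)"
    unfolding ev(3)[OF i a] using i a y(1) ev(1) by (simp add: smult_mult_right)
  finally show ?thesis unfolding y(2) .
qed

end

lemma opposite_simps [simp]:
  "carrier (opposite R) = carrier R" "x \<otimes>\<^bsub>opposite R\<^esub> y = y \<otimes>\<^bsub>R\<^esub> x"
  by (simp_all add: opposite_def)

lemma right_projective_simps [simp]:
  "carrier (right_projective R f) = {f \<otimes>\<^bsub>R\<^esub> x | x. x \<in> carrier R}"
  "x \<oplus>\<^bsub>right_projective R f\<^esub> y = x \<oplus>\<^bsub>R\<^esub> y"
  "\<zero>\<^bsub>right_projective R f\<^esub> = \<zero>\<^bsub>R\<^esub>"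
  "a \<odot>\<^bsub>right_projective R f\<^esub> x = x \<otimes>\<^bsub>R\<^esub> a"
  by (simp_all add: right_projective_def regular_module_def opposite_def)

lemma (in ring) abelian_group_right_projective:
  assumes "f \<in> carrier R" shows "abelian_group (right_projective R f)"
proof (rule abelian_groupI)
  let ?M = "right_projective R f"
  have c: "x \<in> carrier R" if "x \<in> carrier ?M" for x using that assms by auto
  show "x \<oplus>\<^bsub>?M\<^esub> y \<in> carrier ?M" if xy: "x \<in> carrier ?M" "y \<in> carrier ?M" for x y
  proof -
    obtain a b where "x = f \<otimes> a" "y = f \<otimes> b" "a \<in> carrier R" "b \<in> carrier R" using xy by auto
    then show ?thesis using assms by (auto intro!: exI[of _ "a \<oplus> b"] simp: r_distr)
  qed
  show "\<zero>\<^bsub>?M\<^esub> \<in> carrier ?M" using assms by (auto intro!: exI[of _ \<zero>])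
  show "\<exists>y\<in>carrier ?M. y \<oplus>\<^bsub>?M\<^esub> x = \<zero>\<^bsub>?M\<^esub>" if x: "x \<in> carrier ?M" for x
  proof -
    obtain a where a: "x = f \<otimes> a" "a \<in> carrier R" using x by auto
    then have "f \<otimes> (\<ominus> a) \<oplus>\<^bsub>?M\<^esub> x = \<zero>\<^bsub>?M\<^esub>" using assms by (simp add: r_minus l_neg)
    moreover have "f \<otimes> (\<ominus> a) \<in> carrier ?M" unfolding right_projective_simps using a(2) by blast
    ultimately show ?thesis by blast
  qed
  show "x \<oplus>\<^bsub>?M\<^esub> y \<oplus>\<^bsub>?M\<^esub> z = x \<oplus>\<^bsub>?M\<^esub> (y \<oplus>\<^bsub>?M\<^esub> z)"
    if "x \<in> carrier ?M" "y \<in> carrier ?M" "z \<in> carrier ?M" for x y z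
    using c[OF that(1)] c[OF that(2)] c[OF that(3)] by (simp add: a_assoc)
  show "x \<oplus>\<^bsub>?M\<^esub> y = y \<oplus>\<^bsub>?M\<^esub> x" if "x \<in> carrier ?M" "y \<in> carrier ?M" for x y
    using c[OF that(1)] c[OF that(2)] by (simp add: a_comm)
  show "\<zero>\<^bsub>?M\<^esub> \<oplus>\<^bsub>?M\<^esub> x = x" if "x \<in> carrier ?M" for x
    using c[OF that] by simp
qed

text \<open>By \<open>right_eigen\<close> the line through y is stable under right multiplication,
  and a one-dimensional submodule is simple. The zero element spans no simple module and is treated
  apart.\<close>

lemma (in graded_algebra_over) socle_memI:
  assumes i: "i \<in> {1..n}" and j: "j \<in> {1..n}" and y: "y \<in> carrier A" "e i \<otimes> y = y" "y \<otimes> e j = y"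
    and kill: "\<And>t b. 1 \<le> t \<Longrightarrow> b \<in> G t \<Longrightarrow> y \<otimes> b = \<zero>"
  shows "y \<in> socle (opposite A) (right_projective A (e i))"
proof (cases "y = \<zero>")
  case True
  have "\<zero> \<in> N" if "submodule N (opposite A) (right_projective A (e i))" for N
    using submoduleD(2)[OF A.abelian_group_right_projective[OF e_closed[OF i]] that] by simp
  then show ?thesis by (simp add: True socle_def submodule_span_def)
next
  case False
  let ?M = "right_projective A (e i)" and ?S = "{c \<odot> y | c. c \<in> carrier K}"
  have M: "abelian_group ?M" by (rule A.abelian_group_right_projective[OF e_closed[OF i]])
  interpret M: abelian_group ?M by (rule M)
  have SM: "?S \<subseteq> carrier ?M"
  proof clarify
    fix c assume c: "c \<in> carrier K"
    then have "c \<odot> y = e i \<otimes> (c \<odot> y)" using i y by (simp add: smult_mult_right)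
    then show "c \<odot> y \<in> carrier ?M" using c y(1) by auto
  qed
  have act: "(c \<odot> y) \<otimes> a = (c \<otimes>\<^bsub>K\<^esub> ev j a) \<odot> y" if "c \<in> carrier K" "a \<in> carrier A" for c a
    using that j y(1) ev(1)[OF j that(2)] right_eigen[OF j that(2) y(1,3) kill]
    by (simp add: smult_mult_left smult_assoc1)
  have subS: "submodule ?S (opposite A) ?M"
  proof (rule submoduleI'[OF M SM])
    show "\<zero>\<^bsub>?M\<^esub> \<in> ?S" using y(1) by (auto intro!: exI[of _ "\<zero>\<^bsub>K\<^esub>"])
    show "v \<oplus>\<^bsub>?M\<^esub> w \<in> ?S" if vw: "v \<in> ?S" "w \<in> ?S" for v w
    proof -
      obtain c d where "v = c \<odot> y" "w = d \<odot> y" "c \<in> carrier K" "d \<in> carrier K" using vw by auto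
      then show ?thesis using y(1) by (auto intro!: exI[of _ "c \<oplus>\<^bsub>K\<^esub> d"] simp: smult_l_distr)
    qed
    show "\<ominus>\<^bsub>?M\<^esub> v \<in> ?S" if v: "v \<in> ?S" for v
    proof -
      obtain c where c: "v = c \<odot> y" "c \<in> carrier K" using v by auto
      then have sum0: "(\<ominus>\<^bsub>K\<^esub> c) \<odot> y \<oplus>\<^bsub>?M\<^esub> v = \<zero>\<^bsub>?M\<^esub>"
        using y(1) by (simp add: smult_l_minus A.l_neg)
      have mem: "(\<ominus>\<^bsub>K\<^esub> c) \<odot> y \<in> ?S" using K.a_inv_closed[OF c(2)] by blast
      have "\<ominus>\<^bsub>?M\<^esub> v = (\<ominus>\<^bsub>K\<^esub> c) \<odot> y"
        by (rule M.minus_equality[OF sum0 subsetD[OF SM v] subsetD[OF SM mem]])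
      then show ?thesis using mem by simp
    qed
    show "a \<odot>\<^bsub>?M\<^esub> v \<in> ?S" if a: "a \<in> carrier (opposite A)" and v: "v \<in> ?S" for a v
    proof -
      obtain c where c: "v = c \<odot> y" "c \<in> carrier K" using v by auto
      then show ?thesis using a act[of c a] ev(1)[OF j, of a] by auto
    qed
  qed
  have "simple_submodule (opposite A) ?M ?S"
    unfolding simple_submodule_def
  proof (intro conjI allI impI subS)
    have yS: "y \<in> ?S" using y(1) by (auto intro!: exI[of _ "\<one>\<^bsub>K\<^esub>"])
    then show "?S \<noteq> {\<zero>\<^bsub>?M\<^esub>}" using False by auto
    fix N assume "submodule N (opposite A) ?M \<and> N \<subseteq> ?S"
    then have N: "submodule N (opposite A) ?M" and NS: "N \<subseteq> ?S" by auto
    show "N = {\<zero>\<^bsub>?M\<^esub>} \<or> N = ?S"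
    proof (cases "N \<subseteq> {\<zero>\<^bsub>?M\<^esub>}")
      case True
      then show ?thesis using submoduleD(2)[OF M N] by blast
    next
      case nz: False
      then obtain v where v: "v \<in> N" "v \<noteq> \<zero>" by auto
      then obtain c where c: "v = c \<odot> y" "c \<in> carrier K" using NS by auto
      have "c \<noteq> \<zero>\<^bsub>K\<^esub>" using v(2) y(1) unfolding c(1) by auto
      then have u: "c \<in> Units K" using c(2) by (simp add: K.field_Units)
      have "d \<odot> y \<in> N" if d: "d \<in> carrier K" for d
      proof -
        \<comment> \<open>The scalar d/c, as a multiple of the unit, takes v to
          \<open>d \<odot> y\<close>.\<close>
        let ?a = "(d \<otimes>\<^bsub>K\<^esub> inv\<^bsub>K\<^esub> c) \<odot> \<one>"
        have "?a \<odot>\<^bsub>?M\<^esub> v \<in> N"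
          by (rule submoduleD(5)[OF M N _ v(1)]) (use d u in simp)
        moreover have "?a \<odot>\<^bsub>?M\<^esub> v = (d \<otimes>\<^bsub>K\<^esub> inv\<^bsub>K\<^esub> c) \<odot> (c \<odot> y)"
          using d u c(2) y(1) by (simp add: c(1) smult_mult_right)
        moreover have "\<dots> = d \<odot> y"
          using d u c(2) y(1) by (simp add: smult_assoc1[symmetric] K.m_assoc)
        ultimately show ?thesis by simp
      qed
      then show ?thesis using NS by auto
    qed
  qed
  moreover have "y \<in> ?S" using y(1) by (auto intro!: exI[of _ "\<one>\<^bsub>K\<^esub>"])
  ultimately show ?thesis unfolding socle_def submodule_span_def by blast
qed

section \<open>Socle generators, the functional \<phi> and nondegeneracy in the first
  argument\<close>

locale stable_self_injective = graded_algebra_over A K G n e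
  for K :: "('k, 'c) ring_scheme" and A :: "('k, 'a) module" (structure) and G n e +
  fixes l :: nat and \<tau> :: "nat \<Rightarrow> nat"
  assumes fin_dim: "finite_dimensional K A"
    and self_inj: "self_injective A"
    and stable: "stable_bound_quiver_algebra K A G n e l \<tau>"
begin

lemma above_l: "l < t \<Longrightarrow> G t = {\<zero>}"
  and \<tau>_bij: "bij_betw \<tau> {1..n} {1..n}"
  using stable by (auto simp: stable_bound_quiver_algebra_def)

lemma \<tau>_in: "i \<in> {1..n} \<Longrightarrow> \<tau> i \<in> {1..n}"
  using \<tau>_bij by (rule bij_betwE[THEN bspec])

lemma \<tau>_eq: "i \<in> {1..n} \<Longrightarrow> j \<in> {1..n} \<Longrightarrow> \<tau> i = \<tau> j \<longleftrightarrow> i = j"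
  using inj_on_eq_iff[OF bij_betw_imp_inj_on[OF \<tau>_bij]] .

definition u :: "nat \<Rightarrow> 'a" where
  "u i = (SOME u. u \<in> carrier A \<and> u \<noteq> \<zero> \<and>
     {e i \<otimes> x \<otimes> e (\<tau> i) | x. x \<in> G l} = {c \<odot> u | c. c \<in> carrier K})"

lemma u:
  assumes "i \<in> {1..n}"
  shows u_closed [simp]: "u i \<in> carrier A" and u_nonzero: "u i \<noteq> \<zero>"
    and u_span: "{e i \<otimes> x \<otimes> e (\<tau> i) | x. x \<in> G l} = {c \<odot> u i | c. c \<in> carrier K}"
proof -
  have "\<exists>u. u \<in> carrier A \<and> u \<noteq> \<zero> \<and>
     {e i \<otimes> x \<otimes> e (\<tau> i) | x. x \<in> G l} = {c \<odot> u | c. c \<in> carrier K}"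
    using stable assms unfolding stable_bound_quiver_algebra_def one_dimensional_def by blast
  from someI_ex[OF this] show "u i \<in> carrier A" "u i \<noteq> \<zero>"
    "{e i \<otimes> x \<otimes> e (\<tau> i) | x. x \<in> G l} = {c \<odot> u i | c. c \<in> carrier K}"
    unfolding u_def by blast+
qed

lemma u_props:
  assumes i: "i \<in> {1..n}"
  shows u_degree: "u i \<in> G l" and e_u: "e i \<otimes> u i = u i" and u_e: "u i \<otimes> e (\<tau> i) = u i"
proof -
  have "u i = \<one>\<^bsub>K\<^esub> \<odot> u i" using u_closed[OF i] by simp
  then have "u i \<in> {c \<odot> u i | c. c \<in> carrier K}" by blast
  then obtain x where x: "x \<in> G l" "u i = e i \<otimes> x \<otimes> e (\<tau> i)"
    unfolding u_span[OF i, symmetric] by blast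
  have xc: "x \<in> carrier A" using AG.component_closed[OF x(1)] .
  note c = e_closed[OF i] e_closed[OF \<tau>_in[OF i]]
  show "u i \<in> G l" unfolding x(2)
    by (intro component_mult0_left component_mult0_right e_degree i \<tau>_in x(1))
  show "e i \<otimes> u i = u i"
    using c xc by (simp add: x(2) A.m_assoc[symmetric] e_idem[OF i])
  show "u i \<otimes> e (\<tau> i) = u i"
    using c xc by (simp add: x(2) A.m_assoc e_idem[OF \<tau>_in[OF i]])
qed

lemma e_u': assumes i: "i \<in> {1..n}" and j: "j \<in> {1..n}"
  shows "e j \<otimes> u i = (if i = j then u i else \<zero>)"
proof -
  have "e j \<otimes> u i = e j \<otimes> e i \<otimes> u i"
    using A.m_assoc[of "e j" "e i" "u i"] i j by (simp only: e_u u_closed e_closed)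
  then show ?thesis using e_mult[OF j i] e_u[OF i] u_closed[OF i] by (cases "j = i") auto
qed

definition \<kappa> :: "nat \<Rightarrow> 'a \<Rightarrow> 'k" where
  "\<kappa> i y = (SOME c. c \<in> carrier K \<and> y = c \<odot> u i)"

lemma \<kappa>_smult_u [simp]:
  assumes "i \<in> {1..n}" "c \<in> carrier K" shows "\<kappa> i (c \<odot> u i) = c"
  unfolding \<kappa>_def
proof (rule some_equality)
  show "c \<in> carrier K \<and> c \<odot> u i = c \<odot> u i" using assms by simp
  show "c' = c" if "c' \<in> carrier K \<and> c \<odot> u i = c' \<odot> u i" for c'
    by (rule smult_cancel[OF conjunct1[OF that] assms(2) u_closed[OF assms(1)] u_nonzero[OF assms(1)]
          conjunct2[OF that, symmetric]])
qed

definition corner :: "nat \<Rightarrow> 'a \<Rightarrow> 'a" where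
  "corner i x = e i \<otimes> AG.pr l x \<otimes> e (\<tau> i)"

lemma corner_span:
  assumes "i \<in> {1..n}" "x \<in> carrier A" shows "\<exists>c\<in>carrier K. corner i x = c \<odot> u i"
proof -
  have "corner i x \<in> {e i \<otimes> x \<otimes> e (\<tau> i) | x. x \<in> G l}"
    unfolding corner_def using AG.pr_in[OF assms(2)] by blast
  then show ?thesis unfolding u_span[OF assms(1)] by blast
qed

lemma corner_\<kappa>:
  assumes "i \<in> {1..n}" "x \<in> carrier A"
  shows "\<kappa> i (corner i x) \<in> carrier K" and "corner i x = \<kappa> i (corner i x) \<odot> u i"
  using corner_span[OF assms] assms by auto

lemma corner_add: "i \<in> {1..n} \<Longrightarrow> x \<in> carrier A \<Longrightarrow> y \<in> carrier A \<Longrightarrow>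
    corner i (x \<oplus> y) = corner i x \<oplus> corner i y"
  using e_closed[OF \<tau>_in, of i] by (simp add: corner_def AG.pr_add A.r_distr A.l_distr)

lemma corner_smult: "i \<in> {1..n} \<Longrightarrow> c \<in> carrier K \<Longrightarrow> x \<in> carrier A \<Longrightarrow>
    corner i (c \<odot> x) = c \<odot> corner i x"
  using e_closed[OF \<tau>_in, of i] by (simp add: corner_def pr_smult smult_mult_left smult_mult_right)

lemma \<kappa>_corner_add:
  assumes "i \<in> {1..n}" "x \<in> carrier A" "y \<in> carrier A"
  shows "\<kappa> i (corner i (x \<oplus> y)) = \<kappa> i (corner i x) \<oplus>\<^bsub>K\<^esub> \<kappa> i (corner i y)"
proof -
  have "corner i (x \<oplus> y) = (\<kappa> i (corner i x) \<oplus>\<^bsub>K\<^esub> \<kappa> i (corner i y)) \<odot> u i"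
    using corner_\<kappa>[OF assms(1,2)] corner_\<kappa>[OF assms(1,3)] assms
    by (simp add: corner_add smult_l_distr)
  then show ?thesis using corner_\<kappa>(1)[OF assms(1,2)] corner_\<kappa>(1)[OF assms(1,3)] assms(1) by simp
qed

lemma \<kappa>_corner_smult:
  assumes "i \<in> {1..n}" "c \<in> carrier K" "x \<in> carrier A"
  shows "\<kappa> i (corner i (c \<odot> x)) = c \<otimes>\<^bsub>K\<^esub> \<kappa> i (corner i x)"
proof -
  have "corner i (c \<odot> x) = (c \<otimes>\<^bsub>K\<^esub> \<kappa> i (corner i x)) \<odot> u i"
    using corner_\<kappa>[OF assms(1,3)] assms by (simp add: corner_smult smult_assoc1)
  then show ?thesis using corner_\<kappa>(1)[OF assms(1,3)] assms by simp
qed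

text \<open>Adds up the socle coordinates of the degree l part, so that every \<open>u i\<close>
  gets the value 1. As an element of the twisted dual it will be the generator x of the
  extension.\<close>

definition \<phi> :: "'a \<Rightarrow> 'k" where
  "\<phi> = (\<lambda>x\<in>carrier A. \<Oplus>\<^bsub>K\<^esub>i\<in>{1..n}. \<kappa> i (corner i x))"

lemma \<phi>_functional: "\<phi> \<in> linear_functionals K A"
  unfolding linear_functionals_def
proof (intro CollectI conjI ballI)
  have k: "(\<lambda>i. \<kappa> i (corner i x)) \<in> {1..n} \<rightarrow> carrier K" if "x \<in> carrier A" for x
    using corner_\<kappa>(1) that by blast
  show "\<phi> \<in> carrier A \<rightarrow>\<^sub>E carrier K"
    unfolding \<phi>_def using k by (auto intro!: K.finsum_closed)
  show "\<phi> (x \<oplus> y) = \<phi> x \<oplus>\<^bsub>K\<^esub> \<phi> y" if "x \<in> carrier A" "y \<in> carrier A" for x y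
  proof -
    have "(\<Oplus>\<^bsub>K\<^esub>i\<in>{1..n}. \<kappa> i (corner i (x \<oplus> y))) =
        (\<Oplus>\<^bsub>K\<^esub>i\<in>{1..n}. \<kappa> i (corner i x) \<oplus>\<^bsub>K\<^esub> \<kappa> i (corner i y))"
      by (rule K.finsum_cong') (use that corner_\<kappa>(1) in \<open>auto simp: \<kappa>_corner_add\<close>)
    then show ?thesis using that k by (simp add: \<phi>_def K.finsum_addf)
  qed
  show "\<phi> (c \<odot> x) = c \<otimes>\<^bsub>K\<^esub> \<phi> x" if "c \<in> carrier K" "x \<in> carrier A" for c x
  proof -
    have "(\<Oplus>\<^bsub>K\<^esub>i\<in>{1..n}. \<kappa> i (corner i (c \<odot> x))) = (\<Oplus>\<^bsub>K\<^esub>i\<in>{1..n}. c \<otimes>\<^bsub>K\<^esub> \<kappa> i (corner i x))"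
      by (rule K.finsum_cong') (use that corner_\<kappa>(1) in \<open>auto simp: \<kappa>_corner_smult\<close>)
    then show ?thesis using that k by (simp add: \<phi>_def K.finsum_rdistr)
  qed
qed

lemmas \<phi>_closed [simp] = linear_functionalsD(1)[OF \<phi>_functional]
  and \<phi>_add = linear_functionalsD(2)[OF \<phi>_functional]
  and \<phi>_smult = linear_functionalsD(3)[OF \<phi>_functional]

lemma \<kappa>_zero [simp]: "i \<in> {1..n} \<Longrightarrow> \<kappa> i \<zero> = \<zero>\<^bsub>K\<^esub>"
  using \<kappa>_smult_u[of i "\<zero>\<^bsub>K\<^esub>"] by simp

lemma \<phi>_zero [simp]: "\<phi> \<zero> = \<zero>\<^bsub>K\<^esub>"
  by (rule additive_zero[OF A_group K.abelian_group_axioms]) (auto simp: \<phi>_add)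

lemma \<phi>_degree:
  assumes "x \<in> G t" "t \<noteq> l" shows "\<phi> x = \<zero>\<^bsub>K\<^esub>"
proof -
  have "corner i x = \<zero>" if "i \<in> {1..n}" for i
    using assms that e_closed[OF \<tau>_in[OF that]] by (simp add: corner_def AG.pr_homogeneous)
  then have "(\<Oplus>\<^bsub>K\<^esub>i\<in>{1..n}. \<kappa> i (corner i x)) = (\<Oplus>\<^bsub>K\<^esub>i\<in>{1..n}. \<zero>\<^bsub>K\<^esub>)"
    by (intro K.finsum_cong') auto
  then show ?thesis using AG.component_closed[OF assms(1)] by (simp add: \<phi>_def)
qed

lemma \<phi>_eq_corner:
  assumes i: "i \<in> {1..n}" and x: "x \<in> carrier A"
    and "\<And>k. k \<in> {1..n} \<Longrightarrow> k \<noteq> i \<Longrightarrow> corner k x = \<zero>"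
  shows "\<phi> x = \<kappa> i (corner i x)"
proof -
  have "(\<Oplus>\<^bsub>K\<^esub>k\<in>{1..n}. \<kappa> k (corner k x)) = \<kappa> i (corner i x)"
    by (rule K.finsum_eq_single)
      (use assms corner_\<kappa>(1) in auto)
  then show ?thesis using x by (simp add: \<phi>_def)
qed

lemma \<phi>_u:
  assumes i: "i \<in> {1..n}" and c: "c \<in> carrier K"
  shows "\<phi> (c \<odot> u i) = c"
proof -
  have *: "corner k (c \<odot> u i) = (if k = i then c \<odot> u i else \<zero>)" if k: "k \<in> {1..n}" for k
    using i c k e_closed[OF \<tau>_in[OF k]] e_closed[OF k] AG.pr_homogeneous[OF component_smult[OF c u_degree[OF i]]]
    by (simp add: corner_def smult_mult_right smult_mult_left e_u' u_e)
  then show ?thesis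
    using i c by (subst \<phi>_eq_corner[OF i]) simp_all
qed

text \<open>Both sides see only the corner from i to \<open>\<tau> i\<close>. This is the Nakayama
  permutation at work: an idempotent may be moved around the form at the price of \<tau>.\<close>

lemma \<phi>_e:
  assumes i: "i \<in> {1..n}" and x: "x \<in> carrier A"
  shows "\<phi> (e i \<otimes> x) = \<phi> (x \<otimes> e (\<tau> i))"
proof -
  have ei: "e i \<in> carrier A" "e (\<tau> i) \<in> carrier A" using i \<tau>_in by simp_all
  have 1: "corner k (e i \<otimes> x) = (if k = i then corner i x else \<zero>)" if k: "k \<in> {1..n}" for k
    using x ei e_closed[OF k] e_closed[OF \<tau>_in[OF k]] e_mult[OF k i]
    by (simp add: corner_def pr_mult0_left[OF e_degree[OF i] x] A.m_assoc[symmetric])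
  have 2: "corner k (x \<otimes> e (\<tau> i)) = (if k = i then corner i x else \<zero>)" if k: "k \<in> {1..n}" for k
    using x ei e_closed[OF k] e_closed[OF \<tau>_in[OF k]] e_mult[OF \<tau>_in[OF i] \<tau>_in[OF k]] \<tau>_eq[OF i k]
    by (auto simp: corner_def pr_mult0_right[OF e_degree[OF \<tau>_in[OF i]] x] A.m_assoc)
  show ?thesis
    using \<phi>_eq_corner[OF i, of "e i \<otimes> x"] \<phi>_eq_corner[OF i, of "x \<otimes> e (\<tau> i)"] 1 2 i x ei by simp
qed

text \<open>Meant for R saying that the product with a fixed element is nonzero: a homogeneous
  factor of maximal degree then puts the product into the socle, because any further factor of
  positive degree raises the degree. The maximum exists since degrees above l contain only zero,
  where R fails.\<close>

lemma top_degree: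
  assumes "R \<one>" and "\<not> R \<zero>"
  obtains t b where "b \<in> G t" "R b" "\<And>s c. c \<in> G s \<Longrightarrow> t < s \<Longrightarrow> \<not> R c"
proof -
  define Rt where "Rt t \<longleftrightarrow> (\<exists>b\<in>G t. R b)" for t
  have 0: "Rt 0" using one_degree assms(1) by (auto simp: Rt_def)
  have le: "\<forall>t. Rt t \<longrightarrow> t < Suc l"
  proof (intro allI impI, rule ccontr)
    fix t assume t: "Rt t" "\<not> t < Suc l"
    then have "G t = {\<zero>}" by (intro above_l) simp
    then show False using t(1) assms(2) by (simp add: Rt_def)
  qed
  from ex_has_greatest_nat[of Rt 0 "\<lambda>t. t" "Suc l", OF 0 le]
  obtain t where t: "Rt t" "\<forall>s. Rt s \<longrightarrow> s \<le> t" by blast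
  obtain b where "b \<in> G t" "R b" using t(1) unfolding Rt_def by blast
  moreover have "\<not> R c" if "c \<in> G s" "t < s" for s c
  proof
    assume "R c"
    then have "Rt s" using that(1) unfolding Rt_def by blast
    then have "s \<le> t" using t(2) by blast
    then show False using that(2) by simp
  qed
  ultimately show ?thesis by (rule that)
qed

text \<open>Cutting a down to some \<open>e i\<close> on the left and multiplying it on the right by
  a factor of top degree gives a nonzero element of the socle of the right projective at i. By
  stability this is a multiple of \<open>u i\<close>, on which \<phi> does not vanish;
  \<open>\<phi>_e\<close> finally moves the factor \<open>e i\<close> from the left end to the
  right.\<close>

lemma left_nondegenerate:
  assumes a: "a \<in> carrier A" "a \<noteq> \<zero>"
  shows "\<exists>b\<in>carrier A. \<phi> (a \<otimes> b) \<noteq> \<zero>\<^bsub>K\<^esub>"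
proof -
  obtain i where i: "i \<in> {1..n}" "e i \<otimes> a \<noteq> \<zero>" using ex_e_left[OF a] by blast
  let ?x = "e i \<otimes> a"
  have x: "?x \<in> carrier A" using i a by simp
  obtain t b where b: "b \<in> G t" "?x \<otimes> b \<noteq> \<zero>"
    and t: "\<And>s c. c \<in> G s \<Longrightarrow> t < s \<Longrightarrow> ?x \<otimes> c = \<zero>"
  proof (rule top_degree[of "\<lambda>b. ?x \<otimes> b \<noteq> \<zero>"])
    show "?x \<otimes> \<one> \<noteq> \<zero>" using i(2) x by (simp only: A.r_one not_False_eq_True)
    show "\<not> ?x \<otimes> \<zero> \<noteq> \<zero>" using x by simp
  qed (rule that, simp_all)
  have bc: "b \<in> carrier A" using AG.component_closed[OF b(1)] .
  obtain j where j: "j \<in> {1..n}" "?x \<otimes> b \<otimes> e j \<noteq> \<zero>"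
    using ex_e_right[OF A.m_closed[OF x bc] b(2)] by (rule bexE) (rule that)
  let ?y = "?x \<otimes> b \<otimes> e j"
  have "?y \<in> socle (opposite A) (right_projective A (e i))"
  proof (rule socle_memI[OF i(1) j(1)])
    show "?y \<in> carrier A" using x bc j by simp
    show "e i \<otimes> ?y = ?y"
      using a bc i j by (simp add: A.m_assoc[symmetric] e_idem)
    show "?y \<otimes> e j = ?y"
      using x bc j by (simp add: A.m_assoc e_idem)
    fix s v assume s: "1 \<le> s" and v: "v \<in> G s"
    have vc: "v \<in> carrier A" using AG.component_closed[OF v] .
    have "b \<otimes> (e j \<otimes> v) \<in> G (t + s)"
      by (intro component_mult b component_mult0_left e_degree j v)
    then have "?x \<otimes> (b \<otimes> (e j \<otimes> v)) = \<zero>" by (rule t) (use s in simp)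
    then show "?y \<otimes> v = \<zero>" using x bc j vc by (simp add: A.m_assoc)
  qed
  also have "\<dots> = {c \<odot> u i | c. c \<in> carrier K}"
    using stable i(1) u_span[OF i(1)] by (simp add: stable_bound_quiver_algebra_def)
  finally obtain c where c: "c \<in> carrier K" "?y = c \<odot> u i" by blast
  have c0: "c \<noteq> \<zero>\<^bsub>K\<^esub>"
  proof
    assume "c = \<zero>\<^bsub>K\<^esub>"
    then have "?y = \<zero>" using c(2) smult_l_null[OF u_closed[OF i(1)]] by simp
    then show False using j(2) by simp
  qed
  let ?b = "b \<otimes> e j"
  have bj: "?b \<in> carrier A" using bc j by simp
  have e\<tau>: "e (\<tau> i) \<in> carrier A" using e_closed[OF \<tau>_in[OF i(1)]] .
  have "\<phi> (a \<otimes> (?b \<otimes> e (\<tau> i))) = \<phi> (a \<otimes> ?b \<otimes> e (\<tau> i))"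
    using a(1) bj e\<tau> by (simp add: A.m_assoc)
  also have "\<dots> = \<phi> (e i \<otimes> (a \<otimes> ?b))"
    using \<phi>_e[OF i(1) A.m_closed[OF a(1) bj]] by (rule sym)
  also have "e i \<otimes> (a \<otimes> ?b) = ?y"
    using a(1) bc e_closed[OF i(1)] e_closed[OF j(1)] by (simp add: A.m_assoc)
  also have "\<phi> ?y = c"
    unfolding c(2) by (rule \<phi>_u[OF i(1) c(1)])
  finally show ?thesis using c0 A.m_closed[OF bj e\<tau>] by blast
qed

end

text \<open>A left ideal realised by constant sequences, because the test modules of
  \<open>injective_module\<close> have their carriers in
  \<open>nat \<Rightarrow> 'a\<close>.\<close>

definition const_module :: "('a, 'c) ring_scheme \<Rightarrow> 'a set \<Rightarrow> ('a, nat \<Rightarrow> 'a) module" where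
  "const_module R S =
    \<lparr>carrier = (\<lambda>a _. a) ` S, monoid.mult = undefined, one = undefined,
     ring.zero = (\<lambda>_. \<zero>\<^bsub>R\<^esub>), ring.add = (\<lambda>f g _. f 0 \<oplus>\<^bsub>R\<^esub> g 0), smult = (\<lambda>a f _. a \<otimes>\<^bsub>R\<^esub> f 0)\<rparr>"

lemma const_module_simps [simp]:
  "carrier (const_module R S) = (\<lambda>a _. a) ` S"
  "\<zero>\<^bsub>const_module R S\<^esub> = (\<lambda>_. \<zero>\<^bsub>R\<^esub>)"
  "f \<oplus>\<^bsub>const_module R S\<^esub> g = (\<lambda>_. f 0 \<oplus>\<^bsub>R\<^esub> g 0)"
  "a \<odot>\<^bsub>const_module R S\<^esub> f = (\<lambda>_. a \<otimes>\<^bsub>R\<^esub> f 0)"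
  by (simp_all add: const_module_def)

lemma (in ring) left_module_const_module:
  assumes S: "S \<subseteq> carrier R" and zero: "\<zero> \<in> S" and add: "\<And>x y. x \<in> S \<Longrightarrow> y \<in> S \<Longrightarrow> x \<oplus> y \<in> S"
    and minus: "\<And>x. x \<in> S \<Longrightarrow> \<ominus> x \<in> S" and mult: "\<And>a x. a \<in> carrier R \<Longrightarrow> x \<in> S \<Longrightarrow> a \<otimes> x \<in> S"
  shows "left_module R (const_module R S)"
proof (intro left_module.intro left_module_axioms.intro ring_axioms)
  have c [simp]: "x \<in> carrier R" if "x \<in> S" for x using S that by blast
  let ?M = "const_module R S"
  show "abelian_group ?M"
  proof (rule abelian_groupI)
    show "x \<oplus>\<^bsub>?M\<^esub> y \<in> carrier ?M" if "x \<in> carrier ?M" "y \<in> carrier ?M" for x y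
      using that add by auto
    show "\<zero>\<^bsub>?M\<^esub> \<in> carrier ?M" using zero by auto
    show "\<exists>y\<in>carrier ?M. y \<oplus>\<^bsub>?M\<^esub> x = \<zero>\<^bsub>?M\<^esub>" if x: "x \<in> carrier ?M" for x
    proof -
      obtain a where a: "x = (\<lambda>_. a)" "a \<in> S" using x by auto
      show ?thesis
        by (rule bexI[of _ "\<lambda>_. \<ominus> a"]) (use a minus in \<open>auto simp: l_neg\<close>)
    qed
  qed (auto simp: a_ac)
  show "a \<odot>\<^bsub>?M\<^esub> x \<in> carrier ?M" if "a \<in> carrier R" "x \<in> carrier ?M" for a x
    using that mult by auto
qed (use S in \<open>auto simp: l_distr r_distr m_assoc subset_iff\<close>)

section \<open>Nondegeneracy in the second argument, duality and degrees\<close>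

context stable_self_injective
begin

lemma mult_u_zero:
  assumes "j \<in> {1..n}" "1 \<le> t" "b \<in> G t"
  shows "b \<otimes> u j = \<zero>" and "u j \<otimes> b = \<zero>"
  using component_mult[OF assms(3) u_degree[OF assms(1)]] component_mult[OF u_degree[OF assms(1)] assms(3)]
    above_l[of "t + l"] above_l[of "l + t"] assms(2) by auto

text \<open>Since \<open>u j\<close> and \<open>y\<close> generate isomorphic simple left ideals, injectivity extends the
  isomorphism \<open>u j \<mapsto> y\<close> to a right multiplication of \<open>A\<close>.\<close>

lemma left_socle:
  assumes j: "j \<in> {1..n}" and y: "y \<in> carrier A" "e j \<otimes> y = y"
    and kill: "\<And>t b. 1 \<le> t \<Longrightarrow> b \<in> G t \<Longrightarrow> b \<otimes> y = \<zero>"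
  shows "\<exists>c\<in>carrier A. y = u j \<otimes> c"
proof -
  have uj: "u j \<in> carrier A" using u_closed[OF j] .
  have act_u: "a \<otimes> (c \<odot> u j) = (c \<otimes>\<^bsub>K\<^esub> ev j a) \<odot> u j" if "a \<in> carrier A" "c \<in> carrier K" for a c
    using that ev(1)[OF j that(1)] uj left_eigen[OF j that(1) uj e_u[OF j] mult_u_zero(1)[OF j]]
    by (simp add: smult_mult_right smult_assoc1)
  have act_y: "a \<otimes> (c \<odot> y) = (c \<otimes>\<^bsub>K\<^esub> ev j a) \<odot> y" if "a \<in> carrier A" "c \<in> carrier K" for a c
    using that ev(1)[OF j that(1)] y(1) left_eigen[OF j that(1) y kill]
    by (simp add: smult_mult_right smult_assoc1)
  let ?S = "(\<lambda>c. c \<odot> u j) ` carrier K"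
  let ?M = "const_module A ?S" and ?N = "const_module A (carrier A)"
  \<comment> \<open>\<open>m 0\<close> is the value of the constant sequence and
    \<open>\<kappa> j\<close> its coefficient, so g sends \<open>u j\<close> to y. It is linear
    because a acts on \<open>u j\<close> and on y by the same scalar \<open>ev j a\<close>.\<close>
  define g where "g m = \<kappa> j (m (0::nat)) \<odot> y" for m
  have g: "g (\<lambda>_. c \<odot> u j) = c \<odot> y" if "c \<in> carrier K" for c
    using that j by (simp add: g_def)
  have M: "left_module A ?M"
  proof (rule A.left_module_const_module)
    show "?S \<subseteq> carrier A" using uj by auto
    show "\<zero> \<in> ?S" by (rule image_eqI[of _ _ "\<zero>\<^bsub>K\<^esub>"]) (use uj in auto)
    show "v \<oplus> w \<in> ?S" if vw: "v \<in> ?S" "w \<in> ?S" for v w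
    proof -
      obtain c c' where "v = c \<odot> u j" "w = c' \<odot> u j" "c \<in> carrier K" "c' \<in> carrier K" using vw by auto
      then show ?thesis by (intro image_eqI[of _ _ "c \<oplus>\<^bsub>K\<^esub> c'"]) (use uj in \<open>auto simp: smult_l_distr\<close>)
    qed
    show "\<ominus> v \<in> ?S" if v: "v \<in> ?S" for v
    proof -
      obtain c where "v = c \<odot> u j" "c \<in> carrier K" using v by auto
      then show ?thesis by (intro image_eqI[of _ _ "\<ominus>\<^bsub>K\<^esub> c"]) (use uj in \<open>auto simp: smult_l_minus\<close>)
    qed
    show "a \<otimes> v \<in> ?S" if a: "a \<in> carrier A" and v: "v \<in> ?S" for a v
    proof -
      obtain c where "v = c \<odot> u j" "c \<in> carrier K" using v by auto
      then show ?thesis using a act_u[OF a] ev(1)[OF j a] by auto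
    qed
  qed
  have N: "left_module A ?N"
    by (rule A.left_module_const_module) auto
  have f: "(\<lambda>m. m) \<in> left_module_hom A ?M ?N"
    unfolding left_module_hom_def using uj by auto
  have "g \<in> left_module_hom A ?M (regular_module A)"
    unfolding left_module_hom_def
  proof (intro CollectI conjI ballI funcsetI)
    fix m assume "m \<in> carrier ?M"
    then obtain c where c: "c \<in> carrier K" "m = (\<lambda>_. c \<odot> u j)" by auto
    show "g m \<in> carrier (regular_module A)" using c y(1) g by (simp add: regular_module_def)
    show "g (m \<oplus>\<^bsub>?M\<^esub> m') = g m \<oplus>\<^bsub>regular_module A\<^esub> g m'" if m': "m' \<in> carrier ?M" for m'
    proof -
      obtain c' where c': "c' \<in> carrier K" "m' = (\<lambda>_. c' \<odot> u j)" using m' by auto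
      have "m \<oplus>\<^bsub>?M\<^esub> m' = (\<lambda>_. (c \<oplus>\<^bsub>K\<^esub> c') \<odot> u j)" using c c' uj by (simp add: smult_l_distr)
      then show ?thesis using c c' y(1) g by (simp add: regular_module_def smult_l_distr del: const_module_simps)
    qed
  next
    fix a m assume a: "a \<in> carrier A" and "m \<in> carrier ?M"
    then obtain c where c: "c \<in> carrier K" "m = (\<lambda>_. c \<odot> u j)" by auto
    have "a \<odot>\<^bsub>?M\<^esub> m = (\<lambda>_. (c \<otimes>\<^bsub>K\<^esub> ev j a) \<odot> u j)" using c a act_u by simp
    then show "g (a \<odot>\<^bsub>?M\<^esub> m) = a \<odot>\<^bsub>regular_module A\<^esub> g m"
      using c a act_y ev(1)[OF j a] g by (simp add: regular_module_def del: const_module_simps)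
  qed
  with M N f obtain h where h: "h \<in> left_module_hom A ?N (regular_module A)" "\<forall>x\<in>carrier ?M. h x = g x"
    using self_inj unfolding self_injective_def injective_module_def by (metis inj_on_id2)
  let ?m = "\<lambda>_::nat. u j"
  have m: "?m = (\<lambda>_. \<one>\<^bsub>K\<^esub> \<odot> u j)" using uj by simp
  then have mM: "?m \<in> carrier ?M" by auto
  \<comment> \<open>A left linear map on \<open>A\<close> is right multiplication by its value at
    \<one>; this value is the c sought.\<close>
  have "h (u j \<odot>\<^bsub>?N\<^esub> (\<lambda>_. \<one>)) = u j \<odot>\<^bsub>regular_module A\<^esub> h (\<lambda>_. \<one>)"
  proof -
    have "(\<lambda>_. \<one>) \<in> carrier ?N" by simp
    moreover have "\<forall>a\<in>carrier A. \<forall>x\<in>carrier ?N. h (a \<odot>\<^bsub>?N\<^esub> x) = a \<odot>\<^bsub>regular_module A\<^esub> h x"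
      using h(1) unfolding left_module_hom_def by blast
    ultimately show ?thesis using uj by blast
  qed
  then have "h ?m = u j \<otimes> h (\<lambda>_. \<one>)" using uj by (simp add: regular_module_def)
  moreover have "h ?m = y" using bspec[OF h(2) mM] g[of "\<one>\<^bsub>K\<^esub>"] y(1) uj by simp
  moreover have "h (\<lambda>_. \<one>) \<in> carrier A"
    using h(1) unfolding left_module_hom_def by (auto simp: regular_module_def)
  ultimately show ?thesis by blast
qed

text \<open>Mirrors \<open>left_nondegenerate\<close>, but stability speaks of right modules only.
  Instead \<open>left_socle\<close> puts the socle element into the right ideal generated by
  \<open>u j\<close>, and since positive degrees annihilate \<open>u j\<close> from the right, that
  ideal is just the line through \<open>u j\<close>.\<close>

lemma right_nondegenerate:
  assumes b: "b \<in> carrier A" "b \<noteq> \<zero>"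
  shows "\<exists>a\<in>carrier A. \<phi> (a \<otimes> b) \<noteq> \<zero>\<^bsub>K\<^esub>"
proof -
  obtain t a where a: "a \<in> G t" "a \<otimes> b \<noteq> \<zero>"
    and t: "\<And>s c. c \<in> G s \<Longrightarrow> t < s \<Longrightarrow> c \<otimes> b = \<zero>"
  proof (rule top_degree[of "\<lambda>a. a \<otimes> b \<noteq> \<zero>"])
    show "\<one> \<otimes> b \<noteq> \<zero>" using b by simp
    show "\<not> \<zero> \<otimes> b \<noteq> \<zero>" using b by simp
  qed (rule that, simp_all)
  have ac: "a \<in> carrier A" using AG.component_closed[OF a(1)] .
  obtain j where j: "j \<in> {1..n}" "e j \<otimes> (a \<otimes> b) \<noteq> \<zero>"
    using ex_e_left[OF A.m_closed[OF ac b(1)] a(2)] by (rule bexE) (rule that)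
  let ?y = "e j \<otimes> (a \<otimes> b)"
  have y: "?y \<in> carrier A" using ac b j by simp
  have "\<exists>c\<in>carrier A. ?y = u j \<otimes> c"
  proof (rule left_socle[OF j(1) y])
    show "e j \<otimes> ?y = ?y" using ac b j by (simp add: A.m_assoc[symmetric] e_idem)
    fix s v assume s: "1 \<le> s" and v: "v \<in> G s"
    have vc: "v \<in> carrier A" using AG.component_closed[OF v] .
    have "v \<otimes> e j \<otimes> a \<in> G (s + t)"
      by (intro component_mult component_mult0_right e_degree j v a)
    then have "v \<otimes> e j \<otimes> a \<otimes> b = \<zero>" by (rule t) (use s in simp)
    then show "v \<otimes> ?y = \<zero>" using vc ac b j by (simp add: A.m_assoc)
  qed
  then obtain c where c: "c \<in> carrier A" "?y = u j \<otimes> c" by blast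
  let ?k = "ev (\<tau> j) c"
  have k: "?k \<in> carrier K" using ev(1)[OF \<tau>_in[OF j(1)] c(1)] .
  have yk: "?y = ?k \<odot> u j"
    unfolding c(2)
    by (rule right_eigen[OF \<tau>_in[OF j(1)] c(1) u_closed[OF j(1)] u_e[OF j(1)] mult_u_zero(2)[OF j(1)]])
  have "?k \<noteq> \<zero>\<^bsub>K\<^esub>"
  proof
    assume "?k = \<zero>\<^bsub>K\<^esub>"
    then have "?y = \<zero>" using yk smult_l_null[OF u_closed[OF j(1)]] by simp
    then show False using j(2) by simp
  qed
  moreover have "\<phi> (e j \<otimes> a \<otimes> b) = ?k"
  proof -
    have "e j \<otimes> a \<otimes> b = ?y" using ac b j by (simp add: A.m_assoc)
    also have "\<phi> ?y = ?k" unfolding yk by (rule \<phi>_u[OF j(1) k])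
    finally show ?thesis .
  qed
  ultimately show ?thesis using A.m_closed[OF e_closed[OF j(1)] ac] by (metis)
qed

text \<open>Values of a linear family form a subspace of the dual, which is everything once it
  separates points. Applied to both one-sided families of multiples of \<phi>.\<close>

lemma separating_family:
  assumes w: "\<And>a. a \<in> carrier A \<Longrightarrow> restrict (w a) (carrier A) \<in> linear_functionals K A"
    and lin: "\<And>a b c x. \<lbrakk>a \<in> carrier A; b \<in> carrier A; c \<in> carrier K; x \<in> carrier A\<rbrakk> \<Longrightarrow>
      w (a \<oplus> c \<odot> b) x = w a x \<oplus>\<^bsub>K\<^esub> c \<otimes>\<^bsub>K\<^esub> w b x"
    and sep: "\<And>v. \<lbrakk>v \<in> carrier A; v \<noteq> \<zero>\<rbrakk> \<Longrightarrow> \<exists>a\<in>carrier A. w a v \<noteq> \<zero>\<^bsub>K\<^esub>"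
    and f: "f \<in> linear_functionals K A"
  shows "\<exists>a\<in>carrier A. f = restrict (w a) (carrier A)"
proof -
  let ?W = "(\<lambda>a. restrict (w a) (carrier A)) ` carrier A"
  have "separating_functionals K A ?W"
  proof (intro separating_functionals.intro separating_functionals_axioms.intro)
    show "field K" "module K A" by unfold_locales
    show "?W \<subseteq> linear_functionals K A" using w by blast
    show "?W \<noteq> {}" by blast
    show "(\<lambda>x\<in>carrier A. v x \<oplus>\<^bsub>K\<^esub> c \<otimes>\<^bsub>K\<^esub> v' x) \<in> ?W" if v: "v \<in> ?W" "v' \<in> ?W" and c: "c \<in> carrier K" for v v' c
    proof -
      obtain a b where "a \<in> carrier A" "v = restrict (w a) (carrier A)"
        "b \<in> carrier A" "v' = restrict (w b) (carrier A)" using v by blast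
      then show ?thesis using c by (intro image_eqI[of _ _ "a \<oplus> c \<odot> b"]) (auto simp: lin)
    qed
    show "\<exists>w\<in>?W. w v \<noteq> \<zero>\<^bsub>K\<^esub>" if "v \<in> carrier A" "v \<noteq> \<zero>" for v
      using sep[OF that] that(1) by auto
  qed
  from separating_functionals.all_functionals[OF this fin_dim f] show ?thesis by blast
qed

text \<open>The functionals x \<mapsto> \<phi>(x a) separate points by nondegeneracy in the first
  argument, so this side rests on \<open>left_nondegenerate\<close> and
  \<open>functional_left\<close> on \<open>right_nondegenerate\<close>.\<close>

lemma functional_right:
  assumes "f \<in> linear_functionals K A"
  shows "\<exists>a\<in>carrier A. f = (\<lambda>x\<in>carrier A. \<phi> (x \<otimes> a))"
  by (rule separating_family[OF _ _ _ assms])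
    (auto simp: linear_functionals_def A.l_distr A.r_distr smult_mult_left smult_mult_right
      \<phi>_add \<phi>_smult left_nondegenerate)

lemma functional_left:
  assumes "f \<in> linear_functionals K A"
  shows "\<exists>b\<in>carrier A. f = (\<lambda>x\<in>carrier A. \<phi> (b \<otimes> x))"
  by (rule separating_family[OF _ _ _ assms])
    (auto simp: linear_functionals_def A.l_distr A.r_distr smult_mult_left smult_mult_right
      \<phi>_add \<phi>_smult right_nondegenerate)

lemma \<phi>_minus: "x \<in> carrier A \<Longrightarrow> \<phi> (\<ominus> x) = \<ominus>\<^bsub>K\<^esub> \<phi> x"
  by (rule additive_minus[OF A_group K.abelian_group_axioms]) (auto simp: \<phi>_add)

lemma left_cancel:
  assumes b: "b \<in> carrier A" "b' \<in> carrier A" and eq: "\<And>x. x \<in> carrier A \<Longrightarrow> \<phi> (b \<otimes> x) = \<phi> (b' \<otimes> x)"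
  shows "b = b'"
proof (rule ccontr)
  assume "b \<noteq> b'"
  then have "b \<ominus> b' \<noteq> \<zero>" using b by simp
  then obtain x where x: "x \<in> carrier A" "\<phi> ((b \<ominus> b') \<otimes> x) \<noteq> \<zero>\<^bsub>K\<^esub>"
    using left_nondegenerate[of "b \<ominus> b'"] b by auto
  then show False
    using b eq[OF x(1)] by (simp add: A.minus_eq A.l_distr A.l_minus \<phi>_add \<phi>_minus K.r_neg)
qed

lemma right_cancel:
  assumes b: "b \<in> carrier A" "b' \<in> carrier A" and eq: "\<And>x. x \<in> carrier A \<Longrightarrow> \<phi> (x \<otimes> b) = \<phi> (x \<otimes> b')"
  shows "b = b'"
proof (rule ccontr)
  assume "b \<noteq> b'"
  then have "b \<ominus> b' \<noteq> \<zero>" using b by simp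
  then obtain x where x: "x \<in> carrier A" "\<phi> (x \<otimes> (b \<ominus> b')) \<noteq> \<zero>\<^bsub>K\<^esub>"
    using right_nondegenerate[of "b \<ominus> b'"] b by auto
  then show False
    using b eq[OF x(1)] by (simp add: A.minus_eq A.r_distr A.r_minus \<phi>_add \<phi>_minus K.r_neg)
qed

text \<open>As \<phi> is supported in degree l, pairing with an x of degree s sees only the
  component of b of degree l - s. A component of degree other than k is therefore orthogonal to
  everything, hence zero by nondegeneracy.\<close>

lemma homogeneous_if_\<phi>_vanishes:
  assumes b: "b \<in> carrier A"
    and van: "\<And>s x. x \<in> G s \<Longrightarrow> k + s \<noteq> l \<Longrightarrow> \<phi> (b \<otimes> x) = \<zero>\<^bsub>K\<^esub>"
  shows "b \<in> G k"
proof -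
  have pr_b: "\<phi> (b \<otimes> x) = \<phi> (AG.pr r b \<otimes> x)" if x: "x \<in> G s" and rs: "r + s = l" for x r s
    using b
  proof (induction b rule: AG.additive_pr_induct)
    case (homogeneous t b)
    then show ?case
      using \<phi>_degree[OF component_mult[OF homogeneous x]] rs AG.component_closed[OF x]
      by (auto simp: AG.pr_homogeneous)
  next
    case (add b c)
    then show ?case using AG.component_closed[OF x] by (simp add: AG.pr_add A.l_distr \<phi>_add)
  qed
  have zero: "AG.pr r b = \<zero>" if r: "r \<noteq> k" for r
  proof (rule left_cancel)
    fix x assume "x \<in> carrier A"
    then show "\<phi> (AG.pr r b \<otimes> x) = \<phi> (\<zero> \<otimes> x)"
    proof (induction x rule: AG.additive_pr_induct)
      case (homogeneous s x)
      have xc: "x \<in> carrier A" using AG.component_closed[OF homogeneous] .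
      show ?case
      proof (cases "r + s = l")
        case True
        then show ?thesis using pr_b[OF homogeneous True] van[OF homogeneous] r xc by simp
      next
        case False
        then show ?thesis using \<phi>_degree[OF component_mult[OF AG.pr_in[OF b] homogeneous]] xc by simp
      qed
    next
      case (add x y)
      then show ?case using b by (simp add: A.r_distr \<phi>_add)
    qed
  qed (use b in simp_all)
  have "b = AG.pr k b"
    by (rule AG.eq_if_pr_eq) (use b zero in \<open>auto simp: AG.pr_homogeneous[OF AG.pr_in[OF b]]\<close>)
  then show ?thesis using AG.pr_in[OF b, of k] by simp
qed

end

section \<open>The twisted trivial extension\<close>

locale twisted_extension = stable_self_injective K A G n e l \<tau>
  for K :: "('k, 'c) ring_scheme" and A :: "('k, 'a) module" (structure) and G n e l \<tau> +
  fixes \<sigma> :: "'a \<Rightarrow> 'a"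
  assumes \<sigma>_automorphism: "graded_automorphism K A G \<sigma>"
begin

abbreviation "DA \<equiv> dual_bimodule K A"
abbreviation "LF \<equiv> linear_functionals K A"
abbreviation "T \<equiv> twisted_trivial_extension K A \<sigma>"
abbreviation "TG \<equiv> twisted_grading K A G l"

lemma \<sigma>_bij: "bij_betw \<sigma> (carrier A) (carrier A)" and \<sigma>_hom: "\<sigma> \<in> ring_hom A A"
  and \<sigma>_smult: "c \<in> carrier K \<Longrightarrow> x \<in> carrier A \<Longrightarrow> \<sigma> (c \<odot> x) = c \<odot> \<sigma> x"
  using \<sigma>_automorphism by (auto simp: graded_automorphism_def ring_iso_def)

lemma \<sigma>_graded: "x \<in> G t \<Longrightarrow> \<sigma> x \<in> G t"
  using \<sigma>_automorphism unfolding graded_automorphism_def by blast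

lemmas \<sigma>_closed [simp] = ring_hom_closed[OF \<sigma>_hom]
  and \<sigma>_mult = ring_hom_mult[OF \<sigma>_hom] and \<sigma>_add = ring_hom_add[OF \<sigma>_hom]
  and \<sigma>_one [simp] = ring_hom_one[OF \<sigma>_hom]
  and \<sigma>_inj = inj_onD[OF bij_betw_imp_inj_on[OF \<sigma>_bij]]

lemma \<sigma>_zero [simp]: "\<sigma> \<zero> = \<zero>"
  by (rule ring_hom_zero[OF \<sigma>_hom A.ring_axioms A.ring_axioms])

lemma \<sigma>_pr:
  assumes "x \<in> carrier A" shows "AG.pr t (\<sigma> x) = \<sigma> (AG.pr t x)"
  using assms
proof (induction x rule: AG.additive_pr_induct)
  case (homogeneous s x)
  then show ?case using \<sigma>_graded[OF homogeneous] by (simp add: AG.pr_homogeneous)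
next
  case (add x y)
  then show ?case by (simp add: \<sigma>_add AG.pr_add)
qed

lemma \<sigma>_graded_iff:
  assumes x: "x \<in> carrier A" and "\<sigma> x \<in> G k" shows "x \<in> G k"
proof -
  have "\<sigma> (AG.pr k x) = \<sigma> x"
    using AG.pr_homogeneous[OF assms(2), of k] \<sigma>_pr[OF x] by simp
  then have "AG.pr k x = x" using \<sigma>_inj x by simp
  then show ?thesis using AG.pr_in[OF x, of k] by simp
qed

lemma LF_closed: "f \<in> LF \<Longrightarrow> x \<in> carrier A \<Longrightarrow> f x \<in> carrier K"
  by (rule linear_functionalsD(1))

lemma LF_eqI: "f \<in> LF \<Longrightarrow> g \<in> LF \<Longrightarrow> (\<And>x. x \<in> carrier A \<Longrightarrow> f x = g x) \<Longrightarrow> f = g"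
  by (rule extensionalityI[OF linear_functionalsD(4) linear_functionalsD(4)])

lemma LF_zero: "f \<in> LF \<Longrightarrow> f \<zero> = \<zero>\<^bsub>K\<^esub>"
  by (rule additive_zero[OF A_group K.abelian_group_axioms]) (auto simp: linear_functionalsD)

lemma LF_restrictI:
  assumes "\<And>x. x \<in> carrier A \<Longrightarrow> f x \<in> carrier K"
    and "\<And>x y. x \<in> carrier A \<Longrightarrow> y \<in> carrier A \<Longrightarrow> f (x \<oplus> y) = f x \<oplus>\<^bsub>K\<^esub> f y"
    and "\<And>c x. c \<in> carrier K \<Longrightarrow> x \<in> carrier A \<Longrightarrow> f (c \<odot> x) = c \<otimes>\<^bsub>K\<^esub> f x"
  shows "restrict f (carrier A) \<in> LF"
  using assms unfolding linear_functionals_def by auto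

section \<open>Functionals, and the algebra and grading of the extension\<close>

definition fzero :: "'a \<Rightarrow> 'k" where "fzero = (\<lambda>x\<in>carrier A. \<zero>\<^bsub>K\<^esub>)"

definition fadd :: "('a \<Rightarrow> 'k) \<Rightarrow> ('a \<Rightarrow> 'k) \<Rightarrow> 'a \<Rightarrow> 'k" where
  "fadd f g = (\<lambda>x\<in>carrier A. f x \<oplus>\<^bsub>K\<^esub> g x)"

definition fsmult :: "'k \<Rightarrow> ('a \<Rightarrow> 'k) \<Rightarrow> 'a \<Rightarrow> 'k" where
  "fsmult c f = (\<lambda>x\<in>carrier A. c \<otimes>\<^bsub>K\<^esub> f x)"

lemma DA_simps:
  "carrier DA = LF" "\<zero>\<^bsub>DA\<^esub> = fzero" "f \<oplus>\<^bsub>DA\<^esub> g = fadd f g"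
  by (simp_all add: dual_bimodule_def fzero_def fadd_def)

definition lact :: "'a \<Rightarrow> ('a \<Rightarrow> 'k) \<Rightarrow> 'a \<Rightarrow> 'k" where
  "lact a f = (\<lambda>x\<in>carrier A. f (x \<otimes> a))"

definition ract :: "('a \<Rightarrow> 'k) \<Rightarrow> 'a \<Rightarrow> 'a \<Rightarrow> 'k" where
  "ract f b = (\<lambda>x\<in>carrier A. f (\<sigma> b \<otimes> x))"

lemma fzero_apply [simp]: "x \<in> carrier A \<Longrightarrow> fzero x = \<zero>\<^bsub>K\<^esub>"
  and fadd_apply [simp]: "x \<in> carrier A \<Longrightarrow> fadd f g x = f x \<oplus>\<^bsub>K\<^esub> g x"
  and fsmult_apply [simp]: "x \<in> carrier A \<Longrightarrow> fsmult c f x = c \<otimes>\<^bsub>K\<^esub> f x"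
  and lact_apply [simp]: "x \<in> carrier A \<Longrightarrow> lact a f x = f (x \<otimes> a)"
  and ract_apply [simp]: "x \<in> carrier A \<Longrightarrow> ract f b x = f (\<sigma> b \<otimes> x)"
  by (simp_all add: fzero_def fadd_def fsmult_def lact_def ract_def)

lemma lact_LF [simp]: "a \<in> carrier A \<Longrightarrow> f \<in> LF \<Longrightarrow> lact a f \<in> LF"
  unfolding lact_def
  by (rule LF_restrictI) (simp_all add: linear_functionalsD A.l_distr smult_mult_left)

lemma ract_LF [simp]: "b \<in> carrier A \<Longrightarrow> f \<in> LF \<Longrightarrow> ract f b \<in> LF"
  unfolding ract_def
  by (rule LF_restrictI) (simp_all add: linear_functionalsD A.r_distr smult_mult_right)

lemma fadd_LF [simp]: "f \<in> LF \<Longrightarrow> g \<in> LF \<Longrightarrow> fadd f g \<in> LF"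
  unfolding fadd_def by (rule LF_restrictI) (simp_all add: linear_functionalsD K.a_ac K.r_distr)

lemma fzero_LF [simp]: "fzero \<in> LF"
  unfolding fzero_def by (rule LF_restrictI) simp_all

lemma fsmult_LF [simp]: "c \<in> carrier K \<Longrightarrow> f \<in> LF \<Longrightarrow> fsmult c f \<in> LF"
  unfolding fsmult_def by (rule LF_restrictI) (simp_all add: linear_functionalsD K.r_distr K.m_ac)

lemma T_simps:
  "carrier T = carrier A \<times> LF"
  "(a, f) \<otimes>\<^bsub>T\<^esub> (b, g) = (a \<otimes> b, fadd (lact a g) (ract f b))"
  "\<one>\<^bsub>T\<^esub> = (\<one>, fzero)" "\<zero>\<^bsub>T\<^esub> = (\<zero>, fzero)"
  "(a, f) \<oplus>\<^bsub>T\<^esub> (b, g) = (a \<oplus> b, fadd f g)"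
  by (simp_all add: twisted_trivial_extension_def trivial_extension_def twist_bimodule_def
      dual_bimodule_def lact_def ract_def fadd_def fzero_def)

lemma T_eqI: "f \<in> LF \<Longrightarrow> g \<in> LF \<Longrightarrow> a = b \<Longrightarrow> (\<And>x. x \<in> carrier A \<Longrightarrow> f x = g x) \<Longrightarrow> (a, f) = (b, g)"
  using LF_eqI by blast

lemma T_group: "abelian_group T"
proof (rule abelian_groupI)
  fix s t v assume "s \<in> carrier T" "t \<in> carrier T" "v \<in> carrier T"
  then obtain a f b g c h where st: "s = (a, f)" "t = (b, g)" "v = (c, h)"
    and m: "a \<in> carrier A" "f \<in> LF" "b \<in> carrier A" "g \<in> LF" "c \<in> carrier A" "h \<in> LF"
    by (auto simp: T_simps)
  show "s \<oplus>\<^bsub>T\<^esub> t \<in> carrier T" using m by (simp add: st T_simps)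
  show "s \<oplus>\<^bsub>T\<^esub> t = t \<oplus>\<^bsub>T\<^esub> s"
    unfolding st T_simps by (rule T_eqI) (use m in \<open>simp_all add: A.a_comm K.a_comm LF_closed\<close>)
  show "s \<oplus>\<^bsub>T\<^esub> t \<oplus>\<^bsub>T\<^esub> v = s \<oplus>\<^bsub>T\<^esub> (t \<oplus>\<^bsub>T\<^esub> v)"
    unfolding st T_simps by (rule T_eqI) (use m in \<open>simp_all add: A.a_assoc K.a_assoc LF_closed\<close>)
  show "\<zero>\<^bsub>T\<^esub> \<oplus>\<^bsub>T\<^esub> s = s"
    unfolding st T_simps by (rule T_eqI) (use m in \<open>simp_all add: LF_closed\<close>)
  show "\<exists>y\<in>carrier T. y \<oplus>\<^bsub>T\<^esub> s = \<zero>\<^bsub>T\<^esub>"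
  proof (rule bexI)
    show "(\<ominus> a, fsmult (\<ominus>\<^bsub>K\<^esub> \<one>\<^bsub>K\<^esub>) f) \<in> carrier T" using m by (simp add: T_simps)
    show "(\<ominus> a, fsmult (\<ominus>\<^bsub>K\<^esub> \<one>\<^bsub>K\<^esub>) f) \<oplus>\<^bsub>T\<^esub> s = \<zero>\<^bsub>T\<^esub>"
      unfolding st T_simps by (rule T_eqI) (use m in \<open>simp_all add: LF_closed A.l_neg K.l_neg K.l_minus\<close>)
  qed
qed (simp add: T_simps)

lemma T_ring: "ring T"
proof (rule ringI[OF T_group])
  show "monoid T"
  proof (rule monoidI)
    fix s t v assume "s \<in> carrier T" "t \<in> carrier T" "v \<in> carrier T"
    then obtain a f b g c h where st: "s = (a, f)" "t = (b, g)" "v = (c, h)"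
      and m: "a \<in> carrier A" "f \<in> LF" "b \<in> carrier A" "g \<in> LF" "c \<in> carrier A" "h \<in> LF"
      by (auto simp: T_simps)
    show "s \<otimes>\<^bsub>T\<^esub> t \<in> carrier T" using m by (simp add: st T_simps)
    show "s \<otimes>\<^bsub>T\<^esub> t \<otimes>\<^bsub>T\<^esub> v = s \<otimes>\<^bsub>T\<^esub> (t \<otimes>\<^bsub>T\<^esub> v)"
      unfolding st T_simps by (rule T_eqI)
        (use m in \<open>simp_all add: A.m_assoc K.a_assoc LF_closed \<sigma>_mult\<close>)
    show "\<one>\<^bsub>T\<^esub> \<otimes>\<^bsub>T\<^esub> s = s"
      unfolding st T_simps by (rule T_eqI) (use m in \<open>simp_all add: LF_closed LF_zero\<close>)
    show "s \<otimes>\<^bsub>T\<^esub> \<one>\<^bsub>T\<^esub> = s"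
      unfolding st T_simps by (rule T_eqI) (use m in \<open>simp_all add: LF_closed LF_zero\<close>)
  qed (simp add: T_simps)
  fix s t v assume "s \<in> carrier T" "t \<in> carrier T" "v \<in> carrier T"
  then obtain a f b g c h where st: "s = (a, f)" "t = (b, g)" "v = (c, h)"
    and m: "a \<in> carrier A" "f \<in> LF" "b \<in> carrier A" "g \<in> LF" "c \<in> carrier A" "h \<in> LF"
    by (auto simp: T_simps)
  show "(s \<oplus>\<^bsub>T\<^esub> t) \<otimes>\<^bsub>T\<^esub> v = s \<otimes>\<^bsub>T\<^esub> v \<oplus>\<^bsub>T\<^esub> t \<otimes>\<^bsub>T\<^esub> v"
    unfolding st T_simps by (rule T_eqI)
      (use m in \<open>simp_all add: A.l_distr A.r_distr linear_functionalsD K.a_ac\<close>)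
  show "v \<otimes>\<^bsub>T\<^esub> (s \<oplus>\<^bsub>T\<^esub> t) = v \<otimes>\<^bsub>T\<^esub> s \<oplus>\<^bsub>T\<^esub> v \<otimes>\<^bsub>T\<^esub> t"
    unfolding st T_simps by (rule T_eqI)
      (use m in \<open>simp_all add: A.l_distr A.r_distr linear_functionalsD K.a_ac \<sigma>_add\<close>)
qed

lemma T_smult:
  assumes "c \<in> carrier K" "a \<in> carrier A" "f \<in> LF"
  shows "c \<odot>\<^bsub>T\<^esub> (a, f) = (c \<odot> a, fsmult c f)"
proof -
  have "c \<odot>\<^bsub>T\<^esub> (a, f) = (c \<odot> a, lact (c \<odot> \<one>) f)"
    by (simp add: twisted_trivial_extension_def trivial_extension_def twist_bimodule_def
        dual_bimodule_def lact_def)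
  also have "\<dots> = (c \<odot> a, fsmult c f)"
    by (rule T_eqI) (use assms in \<open>simp_all add: smult_mult_right linear_functionalsD\<close>)
  finally show ?thesis .
qed

lemma T_field_algebra: "field_algebra K T"
proof (intro field_algebra.intro field_algebra_axioms.intro T_ring)
  show "field K" by unfold_locales
  show "module K T"
  proof (rule moduleI[OF _ T_group])
    show "cring K" by unfold_locales
    fix c d s t assume "s \<in> carrier T" "t \<in> carrier T" and c: "c \<in> carrier K" "d \<in> carrier K"
    then obtain a f b g where st: "s = (a, f)" "t = (b, g)"
      and m: "a \<in> carrier A" "f \<in> LF" "b \<in> carrier A" "g \<in> LF"
      by (auto simp: T_simps)
    show "c \<odot>\<^bsub>T\<^esub> s \<in> carrier T" using c m by (simp add: st T_smult) (simp add: T_simps)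
    show "(c \<oplus>\<^bsub>K\<^esub> d) \<odot>\<^bsub>T\<^esub> s = c \<odot>\<^bsub>T\<^esub> s \<oplus>\<^bsub>T\<^esub> d \<odot>\<^bsub>T\<^esub> s"
      unfolding st T_smult[OF c(1) m(1,2)] T_smult[OF c(2) m(1,2)] T_smult[OF K.a_closed[OF c] m(1,2)] T_simps
      by (rule T_eqI) (use c m in \<open>simp_all add: smult_l_distr K.l_distr LF_closed\<close>)
    show "c \<odot>\<^bsub>T\<^esub> (s \<oplus>\<^bsub>T\<^esub> t) = c \<odot>\<^bsub>T\<^esub> s \<oplus>\<^bsub>T\<^esub> c \<odot>\<^bsub>T\<^esub> t"
      unfolding st T_simps T_smult[OF c(1) m(1,2)] T_smult[OF c(1) m(3,4)]
        T_smult[OF c(1) A.a_closed[OF m(1,3)] fadd_LF[OF m(2,4)]]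
      by (rule T_eqI) (use c m in \<open>simp_all add: smult_r_distr K.r_distr LF_closed\<close>)
    show "(c \<otimes>\<^bsub>K\<^esub> d) \<odot>\<^bsub>T\<^esub> s = c \<odot>\<^bsub>T\<^esub> (d \<odot>\<^bsub>T\<^esub> s)"
      unfolding st T_smult[OF c(2) m(1,2)] T_smult[OF K.m_closed[OF c] m(1,2)]
        T_smult[OF c(1) smult_closed[OF c(2) m(1)] fsmult_LF[OF c(2) m(2)]]
      by (rule T_eqI) (use c m in \<open>simp_all add: smult_assoc1 K.m_assoc LF_closed\<close>)
  next
    fix s assume "s \<in> carrier T"
    then obtain a f where s: "s = (a, f)" and m: "a \<in> carrier A" "f \<in> LF" by (auto simp: T_simps)
    show "\<one>\<^bsub>K\<^esub> \<odot>\<^bsub>T\<^esub> s = s"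
      unfolding s T_smult[OF K.one_closed m] by (rule T_eqI) (use m in \<open>simp_all add: LF_closed\<close>)
  qed
  fix c s t assume c: "c \<in> carrier K" and "s \<in> carrier T" "t \<in> carrier T"
  then obtain a f b g where st: "s = (a, f)" "t = (b, g)"
    and m: "a \<in> carrier A" "f \<in> LF" "b \<in> carrier A" "g \<in> LF"
    by (auto simp: T_simps)
  have st': "c \<odot>\<^bsub>T\<^esub> (s \<otimes>\<^bsub>T\<^esub> t) = (c \<odot> (a \<otimes> b), fsmult c (fadd (lact a g) (ract f b)))"
    unfolding st T_simps(2) by (rule T_smult) (use c m in simp_all)
  show "(c \<odot>\<^bsub>T\<^esub> s) \<otimes>\<^bsub>T\<^esub> t = c \<odot>\<^bsub>T\<^esub> (s \<otimes>\<^bsub>T\<^esub> t)"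
    unfolding st' unfolding st T_smult[OF c m(1,2)] T_simps
    by (rule T_eqI) (use c m in \<open>simp_all add: smult_mult_left smult_mult_right linear_functionalsD K.r_distr\<close>)
  show "s \<otimes>\<^bsub>T\<^esub> (c \<odot>\<^bsub>T\<^esub> t) = c \<odot>\<^bsub>T\<^esub> (s \<otimes>\<^bsub>T\<^esub> t)"
    unfolding st' unfolding st T_smult[OF c m(3,4)] T_simps
    by (rule T_eqI) (use c m in \<open>simp_all add: smult_mult_left smult_mult_right linear_functionalsD K.r_distr \<sigma>_smult\<close>)
qed

text \<open>Functionals of degree t live on the component of degree l + 1 - t. The form
  \<open>s + t\<close> avoids truncated subtraction, and for t = 0 or t > l + 1 the set is zero by
  itself, so that the cases of \<open>twisted_grading\<close> merge into the single formula
  \<open>TG_eq\<close>.\<close>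

definition Dt :: "nat \<Rightarrow> ('a \<Rightarrow> 'k) set" where
  "Dt t = {f \<in> LF. \<forall>s. s + t \<noteq> l + 1 \<longrightarrow> (\<forall>x\<in>G s. f x = \<zero>\<^bsub>K\<^esub>)}"

lemma DtD: "f \<in> Dt t \<Longrightarrow> f \<in> LF" "f \<in> Dt t \<Longrightarrow> x \<in> G s \<Longrightarrow> s + t \<noteq> l + 1 \<Longrightarrow> f x = \<zero>\<^bsub>K\<^esub>"
  by (auto simp: Dt_def)

lemma LF_eqI_homogeneous:
  assumes f: "f \<in> LF" "g \<in> LF" and eq: "\<And>s x. x \<in> G s \<Longrightarrow> f x = g x"
  shows "f = g"
proof (rule LF_eqI[OF f])
  show "f x = g x" if "x \<in> carrier A" for x
    using that
  proof (induction x rule: AG.additive_pr_induct)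
    case (homogeneous t x)
    then show ?case by (rule eq)
  next
    case (add x y)
    then show ?case using linear_functionalsD(2)[OF f(1)] linear_functionalsD(2)[OF f(2)] by simp
  qed
qed

lemma fzero_Dt [simp]: "fzero \<in> Dt t"
  unfolding Dt_def using AG.component_closed by auto

lemma Dt_eq_fzero:
  assumes "t = 0 \<or> l + 1 < t" shows "Dt t = {fzero}"
proof (intro equalityI subsetI)
  fix f assume f: "f \<in> Dt t"
  have "f x = fzero x" if x: "x \<in> G s" for s x
  proof (cases "s + t = l + 1")
    case True
    then have "s = l + 1" using assms by auto
    then have "x = \<zero>" using x above_l[of s] by simp
    then show ?thesis using LF_zero[OF DtD(1)[OF f]] by simp
  next
    case False
    then show ?thesis using DtD(2)[OF f x] AG.component_closed[OF x] by simp
  qed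
  then have "f = fzero" by (rule LF_eqI_homogeneous[OF DtD(1)[OF f] fzero_LF])
  then show "f \<in> {fzero}" by simp
qed simp

lemma dual_component_eq:
  assumes "t \<le> l + 1" shows "dual_component K A G (l + 1 - t) = Dt t"
proof -
  have "s \<noteq> l + 1 - t \<longleftrightarrow> s + t \<noteq> l + 1" for s using assms by auto
  then show ?thesis unfolding dual_component_def Dt_def by (simp only:)
qed

lemma TG_eq: "TG t = G t \<times> Dt t"
proof -
  consider "t = 0" | "1 \<le> t" "t \<le> l" | "t = l + 1" | "l + 1 < t" by linarith
  then show ?thesis
  proof cases
    case 1
    then show ?thesis by (simp add: twisted_grading_def Dt_eq_fzero DA_simps)
  next
    case 2
    then show ?thesis using dual_component_eq[of t] by (simp add: twisted_grading_def)
  next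
    case 3
    then show ?thesis using dual_component_eq[of t] above_l[of t] by (simp add: twisted_grading_def)
  next
    case 4
    then show ?thesis using above_l[of t] by (simp add: twisted_grading_def Dt_eq_fzero DA_simps)
  qed
qed

lemma fadd_Dt: "f \<in> Dt t \<Longrightarrow> g \<in> Dt t \<Longrightarrow> fadd f g \<in> Dt t"
  unfolding Dt_def using AG.component_closed by auto

lemma fsmult_Dt: "c \<in> carrier K \<Longrightarrow> f \<in> Dt t \<Longrightarrow> fsmult c f \<in> Dt t"
  unfolding Dt_def using AG.component_closed by auto

lemma T_minus:
  assumes "a \<in> carrier A" "f \<in> LF" shows "\<ominus>\<^bsub>T\<^esub> (a, f) = (\<ominus> a, fsmult (\<ominus>\<^bsub>K\<^esub> \<one>\<^bsub>K\<^esub>) f)"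
proof (rule abelian_group.minus_equality[OF T_group])
  show "(\<ominus> a, fsmult (\<ominus>\<^bsub>K\<^esub> \<one>\<^bsub>K\<^esub>) f) \<oplus>\<^bsub>T\<^esub> (a, f) = \<zero>\<^bsub>T\<^esub>"
    unfolding T_simps by (rule T_eqI) (use assms in \<open>simp_all add: LF_closed A.l_neg K.l_neg K.l_minus\<close>)
qed (use assms in \<open>simp_all add: T_simps\<close>)

definition fpr :: "nat \<Rightarrow> ('a \<Rightarrow> 'k) \<Rightarrow> 'a \<Rightarrow> 'k" where
  "fpr r f = (\<lambda>x\<in>carrier A. f (AG.pr r x))"

lemma fpr_apply [simp]: "x \<in> carrier A \<Longrightarrow> fpr r f x = f (AG.pr r x)"
  by (simp add: fpr_def)

lemma fpr_LF [simp]: "f \<in> LF \<Longrightarrow> fpr r f \<in> LF"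
  unfolding fpr_def by (rule LF_restrictI) (simp_all add: linear_functionalsD AG.pr_add pr_smult)

text \<open>The guard matters above l + 1, where truncated subtraction would return the part of f in
  degree 0. In degree 0 the functional part vanishes because \<open>G (l + 1)\<close> does.\<close>

definition prT :: "nat \<Rightarrow> 'a \<times> ('a \<Rightarrow> 'k) \<Rightarrow> 'a \<times> ('a \<Rightarrow> 'k)" where
  "prT t = (\<lambda>(a, f). (AG.pr t a, if t \<le> l + 1 then fpr (l + 1 - t) f else fzero))"

lemma T_decomposition:
  shows T_direct_sum: "direct_sum_decomposition T TG"
    and T_pr: "x \<in> carrier T \<Longrightarrow> hom_component T TG t x = prT t x"
proof -
  have sub: "additive_subgroup (TG t) T" for t
  proof (rule additive_subgroupI'[OF T_group])
    show "TG t \<subseteq> carrier T" using AG.component_closed DtD(1) by (auto simp: TG_eq T_simps)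
    show "\<zero>\<^bsub>T\<^esub> \<in> TG t" by (simp add: TG_eq T_simps)
    show "x \<oplus>\<^bsub>T\<^esub> y \<in> TG t" if "x \<in> TG t" "y \<in> TG t" for x y
      using that by (auto simp: TG_eq T_simps AG.component_add fadd_Dt)
    show "\<ominus>\<^bsub>T\<^esub> x \<in> TG t" if "x \<in> TG t" for x
      using that by (auto simp: TG_eq T_minus AG.component_minus fsmult_Dt AG.component_closed DtD(1))
  qed
  have add: "prT t (x \<oplus>\<^bsub>T\<^esub> y) = prT t x \<oplus>\<^bsub>T\<^esub> prT t y" if xyT: "x \<in> carrier T" "y \<in> carrier T" for t x y
  proof -
    obtain a f b g where xy: "x = (a, f)" "y = (b, g)"
      and m: "a \<in> carrier A" "f \<in> LF" "b \<in> carrier A" "g \<in> LF"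
      using xyT by (auto simp: T_simps)
    show ?thesis
      unfolding xy prT_def T_simps prod.case
      by (rule T_eqI) (use m in \<open>simp_all add: AG.pr_add LF_closed\<close>)
  qed
  have p_in: "prT t x \<in> TG t" if xT: "x \<in> carrier T" for t x
  proof -
    obtain a f where x: "x = (a, f)" and m: "a \<in> carrier A" "f \<in> LF"
      using xT by (auto simp: T_simps)
    have "fpr (l + 1 - t) f \<in> Dt t" if t: "t \<le> l + 1"
      unfolding Dt_def
    proof (intro CollectI conjI allI impI ballI fpr_LF m)
      fix s y assume "s + t \<noteq> l + 1" and y: "y \<in> G s"
      then have "l + 1 - t \<noteq> s" using t by auto
      then show "fpr (l + 1 - t) f y = \<zero>\<^bsub>K\<^esub>"
        using AG.pr_homogeneous[OF y] AG.component_closed[OF y] LF_zero[OF m(2)] by simp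
    qed
    then show ?thesis using m by (simp add: x prT_def TG_eq AG.pr_in)
  qed
  have p_hom: "prT t x = (if t = s then x else \<zero>\<^bsub>T\<^esub>)" if xs: "x \<in> TG s" for s t x
  proof -
    obtain a f where x: "x = (a, f)" and a: "a \<in> G s" and f: "f \<in> Dt s"
      using xs by (auto simp: TG_eq)
    note fLF = DtD(1)[OF f]
    have "(if t \<le> l + 1 then fpr (l + 1 - t) f else fzero) = (if t = s then f else fzero)"
    proof (rule LF_eqI_homogeneous)
      fix r y assume y: "y \<in> G r"
      note yc = AG.component_closed[OF y]
      show "(if t \<le> l + 1 then fpr (l + 1 - t) f else fzero) y = (if t = s then f else fzero) y"
      proof (cases "t \<le> l + 1")
        case True
        have "f y = \<zero>\<^bsub>K\<^esub>" if "r + s \<noteq> l + 1" using DtD(2)[OF f y that] .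
        moreover have "l + 1 - t = r \<longleftrightarrow> r + t = l + 1" using True by auto
        ultimately show ?thesis
          using True yc AG.pr_homogeneous[OF y, of "l + 1 - t"] LF_zero[OF fLF]
          by (cases "r + t = l + 1"; cases "t = s") auto
      next
        case False
        have "f = fzero" if "t = s" using f Dt_eq_fzero[of s] that False by simp
        then show ?thesis using False by auto
      qed
    qed (use fLF in simp_all)
    then show ?thesis
      unfolding x prT_def using AG.pr_homogeneous[OF a] by (simp add: T_simps)
  qed
  have fin: "\<exists>S. finite S \<and> (\<forall>t. t \<notin> S \<longrightarrow> prT t x = \<zero>\<^bsub>T\<^esub>) \<and> (\<Oplus>\<^bsub>T\<^esub>t\<in>S. prT t x) = x" if xT: "x \<in> carrier T" for x
  proof -
    obtain a f where x: "x = (a, f)" and m: "a \<in> carrier A" "f \<in> LF"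
      using xT by (auto simp: T_simps)
    have pr_above: "AG.pr t y = \<zero>" if "l + 1 < t" "y \<in> carrier A" for t y
      using AG.pr_in[OF that(2), of t] above_l[of t] that(1) by simp
    have pc: "(\<lambda>t. prT t x) \<in> {..l + 1} \<rightarrow> carrier T"
      using p_in[OF xT] additive_subgroup.a_subset[OF sub] by blast
    have out: "prT t x = \<zero>\<^bsub>T\<^esub>" if "t \<notin> {..l + 1}" for t
      using that pr_above[of t a] m by (simp add: x prT_def T_simps)
    have sum_pr: "(\<Oplus>t\<in>{..l + 1}. AG.pr t y) = y" if "y \<in> carrier A" for y
      by (rule AG.sum_pr) (use pr_above that in \<open>auto simp: not_le[symmetric]\<close>)
    let ?s = "\<Oplus>\<^bsub>T\<^esub>t\<in>{..l + 1}. prT t x"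
    have sT: "?s \<in> carrier T"
      using pc by (intro abelian_monoid.finsum_closed abelian_group.axioms(1) T_group)
    have "fst ?s = (\<Oplus>t\<in>{..l + 1}. fst (prT t x))"
      by (rule additive_finsum[OF T_group A_group _ _ pc]) (auto simp: T_simps)
    then have 1: "fst ?s = a" using sum_pr[OF m(1)] by (simp add: x prT_def)
    have 2: "snd ?s y = f y" if y: "y \<in> carrier A" for y
    proof -
      \<comment> \<open>Evaluating the functional part at y is an additive map from \<open>T\<close>
        to \<open>K\<close>, so the sum can be computed in the field.\<close>
      have "snd ?s y = (\<Oplus>\<^bsub>K\<^esub>t\<in>{..l + 1}. snd (prT t x) y)"
        by (rule additive_finsum[OF T_group K.abelian_group_axioms _ _ pc, where f = "\<lambda>t. snd t y"])
          (use y in \<open>auto simp: T_simps LF_closed\<close>)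
      also have "\<dots> = (\<Oplus>\<^bsub>K\<^esub>t\<in>{..l + 1}. f (AG.pr (l + 1 - t) y))"
        by (rule K.finsum_cong') (use y m in \<open>auto simp: x prT_def LF_closed\<close>)
      also have "\<dots> = f (\<Oplus>t\<in>{..l + 1}. AG.pr (l + 1 - t) y)"
        by (rule additive_finsum[OF A_group K.abelian_group_axioms, symmetric])
          (use m y in \<open>auto simp: linear_functionalsD\<close>)
      \<comment> \<open>Dualising reverses degrees, and t \<mapsto> l + 1 - t permutes the range of
        summation.\<close>
      also have "(\<Oplus>t\<in>{..l + 1}. AG.pr (l + 1 - t) y) = (\<Oplus>t\<in>(\<lambda>t. l + 1 - t) ` {..l + 1}. AG.pr t y)"
        by (rule A.finsum_reindex[symmetric]) (use y in \<open>auto simp: inj_on_def\<close>)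
      also have "(\<lambda>t. l + 1 - t) ` {..l + 1} = {..l + 1}"
      proof (intro equalityI subsetI)
        show "r \<in> (\<lambda>t. l + 1 - t) ` {..l + 1}" if "r \<in> {..l + 1}" for r
          by (rule image_eqI[of _ _ "l + 1 - r"]) (use that in simp_all)
      qed (clarsimp)
      also have "(\<Oplus>t\<in>{..l + 1}. AG.pr t y) = y" by (rule sum_pr[OF y])
      finally show ?thesis .
    qed
    have "?s = x"
    proof -
      have "(fst ?s, snd ?s) = (a, f)"
        by (rule T_eqI) (use 1 2 m sT in \<open>auto simp: T_simps\<close>)
      then show ?thesis by (simp add: x)
    qed
    then show ?thesis using out by blast
  qed
  show "direct_sum_decomposition T TG"
    by (rule direct_sum_decompositionI(1)[OF T_group sub add p_in p_hom fin])
  show "hom_component T TG t x = prT t x" if "x \<in> carrier T"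
    by (rule direct_sum_decompositionI(2)[OF T_group sub add p_in p_hom fin that])
qed

section \<open>Generators, idempotents and the graded algebra axioms\<close>

abbreviation "eT \<equiv> \<lambda>i. (e i, fzero)"

lemma \<phi>_LF [simp]: "\<phi> \<in> LF"
  by (rule \<phi>_functional)

text \<open>Degree l is dual to degree (l + 1) - l = 1: this is what makes x a generator of degree
  one.\<close>

lemma \<phi>_Dt: "\<phi> \<in> Dt 1"
proof -
  have "\<phi> x = \<zero>\<^bsub>K\<^esub>" if "x \<in> G s" "s + 1 \<noteq> l + 1" for s x
    by (rule \<phi>_degree[OF that(1)]) (use that(2) in simp)
  then show ?thesis unfolding Dt_def by simp
qed

lemma fsmult_fzero [simp]: "c \<in> carrier K \<Longrightarrow> fsmult c fzero = fzero"
  by (rule LF_eqI) simp_all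

lemma embed_mult:
  assumes "a \<in> carrier A" "b \<in> carrier A" shows "(a, fzero) \<otimes>\<^bsub>T\<^esub> (b, fzero) = (a \<otimes> b, fzero)"
  unfolding T_simps by (rule T_eqI) (use assms in simp_all)

lemma embed_finsum:
  assumes "g \<in> S \<rightarrow> carrier A" shows "(\<Oplus>\<^bsub>T\<^esub>i\<in>S. (g i, fzero)) = (\<Oplus>i\<in>S. g i, fzero)"
proof (rule additive_finsum[OF A_group T_group, where f = "\<lambda>a. (a, fzero)", symmetric])
  show "(x \<oplus> y, fzero) = (x, fzero) \<oplus>\<^bsub>T\<^esub> (y, fzero)" if "x \<in> carrier A" "y \<in> carrier A" for x y
    unfolding T_simps by (rule T_eqI) simp_all
qed (use assms in \<open>simp_all add: T_simps\<close>)

lemma T_generated: "generate_ring T (TG 0 \<union> TG 1) = carrier T"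
proof (rule equalityI)
  have "TG t \<subseteq> carrier T" for t
    using AG.component_closed DtD(1) by (auto simp: TG_eq T_simps)
  then show "generate_ring T (TG 0 \<union> TG 1) \<subseteq> carrier T"
    by (intro ring.generate_ring_incl[OF T_ring]) blast
  let ?E = "generate_ring T (TG 0 \<union> TG 1)"
  have GA: "G 0 \<union> G 1 \<subseteq> carrier A" using AG.component_closed by blast
  have embed: "(a, fzero) \<in> ?E" if "a \<in> carrier A" for a
    using that unfolding generated[symmetric]
  proof (induction a rule: generate_ring.induct)
    case one
    show ?case using generate_ring.one[of T "TG 0 \<union> TG 1"] by (simp add: T_simps)
  next
    case (incl h)
    then show ?case by (intro generate_ring.incl) (auto simp: TG_eq)
  next
    case (a_inv h)
    have "h \<in> carrier A" using a_inv.hyps generated by simp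
    then have "\<ominus>\<^bsub>T\<^esub> (h, fzero) = (\<ominus> h, fzero)" by (simp add: T_minus)
    then show ?case using generate_ring.a_inv[OF a_inv.IH] by simp
  next
    case (eng_add h k)
    have "fadd fzero fzero = fzero" by (rule LF_eqI) simp_all
    then have "(h, fzero) \<oplus>\<^bsub>T\<^esub> (k, fzero) = (h \<oplus> k, fzero)" by (simp add: T_simps)
    then show ?case using generate_ring.eng_add[OF eng_add.IH] by simp
  next
    case (eng_mult h k)
    have "h \<in> carrier A" "k \<in> carrier A" using eng_mult.hyps generated by simp_all
    then have "(h, fzero) \<otimes>\<^bsub>T\<^esub> (k, fzero) = (h \<otimes> k, fzero)" by (rule embed_mult)
    then show ?case using generate_ring.eng_mult[OF eng_mult.IH] by simp
  qed
  have \<phi>E: "(\<zero>, \<phi>) \<in> ?E"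
    by (rule generate_ring.incl) (use \<phi>_Dt in \<open>simp add: TG_eq\<close>)
  show "carrier T \<subseteq> ?E"
  proof
    fix t assume "t \<in> carrier T"
    then obtain a f where t: "t = (a, f)" and m: "a \<in> carrier A" "f \<in> LF" by (auto simp: T_simps)
    \<comment> \<open>The dual is generated by \<phi> as a left module, so one element of degree one
      supplies the whole second summand.\<close>
    obtain b where b: "b \<in> carrier A" "f = lact b \<phi>"
      using functional_right[OF m(2)] unfolding lact_def by blast
    have "(b, fzero) \<otimes>\<^bsub>T\<^esub> (\<zero>, \<phi>) = (\<zero>, f)"
      unfolding T_simps by (rule T_eqI) (use b m in \<open>simp_all add: LF_closed\<close>)
    then have "(\<zero>, f) \<in> ?E" using generate_ring.eng_mult[OF embed[OF b(1)] \<phi>E] by simp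
    moreover have "(a, fzero) \<oplus>\<^bsub>T\<^esub> (\<zero>, f) = t"
      unfolding t T_simps by (rule T_eqI) (use m in \<open>simp_all add: LF_closed\<close>)
    ultimately show "t \<in> ?E" using generate_ring.eng_add[OF embed[OF m(1)]] by metis
  qed
qed

text \<open>The dual is an ideal of square zero, so an idempotent inside it is zero. Hence a
  splitting of an idempotent of \<open>T\<close> into nonzero parts projects to such a splitting in
  \<open>A\<close>, and primitivity lifts.\<close>

lemma T_idempotent:
  assumes "idempotent_elem T (a, f)"
  shows "idempotent_elem A a" and "a = \<zero> \<Longrightarrow> (a, f) = \<zero>\<^bsub>T\<^esub>"
proof -
  have m: "a \<in> carrier A" "f \<in> LF" and aa: "a \<otimes> a = a" and ff: "fadd (lact a f) (ract f a) = f"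
    using assms by (auto simp: idempotent_elem_def T_simps)
  show "idempotent_elem A a" using m aa by (simp add: idempotent_elem_def)
  show "(a, f) = \<zero>\<^bsub>T\<^esub>" if a: "a = \<zero>"
    unfolding T_simps
  proof (rule T_eqI)
    fix x assume x: "x \<in> carrier A"
    have "f x = fadd (lact a f) (ract f a) x" using ff by simp
    also have "\<dots> = fzero x" using x a LF_zero[OF m(2)] by simp
    finally show "f x = fzero x" .
  qed (use m a in simp_all)
qed

lemma T_primitive:
  assumes i: "i \<in> {1..n}" shows "primitive_idempotent T (eT i)"
  unfolding primitive_idempotent_def
proof (intro conjI notI)
  have p: "primitive_idempotent A (e i)" by (rule primitive[OF i])
  show "idempotent_elem T (eT i)"
    using e_closed[OF i] e_idem[OF i] by (simp add: idempotent_elem_def embed_mult) (simp add: T_simps)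
  show False if "eT i = \<zero>\<^bsub>T\<^esub>"
    using that p by (simp add: T_simps primitive_idempotent_def)
  assume "\<exists>s t. idempotent_elem T s \<and> idempotent_elem T t \<and> s \<noteq> \<zero>\<^bsub>T\<^esub> \<and> t \<noteq> \<zero>\<^bsub>T\<^esub> \<and>
      s \<otimes>\<^bsub>T\<^esub> t = \<zero>\<^bsub>T\<^esub> \<and> t \<otimes>\<^bsub>T\<^esub> s = \<zero>\<^bsub>T\<^esub> \<and> eT i = s \<oplus>\<^bsub>T\<^esub> t"
  then obtain a f b g where s: "idempotent_elem T (a, f)" "(a, f) \<noteq> \<zero>\<^bsub>T\<^esub>"
    and t: "idempotent_elem T (b, g)" "(b, g) \<noteq> \<zero>\<^bsub>T\<^esub>"
    and st: "(a, f) \<otimes>\<^bsub>T\<^esub> (b, g) = \<zero>\<^bsub>T\<^esub>" "(b, g) \<otimes>\<^bsub>T\<^esub> (a, f) = \<zero>\<^bsub>T\<^esub>" "eT i = (a, f) \<oplus>\<^bsub>T\<^esub> (b, g)"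
    by auto
  have "a \<noteq> \<zero>" "b \<noteq> \<zero>" using T_idempotent(2) s t by blast+
  moreover have "a \<otimes> b = \<zero>" "b \<otimes> a = \<zero>" "e i = a \<oplus> b"
    using st by (simp_all add: T_simps)
  ultimately show False
    using p T_idempotent(1)[OF s(1)] T_idempotent(1)[OF t(1)] unfolding primitive_idempotent_def by blast
qed

lemma T_graded_algebra: "graded_algebra K T TG n eT"
proof (intro graded_algebra.intro graded_algebra_axioms.intro T_field_algebra vertices T_direct_sum
    T_generated T_primitive)
  show "c \<odot>\<^bsub>T\<^esub> x \<in> TG t" if "c \<in> carrier K" "x \<in> TG t" for c x t
    using that AG.component_closed DtD(1) by (auto simp: TG_eq T_smult component_smult fsmult_Dt)
  show "x \<otimes>\<^bsub>T\<^esub> y \<in> TG (s + t)" if xs: "x \<in> TG s" and yt: "y \<in> TG t" for x y s t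
  proof -
    obtain a f b g where xy: "x = (a, f)" "y = (b, g)" and a: "a \<in> G s" and f: "f \<in> Dt s"
      and b: "b \<in> G t" and g: "g \<in> Dt t"
      using xs yt by (auto simp: TG_eq)
    note ac = AG.component_closed[OF a] and bc = AG.component_closed[OF b]
    have "lact a g \<in> Dt (s + t)"
      unfolding Dt_def
    proof (intro CollectI conjI allI impI ballI)
      show "lact a g \<in> LF" using ac DtD(1)[OF g] by simp
      fix r z assume r: "r + (s + t) \<noteq> l + 1" and z: "z \<in> G r"
      show "lact a g z = \<zero>\<^bsub>K\<^esub>"
        using DtD(2)[OF g component_mult[OF z a]] r AG.component_closed[OF z] by (simp add: add.assoc)
    qed
    moreover have "ract f b \<in> Dt (s + t)"
      unfolding Dt_def
    proof (intro CollectI conjI allI impI ballI)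
      show "ract f b \<in> LF" using bc DtD(1)[OF f] by simp
      fix r z assume r: "r + (s + t) \<noteq> l + 1" and z: "z \<in> G r"
      have "t + r + s \<noteq> l + 1" using r by simp
      then show "ract f b z = \<zero>\<^bsub>K\<^esub>"
        using DtD(2)[OF f component_mult[OF \<sigma>_graded[OF b] z]] AG.component_closed[OF z] by simp
    qed
    ultimately show ?thesis
      unfolding xy T_simps TG_eq using component_mult[OF a b] by (simp add: fadd_Dt)
  qed
  show "eT i \<otimes>\<^bsub>T\<^esub> eT j = \<zero>\<^bsub>T\<^esub>" if "i \<in> {1..n}" "j \<in> {1..n}" "i \<noteq> j" for i j
    unfolding embed_mult[OF e_closed[OF that(1)] e_closed[OF that(2)]] orthogonal[OF that]
    by (simp add: T_simps)
  show "\<one>\<^bsub>T\<^esub> = (\<Oplus>\<^bsub>T\<^esub>i\<in>{1..n}. eT i)"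
    unfolding T_simps one_eq by (rule embed_finsum[symmetric]) auto
  have "(\<Oplus>\<^bsub>T\<^esub>i\<in>{1..n}. c i \<odot>\<^bsub>T\<^esub> eT i) = (\<Oplus>i\<in>{1..n}. c i \<odot> e i, fzero)"
    if c: "c \<in> {1..n} \<rightarrow> carrier K" for c
  proof -
    have cc: "c i \<odot>\<^bsub>T\<^esub> eT i = (c i \<odot> e i, fzero)" "c i \<odot> e i \<in> carrier A" if i: "i \<in> {1..n}" for i
      using funcset_mem[OF c i] e_closed[OF i] by (simp_all add: T_smult)
    have "(\<Oplus>\<^bsub>T\<^esub>i\<in>{1..n}. c i \<odot>\<^bsub>T\<^esub> eT i) = (\<Oplus>\<^bsub>T\<^esub>i\<in>{1..n}. (c i \<odot> e i, fzero))"
      by (rule abelian_monoid.finsum_cong'[OF abelian_group.axioms(1)[OF T_group]])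
        (use cc in \<open>auto simp: T_simps\<close>)
    also have "\<dots> = (\<Oplus>i\<in>{1..n}. c i \<odot> e i, fzero)"
      by (rule embed_finsum) (use cc in auto)
    finally show ?thesis .
  qed
  then show "TG 0 = {(\<Oplus>\<^bsub>T\<^esub>i\<in>{1..n}. c i \<odot>\<^bsub>T\<^esub> eT i) | c. c \<in> {1..n} \<rightarrow> carrier K}"
    unfolding TG_eq degree_zero Dt_eq_fzero[OF disjI1[OF refl]] by (auto intro: sym)
qed

section \<open>The coordinate \<beta> and the automorphism \<psi>\<close>

definition \<beta> :: "'a \<times> ('a \<Rightarrow> 'k) \<Rightarrow> 'a" where "\<beta> t = inv_into (carrier A) (ract \<phi>) (snd t)"

text \<open>Solves a x = x \<psi>(a) for x = \<phi>. Since the right action is twisted, \<psi>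
  followed by \<sigma> is the Nakayama automorphism of the form, as \<open>\<phi>_\<psi>\<close>
  shows.\<close>

definition \<psi> :: "'a \<Rightarrow> 'a" where "\<psi> a = inv_into (carrier A) (ract \<phi>) (lact a \<phi>)"

text \<open>Freeness of the twisted dual on \<phi> as a right module: \<open>left_cancel\<close> and
  \<open>functional_left\<close> give this without the twist, and \<sigma> is bijective.\<close>

lemma ract_\<phi>_bij: "bij_betw (ract \<phi>) (carrier A) LF"
proof (rule bij_betw_imageI)
  show "inj_on (ract \<phi>) (carrier A)"
  proof (rule inj_onI)
    fix b b' assume b: "b \<in> carrier A" "b' \<in> carrier A" and eq: "ract \<phi> b = ract \<phi> b'"
    have "\<sigma> b = \<sigma> b'"
    proof (rule left_cancel)
      show "\<phi> (\<sigma> b \<otimes> x) = \<phi> (\<sigma> b' \<otimes> x)" if "x \<in> carrier A" for x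
        using fun_cong[OF eq, of x] that by simp
    qed (use b in simp_all)
    then show "b = b'" using \<sigma>_inj b by blast
  qed
  show "ract \<phi> ` carrier A = LF"
  proof (intro equalityI subsetI)
    show "f \<in> LF" if "f \<in> ract \<phi> ` carrier A" for f using that by auto
    fix f assume "f \<in> LF"
    then obtain b where b: "b \<in> carrier A" "f = (\<lambda>x\<in>carrier A. \<phi> (b \<otimes> x))"
      using functional_left by blast
    obtain c where "c \<in> carrier A" "b = \<sigma> c" using b(1) bij_betw_imp_surj_on[OF \<sigma>_bij] by blast
    then show "f \<in> ract \<phi> ` carrier A" using b(2) by (auto simp: ract_def)
  qed
qed

lemma \<beta>_closed [simp]: "f \<in> LF \<Longrightarrow> \<beta> (a, f) \<in> carrier A"
  and ract_\<beta>: "f \<in> LF \<Longrightarrow> ract \<phi> (\<beta> (a, f)) = f"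
  using bij_betw_imp_surj_on[OF ract_\<phi>_bij] inv_into_into[of f "ract \<phi>" "carrier A"]
    f_inv_into_f[of f "ract \<phi>" "carrier A"]
  by (simp_all add: \<beta>_def)

lemma \<psi>_closed [simp]: "a \<in> carrier A \<Longrightarrow> \<psi> a \<in> carrier A"
  and ract_\<psi>: "a \<in> carrier A \<Longrightarrow> ract \<phi> (\<psi> a) = lact a \<phi>"
  using \<beta>_closed[of "lact a \<phi>" a] ract_\<beta>[of "lact a \<phi>" a] by (simp_all add: \<beta>_def \<psi>_def)

lemma ract_eqI:
  assumes "b \<in> carrier A" "b' \<in> carrier A" "\<And>x. x \<in> carrier A \<Longrightarrow> ract \<phi> b x = ract \<phi> b' x"
  shows "b = b'"
proof -
  have "ract \<phi> b = ract \<phi> b'" by (rule LF_eqI) (use assms in simp_all)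
  then show ?thesis using inj_onD[OF bij_betw_imp_inj_on[OF ract_\<phi>_bij]] assms by blast
qed

lemma \<phi>_\<beta>: "f \<in> LF \<Longrightarrow> x \<in> carrier A \<Longrightarrow> \<phi> (\<sigma> (\<beta> (a, f)) \<otimes> x) = f x"
  using fun_cong[OF ract_\<beta>[of f a], of x] by simp

lemma \<phi>_\<psi>: "a \<in> carrier A \<Longrightarrow> x \<in> carrier A \<Longrightarrow> \<phi> (\<sigma> (\<psi> a) \<otimes> x) = \<phi> (x \<otimes> a)"
  using fun_cong[OF ract_\<psi>[of a], of x] by simp

lemma \<psi>_ring_iso: "\<psi> \<in> ring_iso A A"
proof -
  have "\<psi> \<in> ring_hom A A"
  proof (rule ring_hom_memI)
    fix a b assume ab: "a \<in> carrier A" "b \<in> carrier A"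
    show "\<psi> (a \<otimes> b) = \<psi> a \<otimes> \<psi> b"
    proof (rule ract_eqI)
      fix x assume x: "x \<in> carrier A"
      \<comment> \<open>First a and then b is moved around the form, so they arrive at the right end
        in their original order.\<close>
      have "\<phi> (\<sigma> (\<psi> a) \<otimes> (\<sigma> (\<psi> b) \<otimes> x)) = \<phi> (\<sigma> (\<psi> b) \<otimes> (x \<otimes> a))"
        using ab x by (simp add: \<phi>_\<psi> A.m_assoc)
      also have "\<dots> = \<phi> (x \<otimes> (a \<otimes> b))"
        using ab x by (simp add: \<phi>_\<psi> A.m_assoc)
      finally show "ract \<phi> (\<psi> (a \<otimes> b)) x = ract \<phi> (\<psi> a \<otimes> \<psi> b) x"
        using ab x by (simp add: \<phi>_\<psi> \<sigma>_mult A.m_assoc)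
    qed (use ab in simp_all)
    show "\<psi> (a \<oplus> b) = \<psi> a \<oplus> \<psi> b"
      by (rule ract_eqI) (use ab in \<open>simp_all add: \<phi>_\<psi> \<sigma>_add A.l_distr A.r_distr \<phi>_add\<close>)
  next
    show "\<psi> \<one> = \<one>" by (rule ract_eqI) (simp_all add: \<phi>_\<psi>)
  qed simp
  moreover have "bij_betw \<psi> (carrier A) (carrier A)"
  proof (rule bij_betw_imageI)
    show "inj_on \<psi> (carrier A)"
    proof (rule inj_onI)
      fix a b assume ab: "a \<in> carrier A" "b \<in> carrier A" "\<psi> a = \<psi> b"
      show "a = b"
      proof (rule right_cancel)
        fix x assume "x \<in> carrier A"
        then show "\<phi> (x \<otimes> a) = \<phi> (x \<otimes> b)" using ab \<phi>_\<psi>[of a x] \<phi>_\<psi>[of b x] by simp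
      qed (use ab in simp_all)
    qed
    show "\<psi> ` carrier A = carrier A"
    proof (intro equalityI subsetI)
      show "b \<in> carrier A" if "b \<in> \<psi> ` carrier A" for b using that by auto
      fix b assume b: "b \<in> carrier A"
      \<comment> \<open>\<phi> generates the dual from the left as well, so
        \<open>ract \<phi> b\<close> is also a left multiple of \<phi>.\<close>
      then obtain a where a: "a \<in> carrier A" "ract \<phi> b = lact a \<phi>"
        using functional_right[of "ract \<phi> b"] unfolding lact_def by auto
      have "b = \<psi> a" by (rule ract_eqI) (use a b fun_cong[OF a(2)] ract_\<psi> in simp_all)
      then show "b \<in> \<psi> ` carrier A" using a(1) by blast
    qed
  qed
  ultimately show ?thesis by (simp add: ring_iso_def)
qed

lemma \<psi>_graded: assumes a: "a \<in> G k" shows "\<psi> a \<in> G k"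
proof (rule \<sigma>_graded_iff)
  note ac = AG.component_closed[OF a]
  show "\<psi> a \<in> carrier A" using ac by simp
  show "\<sigma> (\<psi> a) \<in> G k"
  proof (rule homogeneous_if_\<phi>_vanishes)
    show "\<phi> (\<sigma> (\<psi> a) \<otimes> x) = \<zero>\<^bsub>K\<^esub>" if "x \<in> G s" "k + s \<noteq> l" for s x
      using \<phi>_degree[OF component_mult[OF that(1) a]] that ac AG.component_closed[OF that(1)]
      by (simp add: \<phi>_\<psi> add.commute)
  qed (use ac in simp)
qed

text \<open>Since f is \<phi> times its coordinate and \<phi> has degree one, the coordinate has one
  degree less.\<close>

lemma \<beta>_graded:
  assumes f: "f \<in> Dt (Suc k)" shows "\<beta> (a, f) \<in> G k"
proof (rule \<sigma>_graded_iff)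
  note fLF = DtD(1)[OF f]
  show "\<beta> (a, f) \<in> carrier A" using fLF by simp
  show "\<sigma> (\<beta> (a, f)) \<in> G k"
  proof (rule homogeneous_if_\<phi>_vanishes)
    show "\<phi> (\<sigma> (\<beta> (a, f)) \<otimes> x) = \<zero>\<^bsub>K\<^esub>" if "x \<in> G s" "k + s \<noteq> l" for s x
      using DtD(2)[OF f that(1)] that(2) \<phi>_\<beta>[OF fLF AG.component_closed[OF that(1)]] by simp
  qed (use fLF in simp)
qed

lemma T_skew_extension: "skew_extension A T G TG fst \<beta> (\<lambda>a b. (a, ract \<phi> b)) \<psi>"
proof (intro skew_extension.intro skew_extension_axioms.intro A.ring_axioms T_ring decomposition
    T_direct_sum \<psi>_ring_iso \<psi>_graded)
  show "fst t \<in> carrier A" "\<beta> t \<in> carrier A" if "t \<in> carrier T" for t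
    using that by (auto simp: T_simps)
  show "fst (t \<oplus>\<^bsub>T\<^esub> v) = fst t \<oplus> fst v" "fst (t \<otimes>\<^bsub>T\<^esub> v) = fst t \<otimes> fst v"
    if "t \<in> carrier T" "v \<in> carrier T" for t v
    using that by (auto simp: T_simps)
  fix t v assume "t \<in> carrier T" "v \<in> carrier T"
  then obtain a f b g where tv: "t = (a, f)" "v = (b, g)"
    and m: "a \<in> carrier A" "f \<in> LF" "b \<in> carrier A" "g \<in> LF"
    by (auto simp: T_simps)
  show "\<beta> (t \<oplus>\<^bsub>T\<^esub> v) = \<beta> t \<oplus> \<beta> v"
    unfolding tv T_simps
    by (rule ract_eqI) (use m in \<open>simp_all add: \<phi>_\<beta> \<sigma>_add A.l_distr \<phi>_add\<close>)
  \<comment> \<open>The functional part a g + f b equals a x \<beta>(v) + x \<beta>(t) b with x =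
    \<phi>, and a x = x \<psi>(a).\<close>
  show "\<beta> (t \<otimes>\<^bsub>T\<^esub> v) = \<psi> (fst t) \<otimes> \<beta> v \<oplus> \<beta> t \<otimes> fst v"
    unfolding tv T_simps
    by (rule ract_eqI) (use m in \<open>simp_all add: \<phi>_\<beta> \<phi>_\<psi> \<sigma>_add \<sigma>_mult A.l_distr A.m_assoc \<phi>_add\<close>)
  show "(fst t, ract \<phi> (\<beta> t)) = t" using m by (simp add: tv ract_\<beta>)
  show "hom_component T TG 0 t = (hom_component A G 0 (fst t), ract \<phi> \<zero>)"
  proof -
    \<comment> \<open>The degree-zero part of f is its restriction to \<open>G (l + 1)\<close>,
      which is zero.\<close>
    have "fpr (l + 1) f x = ract \<phi> \<zero> x" if x: "x \<in> carrier A" for x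
      using AG.pr_in[OF x, of "l + 1"] above_l[of "l + 1"] x LF_zero[OF m(2)] by simp
    then have "fpr (l + 1) f = ract \<phi> \<zero>" by (intro LF_eqI) (simp_all add: m)
    moreover have "hom_component T TG 0 t = prT 0 t" using m by (intro T_pr) (simp add: tv T_simps)
    ultimately show ?thesis
      by (simp add: tv prT_def)
  qed
next
  show "fst \<one>\<^bsub>T\<^esub> = \<one>" by (simp add: T_simps)
  show "\<beta> \<one>\<^bsub>T\<^esub> = \<zero>"
    unfolding T_simps by (rule ract_eqI) (simp_all add: \<phi>_\<beta>)
  fix a b assume ab: "a \<in> carrier A" "b \<in> carrier A"
  show "(a, ract \<phi> b) \<in> carrier T" using ab by (simp add: T_simps)
  show "fst (a, ract \<phi> b) = a" by simp
  show "\<beta> (a, ract \<phi> b) = b" by (rule ract_eqI) (use ab in \<open>simp_all add: \<phi>_\<beta>\<close>)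
next
  show "fst t \<in> G k" if "t \<in> TG k" for t k using that by (auto simp: TG_eq)
  show "\<beta> t = \<zero>" if t: "t \<in> TG 0" for t
  proof -
    obtain a where "t = (a, fzero)" using t by (auto simp: TG_eq Dt_eq_fzero)
    then show ?thesis by (simp only:) (rule ract_eqI, simp_all add: \<phi>_\<beta>)
  qed
  show "\<beta> t \<in> G k" if "t \<in> TG (Suc k)" for t k using that \<beta>_graded by (auto simp: TG_eq)
  have "ract \<phi> \<zero> = fzero" by (rule LF_eqI) simp_all
  then show "TG 0 = (\<lambda>a. (a, ract \<phi> \<zero>)) ` G 0" by (auto simp: TG_eq Dt_eq_fzero)
qed

lemma T_koszul:
  assumes "has_linear_resolution A G"
  shows "koszul_algebra K T TG n (\<lambda>i. (e i, \<zero>\<^bsub>DA\<^esub>))"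
proof -
  have "\<one> \<noteq> \<zero>"
  proof
    assume 1: "\<one> = \<zero>"
    have "1 \<in> {1..n}" using vertices by simp
    then have "e 1 \<noteq> \<zero>" "e 1 \<in> carrier A" using primitive by (auto simp: primitive_idempotent_def)
    then show False using 1 A.l_one[of "e 1"] by simp
  qed
  then have "\<one>\<^bsub>T\<^esub> \<noteq> \<zero>\<^bsub>T\<^esub>" by (simp add: T_simps)
  \<comment> \<open>The injection only codes carriers in the type of elements of \<open>T\<close>;
    its values need not lie in \<open>carrier T\<close>, whence the arbitrary second
    component.\<close>
  then have "has_linear_resolution T TG"
    using skew_extension.linear_resolution[OF T_skew_extension, of "\<lambda>a. (a, undefined)"] assms
    by (auto simp: inj_def)
  then show ?thesis using T_graded_algebra by (simp add: koszul_algebra_def DA_simps)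
qed

end

theorem corollary3p3:
  fixes K :: "('k, 'c) ring_scheme" and \<Lambda> :: "('k, 'a) module"
    and G :: "nat \<Rightarrow> 'a set" and n l :: nat and e :: "nat \<Rightarrow> 'a"
    and \<tau> :: "nat \<Rightarrow> nat" and \<sigma> :: "'a \<Rightarrow> 'a"
  assumes "koszul_self_injective_algebra K \<Lambda> G n e l \<tau>"
    and "graded_automorphism K \<Lambda> G \<sigma>"
  shows "koszul_algebra K (twisted_trivial_extension K \<Lambda> \<sigma>) (twisted_grading K \<Lambda> G l)
           n (\<lambda>i. (e i, \<zero>\<^bsub>dual_bimodule K \<Lambda>\<^esub>))"
proof -
  have *: "graded_algebra K \<Lambda> G n e" "has_linear_resolution \<Lambda> G" "finite_dimensional K \<Lambda>"
    "self_injective \<Lambda>" "stable_bound_quiver_algebra K \<Lambda> G n e l \<tau>"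
    using assms(1) by (auto simp: koszul_self_injective_algebra_def koszul_algebra_def)
  interpret twisted_extension K \<Lambda> G n e l \<tau> \<sigma>
    by (intro twisted_extension.intro stable_self_injective.intro graded_algebra_over.intro stable_self_injective_axioms.intro
        twisted_extension_axioms.intro * assms(2))
  show ?thesis by (rule T_koszul[OF *(2)])
qed

end
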